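(* Let $K=SU(4)$ with maximal torus $T$, 2-torsion subgroup $T_2\subset T$ and coroot lattice $\Phi$, and let $\chi:T_2\cong\Phi/2\Phi\to\{\pm1\}$ be the nontrivial character satisfying $\chi([h_{\alpha_{1,2}}])=\chi([h_{\alpha_{3,4}}])=1$. Then the $\chi$-isotypical component $H^0(\mathcal{F}_1)^\chi$ is not free over $A$, and its Hilbert series is $$P_t(H^0(\mathcal{F}_1)^\chi)=\frac{2t^7+4t^8+2t^9+t^{10}+t^{11}-t^{12}-t^{13}}{(1-t^2)^3}.$$
   Context: Let $e_1,\dots,e_4$ be the standard basis of $\mathbb{C}^4$ with the standard pairing, $\mathfrak{t}=\mathrm{Lie}(T)\otimes\mathbb{C}=(e_1+e_2+e_3+e_4)^\perp\subset\mathbb{C}^4$, identified with $\mathfrak{t}^*$ by the pairing. The positive roots are $\alpha_{i,j}=e_i-e_j$, $i<j$, with coroots $h_{\alpha_{i,j}}=\alpha_{i,j}$; $\Phi=\mathrm{Span}_{\mathbb{Z}}\{h_\alpha\}$. The map $\xi\mapsto\exp(\pi i\xi)$ induces an isomorphism $\Phi/2\Phi\cong T_2$. $A=S(\mathfrak{t}^* )$ is graded with $\mathfrak{t}^*$ in degree 2, and $\wedge(\mathfrak{t}^* )$ with $\mathfrak{t}^*$ in degree 1; $M=\wedge(\mathfrak{t}^* )\otimes_{\mathbb{C}}A$ has the total grading. $S_\alpha$ is the automorphism of $\wedge(\mathfrak{t}^* )$ induced by the reflection in the root $\alpha$. $\mathcal{F}_1$ is the monodromy GKM-sheaf over the graph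 $\Gamma(K)$ with fibre $M$ and holonomy $S_\alpha\otimes\mathrm{Id}_A$ along edges labelled by $\alpha$. (It is isomorphic to the GKM-sheaf of $\{(k_0,k_1)\in K^2:k_0^2k_1^2=c\}$ for $c\in T$ with centralizer $T$.) Explicitly: let $\mathcal{V}$ be a set with a free transitive $T_2$-action; for each positive root $\alpha$ and $v\in\mathcal{V}$ there is an edge labelled $\alpha$ joining $v$ and $\exp(\pi i h_\alpha)v\ne v$. Then $H^0(\mathcal{F}_1)$ is the graded $A$-submodule of $\bigoplus_{v\in\mathcal{V}}M$ consisting of those $(a_v)$ such that for every edge $\{v,w\}$ labelled by $\alpha$ the pair $(a_v,a_w)$ is of the form $(m+\alpha n,\ (S_\alpha\otimes\mathrm{Id})(m)-\alpha (S_\alpha\otimes\mathrm{Id})(n))$ for some $m,n\in M$, where $\alpha$ acts through the factor $A$. $T_2$ acts by permuting the vertices (identically on the fibres $M$), and $H^0(\mathcal{F}_1)^\chi$ is the $\chi$-isotypical component. The Hilbert series of a graded module $N$ is $P_t(N)=\sum_i\dim_{\mathbb{C}}N^i\,t^i$. *)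

theory Defs
  imports
    "HOL-Analysis.Determinants"
    "HOL-Algebra.Group_Action"
    "HOL-Library.Poly_Mapping"
    "HOL-Library.Function_Algebras"
    "HOL-Computational_Algebra.Formal_Power_Series"
begin

section \<open>The group $SU(4)$, its torus, and roots\<close>

definition SU4 :: "(complex^4^4) set" where
  "SU4 = {U. U ** (\<chi> i j. cnj (U $ j $ i)) = mat 1 \<and> det U = 1}"

definition torus :: "(complex^4^4) set" where
  "torus = {U \<in> SU4. \<forall>i j. i \<noteq> j \<longrightarrow> U $ i $ j = 0}"

definition T2 :: "(complex^4^4) monoid" where
  "T2 = \<lparr>carrier = {U \<in> torus. U ** U = mat 1}, mult = (**), one = mat 1\<rparr>"

definition sign_group :: "complex monoid" where
  "sign_group = \<lparr>carrier = {1, -1}, mult = (*), one = 1\<rparr>"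

text \<open>
  Here the complex-bilinear pairing is needed; the library's inner product on \<open>complex^4\<close>
  is real-valued.  It identifies \<open>tt\<close> with its dual.
\<close>

definition pairing :: "complex^4 \<Rightarrow> complex^4 \<Rightarrow> complex" where
  "pairing v w = (\<Sum>i\<in>UNIV. v $ i * w $ i)"

text \<open>
  The index type \<open>4\<close> has the four elements \<open>1, 2, 3, 4\<close>, with \<open>4 = 0\<close>; roots are therefore
  numbered by natural numbers, for which \<open>i < j\<close> has the usual meaning.
\<close>

definition std_basis :: "nat \<Rightarrow> complex^4" where
  "std_basis i = axis (of_nat i) 1"

definition tt :: "(complex^4) set" where
  "tt = {v. pairing v (std_basis 1 + std_basis 2 + std_basis 3 + std_basis 4) = 0}"

definition root_vec :: "nat \<Rightarrow> nat \<Rightarrow> complex^4" where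
  "root_vec i j = std_basis i - std_basis j"

definition positive_roots :: "(complex^4) set" where
  "positive_roots = {root_vec i j | i j. 1 \<le> i \<and> i < j \<and> j \<le> 4}"

text \<open>Each root \<open>\<alpha>\<close> also denotes its coroot, since \<open>2 \<alpha> / pairing \<alpha> \<alpha> = \<alpha>\<close>.\<close>

definition reflection :: "complex^4 \<Rightarrow> complex^4 \<Rightarrow> complex^4" where
  "reflection \<alpha> v = v - (2 * pairing v \<alpha> / pairing \<alpha> \<alpha>) *s \<alpha>"

text \<open>The exponential \<open>exp (\<pi> \<i> \<xi>)\<close>, where \<open>\<xi>\<close> stands for the diagonal matrix with entries \<open>\<xi> $ k\<close>.\<close>

definition exp_pi_i :: "complex^4 \<Rightarrow> complex^4^4" where
  "exp_pi_i \<xi> = (\<chi> k l. if k = l then exp (of_real pi * \<i> * \<xi> $ k) else 0)"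


section \<open>Symmetric and exterior algebra\<close>

text \<open>
  Using the pairing, the dual of the Lie algebra is the subspace \<open>tt\<close> of \<open>complex^4\<close>.
  Accordingly its symmetric algebra is the subalgebra generated by \<open>tt\<close> in the symmetric
  algebra of \<open>complex^4\<close>, that is, in the polynomial ring in four variables, and its exterior
  algebra is the subalgebra generated by \<open>tt\<close> in the exterior algebra of \<open>complex^4\<close>.
\<close>

type_synonym poly4 = "(4 \<Rightarrow>\<^sub>0 nat) \<Rightarrow>\<^sub>0 complex"

definition Const :: "complex \<Rightarrow> poly4" where
  "Const c = Poly_Mapping.single 0 c"

definition Var :: "4 \<Rightarrow> poly4" where
  "Var i = Poly_Mapping.single (Poly_Mapping.single i 1) 1"

definition linear_form :: "complex^4 \<Rightarrow> poly4" where
  "linear_form v = (\<Sum>i\<in>UNIV. Const (v $ i) * Var i)"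

inductive_set sym_alg :: "poly4 set" where
  sym_alg_Const: "Const c \<in> sym_alg"
| sym_alg_linear_form: "v \<in> tt \<Longrightarrow> linear_form v \<in> sym_alg"
| sym_alg_add: "p \<in> sym_alg \<Longrightarrow> q \<in> sym_alg \<Longrightarrow> p + q \<in> sym_alg"
| sym_alg_mult: "p \<in> sym_alg \<Longrightarrow> q \<in> sym_alg \<Longrightarrow> p * q \<in> sym_alg"

text \<open>
  An element \<open>w\<close> of \<open>ext4\<close> represents the sum over all index sets \<open>I\<close> of \<open>e\<^sub>I \<otimes> (w $ I)\<close> in the tensor
  product of the exterior algebra of \<open>complex^4\<close> and the polynomial ring, where \<open>e\<^sub>I\<close> is the wedge
  product of the basis vectors indexed by \<open>I\<close>, in increasing order with respect to the linear
  order of the index type.  The exterior algebra itself consists of the elements with constant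
  coefficients.
\<close>

type_synonym ext4 = "poly4 ^ (4 set)"

text \<open>
  For disjoint \<open>I\<close> and \<open>J\<close>, the product of \<open>e\<^sub>I\<close> and \<open>e\<^sub>J\<close> is \<open>e\<^bsub>I \<union> J\<^esub>\<close> with the sign
  given by the number of pairs \<open>(i, j)\<close> in \<open>I \<times> J\<close> with \<open>j < i\<close>.
\<close>

definition wedge :: "ext4 \<Rightarrow> ext4 \<Rightarrow> ext4" where
  "wedge a b = (\<chi> K. \<Sum>I\<in>Pow K.
     (- 1) ^ card {(i, j). i \<in> I \<and> j \<in> K - I \<and> j < i} * a $ I * b $ (K - I))"

definition ext_vec :: "complex^4 \<Rightarrow> ext4" where
  "ext_vec v = (\<Sum>i\<in>UNIV. Const (v $ i) *s axis {i} 1)"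

definition wedge_list :: "(complex^4) list \<Rightarrow> ext4" where
  "wedge_list vs = foldr (\<lambda>v. wedge (ext_vec v)) vs (axis {} 1)"

text \<open>
  For a linear map \<open>f\<close>, this is the algebra endomorphism of the exterior algebra induced by \<open>f\<close>,
  tensored with the identity of the polynomial ring.
\<close>

definition ext_map :: "(complex^4 \<Rightarrow> complex^4) \<Rightarrow> ext4 \<Rightarrow> ext4" where
  "ext_map f w =
     (\<Sum>I\<in>UNIV. w $ I *s wedge_list (map (\<lambda>i. f (axis i 1)) (sorted_list_of_set I)))"

definition ext_scale :: "complex \<Rightarrow> ext4 \<Rightarrow> ext4" where
  "ext_scale c w = Const c *s w"

definition ext_alg :: "ext4 set" where
  "ext_alg = module.span ext_scale {wedge_list vs | vs. set vs \<subseteq> tt}"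

text \<open>\<open>fibre\<close> is the image of the tensor product of \<open>ext_alg\<close> and \<open>sym_alg\<close> under the inclusion.\<close>

definition fibre :: "ext4 set" where
  "fibre = module.span ext_scale {p *s w | p w. p \<in> sym_alg \<and> w \<in> ext_alg}"

text \<open>Total degree: vectors have degree 1 in the exterior and degree 2 in the symmetric algebra.\<close>

definition homogeneous :: "nat \<Rightarrow> ext4 set" where
  "homogeneous d = {w. \<forall>I m. Poly_Mapping.lookup (w $ I) m \<noteq> 0 \<longrightarrow>
     card I + 2 * (\<Sum>i\<in>UNIV. Poly_Mapping.lookup m i) = d}"


section \<open>Global sections of the GKM-sheaf\<close>

text \<open>
  Elements of the direct sum over the vertex set \<open>V\<close> are functions vanishing outside \<open>V\<close>.
\<close>

definition family_scale :: "poly4 \<Rightarrow> ('v \<Rightarrow> ext4) \<Rightarrow> 'v \<Rightarrow> ext4" where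
  "family_scale p a = (\<lambda>v. p *s a v)"

definition family_cscale :: "complex \<Rightarrow> ('v \<Rightarrow> ext4) \<Rightarrow> 'v \<Rightarrow> ext4" where
  "family_cscale c = family_scale (Const c)"

text \<open>
  The unordered edges labelled by \<open>\<alpha>\<close> are traversed in both directions.  This is harmless: the
  condition for the reversed edge is the same one, as one sees by replacing \<open>m\<close> and \<open>n\<close> by their
  images under the holonomy, up to sign.
\<close>

definition H0_F1 :: "'v set \<Rightarrow> (complex^4^4 \<Rightarrow> 'v \<Rightarrow> 'v) \<Rightarrow> ('v \<Rightarrow> ext4) set" where
  "H0_F1 V \<phi> = {a.
     (\<forall>v. v \<notin> V \<longrightarrow> a v = 0) \<and> (\<forall>v\<in>V. a v \<in> fibre) \<and>
     (\<forall>\<alpha>\<in>positive_roots. \<forall>v\<in>V. \<exists>m\<in>fibre. \<exists>n\<in>fibre.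
        a v = m + linear_form \<alpha> *s n \<and>
        a (\<phi> (exp_pi_i \<alpha>) v) =
          ext_map (reflection \<alpha>) m - linear_form \<alpha> *s ext_map (reflection \<alpha>) n)}"

definition translate ::
  "'v set \<Rightarrow> (complex^4^4 \<Rightarrow> 'v \<Rightarrow> 'v) \<Rightarrow> complex^4^4 \<Rightarrow> ('v \<Rightarrow> ext4) \<Rightarrow> 'v \<Rightarrow> ext4" where
  "translate V \<phi> g a = (\<lambda>v. if v \<in> V then a (\<phi> (inv\<^bsub>T2\<^esub> g) v) else 0)"

definition isotypical ::
  "'v set \<Rightarrow> (complex^4^4 \<Rightarrow> 'v \<Rightarrow> 'v) \<Rightarrow> (complex^4^4 \<Rightarrow> complex) \<Rightarrow> ('v \<Rightarrow> ext4) set \<Rightarrow> ('v \<Rightarrow> ext4) set"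
  where
  "isotypical V \<phi> chi N = {a \<in> N. \<forall>g\<in>carrier T2. translate V \<phi> g a = family_cscale (chi g) a}"

definition free_transitive ::
  "(complex^4^4) monoid \<Rightarrow> 'v set \<Rightarrow> (complex^4^4 \<Rightarrow> 'v \<Rightarrow> 'v) \<Rightarrow> bool" where
  "free_transitive G V \<phi> \<longleftrightarrow> V \<noteq> {} \<and> transitive_action G V \<phi> \<and>
     (\<forall>v\<in>V. stabilizer G \<phi> v = {\<one>\<^bsub>G\<^esub>})"


section \<open>Freeness and Hilbert series\<close>

text \<open>
  The submodule \<open>N\<close> is free over the subring \<open>R\<close>: it has a subset \<open>B\<close> such that every element of \<open>N\<close>
  is a linear combination of \<open>B\<close> with coefficients \<open>c\<close> in \<open>R\<close>, in a unique way.
\<close>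

definition free_over ::
  "'r::comm_ring_1 set \<Rightarrow> ('r \<Rightarrow> 'm \<Rightarrow> 'm::ab_group_add) \<Rightarrow> 'm set \<Rightarrow> bool" where
  "free_over R smul N \<longleftrightarrow> (\<exists>B\<subseteq>N. \<forall>x\<in>N. \<exists>!c.
     finite {b. c b \<noteq> 0} \<and> {b. c b \<noteq> 0} \<subseteq> B \<and> range c \<subseteq> R \<and>
     x = (\<Sum>b | c b \<noteq> 0. smul (c b) b))"

definition homogeneous_part :: "('v \<Rightarrow> ext4) set \<Rightarrow> nat \<Rightarrow> ('v \<Rightarrow> ext4) set" where
  "homogeneous_part N d = {a \<in> N. \<forall>v. a v \<in> homogeneous d}"

text \<open>
  The library's \<open>dim\<close> is 0 for spaces of infinite dimension; homogeneous parts are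
  finite-dimensional here, because \<open>V\<close> is finite in the presence of a free transitive action
  of \<open>T2\<close>.
\<close>

definition hilbert_series :: "('v \<Rightarrow> ext4) set \<Rightarrow> rat fps" where
  "hilbert_series N =
     Abs_fps (\<lambda>d. of_nat (vector_space.dim family_cscale (homogeneous_part N d)))"


section \<open>Well-definedness\<close>

lemma Const_add: "Const (c + d) = Const c + Const d"
  by (simp add: Const_def single_add)

lemma Const_mult: "Const (c * d) = Const c * Const d"
  by (simp add: Const_def mult_single)

lemma Const_one: "Const 1 = 1"
  by (simp add: Const_def)

lemma vector_space_ext_scale: "vector_space ext_scale"
  by unfold_locales
    (auto simp: ext_scale_def vec_eq_iff Const_add Const_mult Const_one algebra_simps)

lemma module_family_scale: "module family_scale"
  by unfold_locales (auto simp: family_scale_def fun_eq_iff vec_eq_iff algebra_simps)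

lemma vector_space_family_cscale: "vector_space family_cscale"
  by unfold_locales
    (auto simp: family_cscale_def family_scale_def fun_eq_iff vec_eq_iff
      Const_add Const_mult Const_one algebra_simps)

lemma torus_matrix_mult:
  assumes "A \<in> torus"
  shows "A ** B = (\<chi> i j. A $ i $ i * B $ i $ j)"
proof -
  have "(\<Sum>k\<in>UNIV. A $ i $ k * B $ k $ j) =
      (\<Sum>k\<in>UNIV. if k = i then A $ i $ i * B $ i $ j else 0)" for i j
    using assms by (intro sum.cong) (auto simp: torus_def)
  then show ?thesis by (simp add: matrix_matrix_mult_def vec_eq_iff)
qed

lemma mat_1_in_torus: "mat 1 \<in> torus"
proof -
  have "(\<chi> i j. cnj ((mat 1 :: complex^4^4) $ j $ i)) = mat 1"
    by (auto simp: vec_eq_iff mat_def)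
  then show ?thesis by (auto simp: torus_def SU4_def) (simp add: mat_def)
qed

lemma group_T2: "group T2"
proof -
  have adj: "(\<chi> i j. cnj ((A ** B) $ j $ i)) =
      (\<chi> i j. cnj (B $ j $ i)) ** (\<chi> i j. cnj (A $ j $ i))"
    for A B :: "complex^4^4"
    by (simp add: matrix_matrix_mult_def vec_eq_iff mult.commute)
  have comm: "A ** B = B ** A" if "A \<in> torus" "B \<in> torus" for A B
    using that unfolding torus_matrix_mult[OF that(1)] torus_matrix_mult[OF that(2)]
    by (auto simp: vec_eq_iff torus_def) (metis mult.commute mult_zero_right)
  have closed: "A ** B \<in> torus" if "A \<in> torus" "B \<in> torus" for A B
  proof -
    let ?a = "\<chi> i j. cnj (A $ j $ i)" and ?b = "\<chi> i j. cnj (B $ j $ i)"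
    have "(A ** B) ** (?b ** ?a) = A ** (B ** ?b) ** ?a" by (simp add: matrix_mul_assoc)
    also have "\<dots> = mat 1" using that by (simp add: torus_def SU4_def)
    finally have "A ** B \<in> SU4" using that by (simp add: SU4_def adj det_mul torus_def)
    then show ?thesis using that unfolding torus_def
      by (auto simp: torus_matrix_mult[OF that(1)])
  qed
  have sq: "(A ** B) ** (A ** B) = mat 1"
    if "A \<in> torus" "B \<in> torus" "A ** A = mat 1" "B ** B = mat 1" for A B
    using comm[OF that(1,2)] that(3,4) by (metis matrix_mul_assoc matrix_mul_rid)
  show ?thesis
  proof (rule groupI)
    show "x \<otimes>\<^bsub>T2\<^esub> y \<in> carrier T2" if "x \<in> carrier T2" "y \<in> carrier T2" for x y
      using that by (auto simp: T2_def closed intro!: sq)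
  qed (auto simp: T2_def mat_1_in_torus matrix_mul_assoc)
qed

lemma module_ext_scale: "module ext_scale"
  using vector_space_ext_scale by (simp add: module_iff_vector_space)

lemma fibre_add: "a \<in> fibre \<Longrightarrow> b \<in> fibre \<Longrightarrow> a + b \<in> fibre"
  unfolding fibre_def by (rule module.span_add[OF module_ext_scale])

lemma fibre_smult:
  assumes "p \<in> sym_alg" "w \<in> fibre"
  shows "p *s w \<in> fibre"
  using assms(2) unfolding fibre_def
proof (induction rule: module.span_induct_alt[OF module_ext_scale, consumes 1, case_names zero step])
  case zero
  show ?case using module.span_zero[OF module_ext_scale] by simp
next
  case (step c x y)
  then obtain q u where x: "x = q *s u" "q \<in> sym_alg" "u \<in> ext_alg" by blast
  have "p *s (ext_scale c x + y) = ext_scale c ((p * q) *s u) + p *s y"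
    by (simp add: x(1) ext_scale_def vec_eq_iff distrib_left mult.assoc mult.left_commute)
  moreover have "(p * q) *s u \<in> module.span ext_scale {p *s w |p w. p \<in> sym_alg \<and> w \<in> ext_alg}"
    using assms(1) x(2,3) sym_alg_mult by (intro module.span_base[OF module_ext_scale]) blast
  ultimately show ?case
    using step.IH module.span_add[OF module_ext_scale] module.span_scale[OF module_ext_scale]
    by simp
qed

lemma ext_map_add: "ext_map f (a + b) = ext_map f a + ext_map f b"
  by (simp add: ext_map_def sum.distrib[symmetric] vec_eq_iff algebra_simps)

lemma ext_map_smult: "ext_map f (p *s a) = p *s ext_map f a"
  by (simp add: ext_map_def vec_eq_iff sum_distrib_left mult.assoc)

lemma H0_F1_submodule:
  assumes "a \<in> H0_F1 V \<phi>" "b \<in> H0_F1 V \<phi>" "p \<in> sym_alg"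
  shows "a + b \<in> H0_F1 V \<phi>" "family_scale p a \<in> H0_F1 V \<phi>"
proof -
  show "a + b \<in> H0_F1 V \<phi>"
    unfolding H0_F1_def
  proof (clarsimp, intro conjI ballI allI impI, goal_cases)
    case 1 then show ?case using assms by (auto simp: H0_F1_def)
  next case 2 then show ?case using assms by (auto simp: H0_F1_def fibre_add)
  next case (3 \<alpha> v)
    then obtain m n where m: "m \<in> fibre" "n \<in> fibre" "a v = m + linear_form \<alpha> *s n"
        "a (\<phi> (exp_pi_i \<alpha>) v) = ext_map (reflection \<alpha>) m - linear_form \<alpha> *s ext_map (reflection \<alpha>) n"
      using assms(1) by (fastforce simp: H0_F1_def)
    from 3 obtain m' n' where m': "m' \<in> fibre" "n' \<in> fibre" "b v = m' + linear_form \<alpha> *s n'"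
        "b (\<phi> (exp_pi_i \<alpha>) v) = ext_map (reflection \<alpha>) m' - linear_form \<alpha> *s ext_map (reflection \<alpha>) n'"
      using assms(2) by (fastforce simp: H0_F1_def)
    have "a v + b v = (m + m') + linear_form \<alpha> *s (n + n')"
      unfolding m(3) m'(3) by (simp add: vec_eq_iff distrib_left)
    moreover have "a (\<phi> (exp_pi_i \<alpha>) v) + b (\<phi> (exp_pi_i \<alpha>) v) =
        ext_map (reflection \<alpha>) (m + m') - linear_form \<alpha> *s ext_map (reflection \<alpha>) (n + n')"
      unfolding m(4) m'(4) ext_map_add by (simp add: vec_eq_iff distrib_left)
    ultimately show ?case using fibre_add m(1,2) m'(1,2) by blast
  qed
  show "family_scale p a \<in> H0_F1 V \<phi>"
    unfolding H0_F1_def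
  proof (clarsimp, intro conjI ballI allI impI, goal_cases)
    case 1 then show ?case using assms by (auto simp: H0_F1_def family_scale_def)
  next case 2 then show ?case using assms by (auto simp: H0_F1_def fibre_smult family_scale_def)
  next case (3 \<alpha> v)
    then obtain m n where m: "m \<in> fibre" "n \<in> fibre" "a v = m + linear_form \<alpha> *s n"
        "a (\<phi> (exp_pi_i \<alpha>) v) = ext_map (reflection \<alpha>) m - linear_form \<alpha> *s ext_map (reflection \<alpha>) n"
      using assms(1) by (fastforce simp: H0_F1_def)
    have "family_scale p a v = p *s m + linear_form \<alpha> *s (p *s n)"
      unfolding family_scale_def m(3) by (simp add: vec_eq_iff distrib_left mult.left_commute)
    moreover have "family_scale p a (\<phi> (exp_pi_i \<alpha>) v) =
        ext_map (reflection \<alpha>) (p *s m) - linear_form \<alpha> *s ext_map (reflection \<alpha>) (p *s n)"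
      unfolding family_scale_def m(4) ext_map_smult
      by (simp add: vec_eq_iff right_diff_distrib mult.left_commute)
    ultimately show ?case using fibre_smult[OF assms(3)] m(1,2) by blast
  qed
qed

lemma isotypical_submodule:
  assumes "a \<in> isotypical V \<phi> chi (H0_F1 V \<phi>)" "b \<in> isotypical V \<phi> chi (H0_F1 V \<phi>)"
    and "p \<in> sym_alg"
  shows "a + b \<in> isotypical V \<phi> chi (H0_F1 V \<phi>)"
    and "family_scale p a \<in> isotypical V \<phi> chi (H0_F1 V \<phi>)"
proof -
  have H: "a \<in> H0_F1 V \<phi>" "b \<in> H0_F1 V \<phi>"
    and t: "\<And>g. g \<in> carrier T2 \<Longrightarrow> translate V \<phi> g a = family_cscale (chi g) a"
      "\<And>g. g \<in> carrier T2 \<Longrightarrow> translate V \<phi> g b = family_cscale (chi g) b"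
    using assms by (auto simp: isotypical_def)
  have 1: "translate V \<phi> g (a + b) = translate V \<phi> g a + translate V \<phi> g b" for g
    by (auto simp: translate_def)
  have 2: "translate V \<phi> g (family_scale p a) = family_scale p (translate V \<phi> g a)" for g
    by (auto simp: translate_def family_scale_def)
  have 3: "family_scale p (family_cscale c a) = family_cscale c (family_scale p a)" for c
    by (auto simp: family_cscale_def family_scale_def vec_eq_iff mult.left_commute)
  have 4: "family_cscale c (a + b) = family_cscale c a + family_cscale c b" for c
    by (auto simp: family_cscale_def family_scale_def vec_eq_iff distrib_left)
  show "a + b \<in> isotypical V \<phi> chi (H0_F1 V \<phi>)"
    unfolding isotypical_def using H0_F1_submodule(1)[OF H assms(3)] t 1 4 by simp
  show "family_scale p a \<in> isotypical V \<phi> chi (H0_F1 V \<phi>)"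
    unfolding isotypical_def using H0_F1_submodule(2)[OF H assms(3)] t 2 3 by simp
qed

end

theory Submission
  imports Defs "HOL-Computational_Algebra.Polynomial"
begin

text \<open>
  An isotypical section is determined by its value \<open>x\<close> at one vertex, and the conditions on \<open>x\<close> are
  \<open>S\<^sub>\<alpha> x \<equiv> \<plusminus> x\<close> modulo \<open>\<alpha>\<close>, with the sign \<open>+\<close> for \<open>\<alpha>\<^bsub>1,2\<^esub>\<close> and \<open>\<alpha>\<^bsub>3,4\<^esub>\<close> and the sign \<open>-\<close> for the other
  roots.  In orthonormal coordinates \<open>a, b, c\<close> the former two roots are \<open>b \<plusminus> c\<close> and the latter four are
  \<open>a \<plusminus> b\<close> and \<open>a \<plusminus> c\<close>.  The conditions separate by exterior degree.  In degrees 0 and 3 the solutions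
  are the multiples of \<open>(a\<^sup>2 - b\<^sup>2)(a\<^sup>2 - c\<^sup>2)\<close> and of \<open>b\<^sup>2 - c\<^sup>2\<close>.  In degrees 1 and 2 solving the
  congruences successively presents the solutions as an iterated extension of two free modules of
  rank 1 and the ideal \<open>(a, bc)\<close>, so there are four generators and one relation in each of these
  degrees.  In degree 2 this relation has the form \<open>a x = b y + c z\<close> with \<open>x\<close> not in \<open>bN + cN\<close>,
  which is impossible in a free module because \<open>a, b, c\<close> is a regular sequence.
\<close>

section \<open>Division by the roots\<close>

text \<open>The ideal (a, bc) comes from setting a = 0. There \<open>va + vb\<close> and
  \<open>va - vb\<close> both become b up to sign, so two congruences that the overview treats as
  independent make the same expression divisible by b. The same happens with c, and the part without
  a has to be a multiple of bc.

  Orthonormal coordinates are used because every reflection becomes a signed permutation of them, so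
  no congruence involves more than two coordinates.

  The Hilbert series is obtained without a resolution. An element of (a, bc) is uniquely a g + bc k
  with k free of a; with this normal form two of the ten generators carry coefficients in b and c
  only. They contribute (t^10 + t^11)/(1 - t^2)^2, which is where the negative terms of the
  numerator come from.

  Those negative terms exclude a homogeneous basis, but \<open>free_over\<close> admits bases that
  are neither homogeneous nor finite. Non-freeness is therefore proved by an ungraded argument with
  one explicit relation.\<close>

type_synonym R3 = "complex poly poly poly"

text \<open>
  The variables \<open>a\<close>, \<open>b\<close>, \<open>c\<close> are orthonormal coordinates on \<open>tt\<close> in which the roots of type
  \<open>A\<^sub>3\<close> become those of type \<open>D\<^sub>3\<close>; see \<open>root_vec_y\<close>.
  The variable \<open>a\<close> is outermost, so \<open>pCons\<close> splits off the part of a polynomial without \<open>a\<close>.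
\<close>

definition va :: R3 where "va = [:0, 1:]"
definition vb :: R3 where "vb = [:[:0, 1:]:]"
definition vc :: R3 where "vc = [:[:[:0, 1:]:]:]"

lemma linear_dvd_iff: "[:- r, 1:] dvd p \<longleftrightarrow> poly p r = 0" for r :: "'a::comm_ring_1"
  by (simp add: poly_eq_0_iff_dvd)

lemma prime_elem_monic_linear: "prime_elem [:r, 1:]" for r :: "'a::idom_divide"
proof (rule prime_elemI)
  have dvd: "[:r, 1:] dvd p \<longleftrightarrow> poly p (- r) = 0" for p
    using linear_dvd_iff[of "- r" p] by simp
  show "\<not> is_unit [:r, 1:]" by (simp add: dvd)
  show "[:r, 1:] dvd p \<or> [:r, 1:] dvd q" if "[:r, 1:] dvd p * q" for p q
    using that by (simp add: dvd)
qed simp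

lemma root_forms:
  "va + vb = [:[:0, 1:], 1:]" "va - vb = [:- [:0, 1:], 1:]"
  "va + vc = [:[:[:0, 1:]:], 1:]" "va - vc = [:- [:[:0, 1:]:], 1:]"
  "vb + vc = [:[:[:0, 1:], 1:]:]" "vb - vc = [:[:- [:0, 1:], 1:]:]"
  by (simp_all add: va_def vb_def vc_def)

lemma prime_roots:
  "prime_elem (va + vb)" "prime_elem (va - vb)" "prime_elem (va + vc)"
  "prime_elem (va - vc)" "prime_elem (vb + vc)" "prime_elem (vb - vc)"
  unfolding root_forms by (simp_all add: prime_elem_const_poly_iff prime_elem_monic_linear)

lemma root_not_dvd:
  "\<not> va + vb dvd va - vb" "\<not> va + vb dvd va + vc" "\<not> va + vb dvd va - vc"
  "\<not> va - vb dvd va + vc" "\<not> va - vb dvd va - vc"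
  "\<not> va + vc dvd va - vc"
  "\<not> vb + vc dvd vb - vc" "\<not> vb + vc dvd va + vb" "\<not> vb + vc dvd va - vb"
  "\<not> vb + vc dvd va + vc" "\<not> vb + vc dvd va - vc"
  "\<not> vb - vc dvd va + vb" "\<not> vb - vc dvd va - vb"
  "\<not> vb - vc dvd va + vc" "\<not> vb - vc dvd va - vc"
proof -
  have 1: "[:r, 1:] dvd p \<longleftrightarrow> poly p (- r) = 0" for p and r :: "'a::idom"
    using linear_dvd_iff[of "- r" p] by simp
  show "\<not> va + vb dvd va - vb" "\<not> va + vb dvd va + vc" "\<not> va + vb dvd va - vc"
  "\<not> va - vb dvd va + vc" "\<not> va - vb dvd va - vc"
  "\<not> va + vc dvd va - vc"
    unfolding root_forms 1 by simp_all
  show "\<not> vb + vc dvd vb - vc"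
    unfolding root_forms const_poly_dvd_const_poly_iff 1 by simp
  show  "\<not> vb + vc dvd va + vb" "\<not> vb + vc dvd va - vb"
  "\<not> vb + vc dvd va + vc" "\<not> vb + vc dvd va - vc"
  "\<not> vb - vc dvd va + vb" "\<not> vb - vc dvd va - vb"
  "\<not> vb - vc dvd va + vc" "\<not> vb - vc dvd va - vc"
    \<comment> \<open>\<open>vb + vc\<close> and \<open>vb - vc\<close> are constants with respect
      to a; they would have to divide the coefficient of a, which is 1.\<close>
    unfolding root_forms by (auto simp: const_poly_dvd_iff coeff_pCons 1 poly_eq_0_iff_dvd[symmetric] split: nat.splits dest!: spec[of _ "1::nat"])
qed

lemma prime_mult_dvd:
  fixes p q x :: "'a::idom"
  assumes "prime_elem p" "\<not> p dvd q" "p dvd x" "q dvd x"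
  shows "p * q dvd x"
proof -
  from assms(4) obtain y where y: "x = q * y" ..
  with assms(1-3) have "p dvd y" using prime_elem_dvd_mult_iff by blast
  then show ?thesis unfolding y by (simp add: mult.commute mult_dvd_mono)
qed

lemma dvd_cancel_prime: "prime_elem p \<Longrightarrow> \<not> p dvd q \<Longrightarrow> p dvd q * x \<Longrightarrow> p dvd x"
  by (simp add: prime_elem_dvd_mult_iff)

definition half :: R3 where "half = [:[:[:1/2:]:]:]"

lemma two_half: "2 * half = 1"
  by (simp add: half_def numeral_poly one_pCons)

lemma half_unique:
  assumes "2 * x = y"
  shows "x = half * y"
proof -
  have "half * y = (2 * half) * x" unfolding assms[symmetric] by (simp only: ac_simps)
  then show ?thesis by (simp only: two_half mult_1)
qed

text \<open>The solutions form a free module with basis (b, c), (c, b): half the sum and half the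
  difference of the two cofactors are the coefficients.\<close>

lemma pair_param:
  assumes "vb + vc dvd x + y" "vb - vc dvd x - y"
  obtains f g where "x = vb * f + vc * g" "y = vc * f + vb * g"
proof -
  from assms obtain u w where u: "x + y = (vb + vc) * u" and w: "x - y = (vb - vc) * w"
    by (auto elim!: dvdE)
  have "2 * x = vb * (u + w) + vc * (u - w)" "2 * y = vc * (u + w) + vb * (u - w)"
    using u w by algebra+
  from this[THEN half_unique] show thesis
    by (intro that[of "half * (u + w)" "half * (u - w)"]) (simp_all add: algebra_simps)
qed

text \<open>Cramer's rule: the matrix with rows (b, c) and (c, b) has the nonzero determinant b^2 -
  c^2.\<close>

lemma pair_param_unique:
  assumes "vb * f + vc * g = 0" "vc * f + vb * g = 0"
  shows "f = 0" "g = 0"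
proof -
  have nz: "(vb + vc) * (vb - vc) \<noteq> 0" using prime_roots by (auto simp: prime_elem_def)
  have "(vb + vc) * (vb - vc) * f = vb * (vb * f + vc * g) - vc * (vc * f + vb * g)"
    "(vb + vc) * (vb - vc) * g = vb * (vc * f + vb * g) - vc * (vb * f + vc * g)"
    by algebra+
  with assms nz show "f = 0" "g = 0" by auto
qed

text \<open>The ring is that of polynomials in b and c, reached by setting a = 0. The powers are the
  factors that the congruences leave in front of the term without a, with exponent 3 in exterior
  degree 1 and 0 in degree 2; they cancel because b and c are non-associate primes.\<close>

lemma bc_dvd:
  fixes g :: "complex poly poly"
  assumes "[:0, 1:] dvd [:[:0, 1:]:] ^ m * g" "[:[:0, 1:]:] dvd [:0, 1:] ^ n * g"
  obtains k where "g = [:0, 1:] * [:[:0, 1:]:] * k"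
proof -
  have p: "prime_elem [:0, 1 :: complex poly:]" "prime_elem [:[:0, 1 :: complex:]:]"
    by (simp_all add: prime_elem_const_poly_iff prime_elem_monic_linear)
  have n1: "\<not> [:0, 1 :: complex poly:] dvd [:[:0, 1:]:]"
    using linear_dvd_iff[of 0 "[:[:0, 1 :: complex:]:]"] by simp
  have n2: "\<not> [:[:0, 1 :: complex:]:] dvd [:0, 1:]"
    unfolding const_poly_dvd_iff by (auto intro!: exI[of _ "1::nat"] simp: is_unit_pCons_iff)
  have "[:0, 1:] dvd g" using assms(1) p(1) n1 prime_elem_dvd_power dvd_cancel_prime by blast
  moreover have "[:[:0, 1:]:] dvd g" using assms(2) p(2) n2 prime_elem_dvd_power dvd_cancel_prime by blast
  ultimately have "[:0, 1:] * [:[:0, 1:]:] dvd g" using prime_mult_dvd[OF p(1) n1] by simp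
  then show thesis using that by (auto elim: dvdE)
qed

definition Rab :: R3 where "Rab = (va + vb) * (va - vb)"
definition Rac :: R3 where "Rac = (va + vc) * (va - vc)"

definition Rbc :: R3 where "Rbc = (vb + vc) * (vb - vc)"

text \<open>This is the normal form in the ideal (a, bc): splitting off the part without a
  determines \<open>g\<close> and \<open>k\<close>.\<close>

lemma pCons_bc: "pCons ([:0, 1:] * [:[:0, 1:]:] * k) g = va * g + vb * vc * [:k:]"
  by (simp add: va_def vb_def vc_def)

lemma poly_Rab_0: "poly Rab 0 = - ([:0, 1:] ^ 2)" and poly_Rac_0: "poly Rac 0 = - ([:[:0, 1:]:] ^ 2)"
  by (simp_all add: Rab_def Rac_def va_def vb_def vc_def power2_eq_square)

lemma poly_vars_0: "poly va 0 = 0" "poly vb 0 = [:0,1:]" "poly vc 0 = [:[:0,1:]:]"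
  by (simp_all add: va_def vb_def vc_def)

text \<open>\<open>Rab\<close> and \<open>Rac\<close> agree modulo \<open>vb + vc\<close> and modulo
  \<open>vb - vc\<close>, so the cofactors of \<open>q\<close> and \<open>r\<close> satisfy the
  hypotheses of \<open>pair_param\<close>. The congruences with \<open>p\<close> restrict
  \<open>g\<close> to (a, bc) and then fix \<open>p\<close> up to multiples of
  \<open>Rab * Rac\<close>.\<close>

lemma deg1_param:
  assumes r: "va + vb dvd r" "va - vb dvd r" and q: "va + vc dvd q" "va - vc dvd q"
    and qr: "vb + vc dvd q + r" "vb - vc dvd q - r"
    and pq: "va + vb dvd p - q" "va - vb dvd p + q"
    and pr: "va + vc dvd p - r" "va - vc dvd p + r"
  obtains f g1 g2 h where
    "p = Rab * Rac * h - (Rab + Rac) * (va * f + vb * vc * g1) - va * (Rac * vc^2 + Rab * vb^2) * [:g2:]"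
    "q = Rac * (vb * f + vc * (va * g1 + vb * vc * [:g2:]))"
    "r = Rab * (vc * f + vb * (va * g1 + vb * vc * [:g2:]))"
proof -
  have "Rab dvd r" "Rac dvd q"
    using r q prime_roots root_not_dvd by (auto simp: Rab_def Rac_def intro!: prime_mult_dvd)
  then obtain r' q' where r': "r = Rab * r'" and q': "q = Rac * q'" by (auto elim!: dvdE)
  have "q + r = (va + vc) * ((va - vc) * (q' + r')) - (vb + vc) * ((vb - vc) * r')"
    "q - r = (va + vc) * ((va - vc) * (q' - r')) + (vb - vc) * ((vb + vc) * r')"
    unfolding r' q' Rab_def Rac_def by algebra+
  with qr have "vb + vc dvd (va + vc) * ((va - vc) * (q' + r'))"
    "vb - vc dvd (va + vc) * ((va - vc) * (q' - r'))"
    by (metis dvd_add_left_iff dvd_diff_left_iff dvd_triv_left)+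
  then have "vb + vc dvd q' + r'" "vb - vc dvd q' - r'"
    using prime_roots root_not_dvd by (meson dvd_cancel_prime)+
  then obtain f g where fg: "q' = vb * f + vc * g" "r' = vc * f + vb * g" by (rule pair_param)
  obtain g0 g1 where g: "g = pCons g0 g1" by (cases g)
  from pq obtain m n where mn: "p - q = (va + vb) * m" "p + q = (va - vb) * n" by (auto elim!: dvdE)
  \<comment> \<open>Eliminating \<open>p\<close> leaves a right side that is divisible by b at a =
    0. There q is -c^2 (b f + c g0), hence b divides c^3 g0.\<close>
  have "2 * q = (va - vb) * n - (va + vb) * m" using mn by algebra
  then have q2: "q = half * ((va - vb) * n - (va + vb) * m)" by (rule half_unique)
  from pr obtain m' n' where mn': "p - r = (va + vc) * m'" "p + r = (va - vc) * n'" by (auto elim!: dvdE)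
  have "2 * r = (va - vc) * n' - (va + vc) * m'" using mn' by algebra
  then have r2: "r = half * ((va - vc) * n' - (va + vc) * m')" by (rule half_unique)
  let ?b = "[:0, 1 :: complex poly:]" and ?c = "[:[:0, 1:]:] :: complex poly poly"
  have "- (?c^2) * (?b * poly f 0 + ?c * g0) = poly half 0 * (- ?b * poly n 0 - ?b * poly m 0)"
    using arg_cong[OF trans[OF q'[symmetric] q2], of "\<lambda>p. poly p 0"]
    by (simp only: poly_mult poly_add poly_diff poly_vars_0 poly_Rab_0 poly_Rac_0 fg g poly_pCons mult_zero_left add_0_right add_0_left diff_0)
  then have "?c ^ 3 * g0 = ?b * (poly half 0 * (poly n 0 + poly m 0) - ?c^2 * poly f 0)"
    by algebra
  then have 1: "?b dvd ?c ^ 3 * g0" by (rule dvdI)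
  have "- (?b^2) * (?c * poly f 0 + ?b * g0) = poly half 0 * (- ?c * poly n' 0 - ?c * poly m' 0)"
    using arg_cong[OF trans[OF r'[symmetric] r2], of "\<lambda>p. poly p 0"]
    by (simp only: poly_mult poly_add poly_diff poly_vars_0 poly_Rab_0 poly_Rac_0 fg g poly_pCons mult_zero_left add_0_right add_0_left diff_0)
  then have "?b ^ 3 * g0 = ?c * (poly half 0 * (poly n' 0 + poly m' 0) - ?b^2 * poly f 0)"
    by algebra
  then have 2: "?c dvd ?b ^ 3 * g0" by (rule dvdI)
  from bc_dvd[OF 1 2] obtain g2 where g2: "g0 = ?b * ?c * g2" .
  have gg: "g = va * g1 + vb * vc * [:g2:]" unfolding g g2 by (rule pCons_bc)
  define G where "G = [:g2:]"
  \<comment> \<open>Chinese remaindering: replacing b by -a in \<open>q\<close>, or by a in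
    \<open>-q\<close>, gives the same residue modulo \<open>Rab\<close>, namely the part of
    \<open>p0\<close> with factor \<open>Rac\<close>. Exchanging b and c gives the part with factor
    \<open>Rab\<close>.\<close>
  define p0 where "p0 = - (Rab + Rac) * (va * f + vb * vc * g1) - va * (Rac * vc^2 + Rab * vb^2) * G"
  have "p - p0 = (va + vb) * (m + Rac * (f + vc * g1 + vc^2 * G) + (va - vb) * (va * f + vb * vc * g1 + va * vb^2 * G))"
    using mn(1) unfolding p0_def q' fg gg G_def[symmetric] unfolding Rab_def by algebra
  moreover have "p - p0 = (va - vb) * (n + Rac * (f - vc * g1 + vc^2 * G) + (va + vb) * (va * f + vb * vc * g1 + va * vb^2 * G))"
    using mn(2) unfolding p0_def q' fg gg G_def[symmetric] unfolding Rab_def by algebra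
  moreover have "p - p0 = (va + vc) * (m' + Rab * (f + vb * g1 + vb^2 * G) + (va - vc) * (va * f + vb * vc * g1 + va * vc^2 * G))"
    using mn'(1) unfolding p0_def r' fg gg G_def[symmetric] unfolding Rac_def by algebra
  moreover have "p - p0 = (va - vc) * (n' + Rab * (f - vb * g1 + vb^2 * G) + (va + vc) * (va * f + vb * vc * g1 + va * vc^2 * G))"
    using mn'(2) unfolding p0_def r' fg gg G_def[symmetric] unfolding Rac_def by algebra
  ultimately have "va + vb dvd p - p0" "va - vb dvd p - p0" "va + vc dvd p - p0" "va - vc dvd p - p0"
    by (blast intro: dvdI)+
  then have "(va + vb) * ((va - vb) * ((va + vc) * (va - vc))) dvd p - p0"
    using prime_roots root_not_dvd by (auto intro!: prime_mult_dvd simp: prime_elem_dvd_mult_iff)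
  then have "Rab * Rac dvd p - p0" by (simp add: Rab_def Rac_def mult.assoc)
  then obtain h where "p - p0 = Rab * Rac * h" by (auto elim!: dvdE)
  then have "p = Rab * Rac * h - (Rab + Rac) * (va * f + vb * vc * g1) - va * (Rac * vc^2 + Rab * vb^2) * G"
    unfolding p0_def by algebra
  then show thesis
    using that q' r' unfolding fg gg G_def by blast
qed

text \<open>Here \<open>p\<close> comes first: its cofactor by \<open>Rbc\<close> lies in (a, bc),
  because b and c are prime to \<open>Rbc\<close> at a = 0. Then \<open>q\<close> and
  \<open>r\<close> are known up to multiples of \<open>Rab\<close> and \<open>Rac\<close>, and these
  multiples are tied together as in \<open>pair_param\<close>.\<close>

lemma deg2_param:
  assumes p: "vb + vc dvd p" "vb - vc dvd p"
    and qr: "vb + vc dvd q - r" "vb - vc dvd q + r"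
    and pq: "va + vb dvd p + q" "va - vb dvd p - q"
    and pr: "va + vc dvd p + r" "va - vc dvd p - r"
  obtains f g k1 k2 where
    "p = Rbc * (va * k1 + vb * vc * [:k2:])"
    "q = Rbc * (vb * k1 + va * vc * [:k2:]) + Rab * (vb * f + vc * g)"
    "r = Rbc * (vc * k1 + va * vb * [:k2:]) - Rac * (vc * f + vb * g)"
proof -
  have "Rbc dvd p"
    using p prime_roots root_not_dvd by (auto simp: Rbc_def intro!: prime_mult_dvd)
  then obtain p' where p': "p = Rbc * p'" by (auto elim!: dvdE)
  obtain p0 k1 where pp: "p' = pCons p0 k1" by (cases p')
  let ?b = "[:0, 1 :: complex poly:]" and ?c = "[:[:0, 1:]:] :: complex poly poly"
  have Z0: "poly Rbc 0 = (?b + ?c) * (?b - ?c)" by (simp add: Rbc_def poly_vars_0)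
  have ndvd: "\<not> ?b dvd (?b + ?c) * (?b - ?c)" "\<not> ?c dvd (?b + ?c) * (?b - ?c)"
    using linear_dvd_iff[of 0 "(?b + ?c) * (?b - ?c)"]
    unfolding const_poly_dvd_iff by (auto intro!: exI[of _ "2::nat"] simp: is_unit_pCons_iff numeral_2_eq_2)
  have pr': "prime_elem ?b" "prime_elem ?c"
    by (simp_all add: prime_elem_const_poly_iff prime_elem_monic_linear)
  from pq obtain m n where mn: "p + q = (va + vb) * m" "p - q = (va - vb) * n" by (auto elim!: dvdE)
  have "2 * p = (va + vb) * m + (va - vb) * n" using mn by algebra
  then have p2: "p = half * ((va + vb) * m + (va - vb) * n)" by (rule half_unique)
  from pr obtain m' n' where mn': "p + r = (va + vc) * m'" "p - r = (va - vc) * n'" by (auto elim!: dvdE)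
  have "2 * p = (va + vc) * m' + (va - vc) * n'" using mn' by algebra
  then have p3: "p = half * ((va + vc) * m' + (va - vc) * n')" by (rule half_unique)
  have "(?b + ?c) * (?b - ?c) * p0 = poly half 0 * (?b * poly m 0 + - ?b * poly n 0)"
    using arg_cong[OF trans[OF p'[symmetric] p2], of "\<lambda>p. poly p 0"]
    by (simp only: poly_mult poly_add poly_diff poly_vars_0 poly_Rab_0 poly_Rac_0 Z0 pp poly_pCons mult_zero_left add_0_right add_0_left diff_0)
  also have "\<dots> = ?b * (poly half 0 * (poly m 0 - poly n 0))"
    by algebra
  finally have "(?b + ?c) * (?b - ?c) * p0 = ?b * (poly half 0 * (poly m 0 - poly n 0))" .
  then have "?b dvd (?b + ?c) * (?b - ?c) * p0" by (rule dvdI)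
  from dvd_cancel_prime[OF pr'(1) ndvd(1) this] have 1: "?b dvd ?c ^ 0 * p0"
    by (simp only: power_0 mult_1)
  have "(?b + ?c) * (?b - ?c) * p0 = poly half 0 * (?c * poly m' 0 + - ?c * poly n' 0)"
    using arg_cong[OF trans[OF p'[symmetric] p3], of "\<lambda>p. poly p 0"]
    by (simp only: poly_mult poly_add poly_diff poly_vars_0 poly_Rab_0 poly_Rac_0 Z0 pp poly_pCons mult_zero_left add_0_right add_0_left diff_0)
  also have "\<dots> = ?c * (poly half 0 * (poly m' 0 - poly n' 0))"
    by algebra
  finally have "(?b + ?c) * (?b - ?c) * p0 = ?c * (poly half 0 * (poly m' 0 - poly n' 0))" .
  then have "?c dvd (?b + ?c) * (?b - ?c) * p0" by (rule dvdI)
  from dvd_cancel_prime[OF pr'(2) ndvd(2) this] have 2: "?c dvd ?b ^ 0 * p0"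
    by (simp only: power_0 mult_1)
  from bc_dvd[OF 1 2] obtain k2 where k2: "p0 = ?b * ?c * k2" .
  define K where "K = [:k2:]"
  have p'2: "p' = va * k1 + vb * vc * K" unfolding pp k2 K_def by (rule pCons_bc)
  \<comment> \<open>Exchanging the visible factors a and b in \<open>va * k1 + vb * vc * K\<close>,
    with \<open>k1\<close> and \<open>K\<close> kept, gives its negative modulo
    \<open>va + vb\<close> and itself modulo \<open>va - vb\<close>. This is a particular solution
    for \<open>q\<close>; exchanging a and c gives one for \<open>r\<close>.\<close>
  define q1 r1 where "q1 = q - Rbc * (vb * k1 + va * vc * K)" and "r1 = r - Rbc * (vc * k1 + va * vb * K)"
  have "q1 = (va + vb) * (m - Rbc * (k1 + vc * K))" "q1 = (va - vb) * (- n + Rbc * (k1 - vc * K))"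
    "r1 = (va + vc) * (m' - Rbc * (k1 + vb * K))" "r1 = (va - vc) * (- n' + Rbc * (k1 - vb * K))"
    using mn mn' unfolding q1_def r1_def p' p'2 by algebra+
  then have "va + vb dvd q1" "va - vb dvd q1" "va + vc dvd r1" "va - vc dvd r1"
    by (metis dvd_triv_left)+
  then have "Rab dvd q1" "Rac dvd r1"
    using prime_roots root_not_dvd by (auto simp: Rab_def Rac_def intro!: prime_mult_dvd)
  \<comment> \<open>The sign of \<open>r'\<close> turns the remaining congruences into those of
    \<open>pair_param\<close>.\<close>
  then obtain q' r' where q': "q1 = Rab * q'" and r': "r1 = Rac * (- r')"
    by (metis dvdE minus_minus)
  have "q - r = (va + vc) * ((va - vc) * (q' + r'))
        + (vb + vc) * ((vb - vc) * (vb * k1 + va * vc * K - vc * k1 - va * vb * K - q'))"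
    "q + r = (va + vc) * ((va - vc) * (q' - r'))
        + (vb - vc) * ((vb + vc) * (vb * k1 + va * vc * K + vc * k1 + va * vb * K - q'))"
    using q' r' unfolding q1_def r1_def Rab_def Rac_def Rbc_def by algebra+
  with qr have "vb + vc dvd (va + vc) * ((va - vc) * (q' + r'))"
    "vb - vc dvd (va + vc) * ((va - vc) * (q' - r'))"
    by (metis dvd_add_left_iff dvd_triv_left)+
  then have "vb + vc dvd q' + r'" "vb - vc dvd q' - r'"
    using prime_roots root_not_dvd by (meson dvd_cancel_prime)+
  then obtain f g where fg: "q' = vb * f + vc * g" "r' = vc * f + vb * g" by (rule pair_param)
  have "q = Rbc * (vb * k1 + va * vc * K) + Rab * q'" "r = Rbc * (vc * k1 + va * vb * K) - Rac * r'"
    using q' r' unfolding q1_def r1_def by (simp_all add: algebra_simps)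
  with p'2 show thesis using that p' unfolding fg K_def by blast
qed

section \<open>Generators of the module of solutions\<close>

text \<open>
  \<open>P 0, \<dots>, P 9\<close> are the coefficients of ten homogeneous generators: \<open>P 0\<close> in exterior degree 0,
  \<open>P 2, P 3, P 4, P 8\<close> in degree 1, \<open>P 5, P 6, P 7, P 9\<close> in degree 2 and \<open>P 1\<close> in degree 3.
  There is one relation in each of the degrees 1 and 2, in which the generators numbered 8 and 9
  have the coefficient \<open>a\<close>; taking \<open>P 8\<close> and \<open>P 9\<close> free of \<open>a\<close> therefore makes the coefficients unique.
\<close>

definition coord :: "(nat \<Rightarrow> R3) \<Rightarrow> nat \<Rightarrow> R3" where
  "coord P = (!) [
     Rab * Rac * P 0,
     Rab * Rac * P 4 - (Rab + Rac) * (va * P 2 + vb * vc * P 3) - va * (Rac * vc^2 + Rab * vb^2) * P 8,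
     Rac * (vb * P 2 + vc * (va * P 3 + vb * vc * P 8)),
     Rab * (vc * P 2 + vb * (va * P 3 + vb * vc * P 8)),
     Rbc * (va * P 7 + vb * vc * P 9),
     Rbc * (vb * P 7 + va * vc * P 9) + Rab * (vb * P 5 + vc * P 6),
     Rbc * (vc * P 7 + va * vb * P 9) - Rac * (vc * P 5 + vb * P 6),
     Rbc * P 1]"

definition admissible :: "(nat \<Rightarrow> R3) \<Rightarrow> bool" where
  "admissible P \<longleftrightarrow> P 8 \<in> range (\<lambda>k. [:k:]) \<and> P 9 \<in> range (\<lambda>k. [:k:])"

text \<open>Coordinates 1, 2, 3 belong to a, b, c, coordinates 4, 5, 6 to bc, ca, ab, and 0 and 7 to
  the lowest and highest exterior degree. There is one row per root. Two coordinates exchanged by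
  the reflection give a single congruence; a coordinate kept up to sign gives one only if that sign
  differs from the character value.\<close>

definition gkm_cond :: "(nat \<Rightarrow> R3) \<Rightarrow> bool" where
  "gkm_cond x \<longleftrightarrow>
     (vb + vc dvd x 2 + x 3 \<and> vb + vc dvd x 4 \<and> vb + vc dvd x 5 - x 6 \<and> vb + vc dvd x 7) \<and>
     (vb - vc dvd x 2 - x 3 \<and> vb - vc dvd x 4 \<and> vb - vc dvd x 5 + x 6 \<and> vb - vc dvd x 7) \<and>
     (va + vb dvd x 0 \<and> va + vb dvd x 1 - x 2 \<and> va + vb dvd x 3 \<and> va + vb dvd x 4 + x 5) \<and>
     (va - vb dvd x 0 \<and> va - vb dvd x 1 + x 2 \<and> va - vb dvd x 3 \<and> va - vb dvd x 4 - x 5) \<and>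
     (va + vc dvd x 0 \<and> va + vc dvd x 1 - x 3 \<and> va + vc dvd x 2 \<and> va + vc dvd x 4 + x 6) \<and>
     (va - vc dvd x 0 \<and> va - vc dvd x 1 + x 3 \<and> va - vc dvd x 2 \<and> va - vc dvd x 4 - x 6)"

lemma gkm_cond_coord: "gkm_cond (coord P)"
proof -
  \<comment> \<open>The witnesses are the quotients by the root. Only congruences between two
    coordinates need one; the others are visible from the factors \<open>Rab\<close>,
    \<open>Rac\<close>, \<open>Rbc\<close>.\<close>
  have "va + vb dvd coord P 1 - coord P 2"
    by (rule dvdI[of _ _ "(va - vb) * Rac * P 4 - (va - vb) * (va * P 2 + vb * vc * P 3) - va * (va - vb) * vb^2 * P 8
         - Rac * (P 2 + vc * P 3 + vc^2 * P 8)"], simp add: coord_def Rab_def, algebra)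
  moreover have "va - vb dvd coord P 1 + coord P 2"
    by (rule dvdI[of _ _ "(va + vb) * Rac * P 4 - (va + vb) * (va * P 2 + vb * vc * P 3) - va * (va + vb) * vb^2 * P 8
         - Rac * (P 2 - vc * P 3 + vc^2 * P 8)"], simp add: coord_def Rab_def, algebra)
  moreover have "va + vc dvd coord P 1 - coord P 3"
    by (rule dvdI[of _ _ "(va - vc) * Rab * P 4 - (va - vc) * (va * P 2 + vb * vc * P 3) - va * (va - vc) * vc^2 * P 8
         - Rab * (P 2 + vb * P 3 + vb^2 * P 8)"], simp add: coord_def Rac_def, algebra)
  moreover have "va - vc dvd coord P 1 + coord P 3"
    by (rule dvdI[of _ _ "(va + vc) * Rab * P 4 - (va + vc) * (va * P 2 + vb * vc * P 3) - va * (va + vc) * vc^2 * P 8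
         - Rab * (P 2 - vb * P 3 + vb^2 * P 8)"], simp add: coord_def Rac_def, algebra)
  moreover have "vb + vc dvd coord P 2 + coord P 3"
    by (rule dvdI[of _ _ "Rac * (P 2 + va * P 3 + vb * vc * P 8) - (vb - vc) * (vc * P 2 + vb * (va * P 3 + vb * vc * P 8))"],
      simp add: coord_def Rab_def Rac_def, algebra)
  moreover have "vb - vc dvd coord P 2 - coord P 3"
    by (rule dvdI[of _ _ "Rac * (P 2 - (va * P 3 + vb * vc * P 8)) + (vb + vc) * (vc * P 2 + vb * (va * P 3 + vb * vc * P 8))"],
      simp add: coord_def Rab_def Rac_def, algebra)
  moreover have "va + vb dvd coord P 4 + coord P 5"
    by (rule dvdI[of _ _ "Rbc * (P 7 + vc * P 9) + (va - vb) * (vb * P 5 + vc * P 6)"],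
      simp add: coord_def Rab_def, algebra)
  moreover have "va - vb dvd coord P 4 - coord P 5"
    by (rule dvdI[of _ _ "Rbc * (P 7 - vc * P 9) - (va + vb) * (vb * P 5 + vc * P 6)"],
      simp add: coord_def Rab_def, algebra)
  moreover have "va + vc dvd coord P 4 + coord P 6"
    by (rule dvdI[of _ _ "Rbc * (P 7 + vb * P 9) - (va - vc) * (vc * P 5 + vb * P 6)"],
      simp add: coord_def Rac_def, algebra)
  moreover have "va - vc dvd coord P 4 - coord P 6"
    by (rule dvdI[of _ _ "Rbc * (P 7 - vb * P 9) + (va + vc) * (vc * P 5 + vb * P 6)"],
      simp add: coord_def Rac_def, algebra)
  moreover have "vb + vc dvd coord P 5 - coord P 6"
    by (rule dvdI[of _ _ "(vb - vc) * (vb * P 7 + va * vc * P 9 - vc * P 7 - va * vb * P 9) + Rac * (P 5 + P 6)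
        - (vb - vc) * (vb * P 5 + vc * P 6)"], simp add: coord_def Rab_def Rac_def Rbc_def, algebra)
  moreover have "vb - vc dvd coord P 5 + coord P 6"
    by (rule dvdI[of _ _ "(vb + vc) * (vb * P 7 + va * vc * P 9 + vc * P 7 + va * vb * P 9) + Rac * (P 5 - P 6)
        - (vb + vc) * (vb * P 5 + vc * P 6)"], simp add: coord_def Rab_def Rac_def Rbc_def, algebra)
  ultimately show ?thesis
    by (simp add: gkm_cond_def) (simp add: coord_def Rab_def Rac_def Rbc_def)
qed

lemma gkm_cond_imp_coord:
  assumes "gkm_cond x"
  obtains P where "admissible P" "\<And>i. i < 8 \<Longrightarrow> x i = coord P i"
proof -
  have "(va + vb) * ((va - vb) * ((va + vc) * (va - vc))) dvd x 0" "(vb + vc) * (vb - vc) dvd x 7"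
    using assms prime_roots root_not_dvd unfolding gkm_cond_def
    by (auto intro!: prime_mult_dvd simp: prime_elem_dvd_mult_iff)
  then obtain f0 f3 where f: "x 0 = Rab * Rac * f0" "x 7 = Rbc * f3"
    unfolding Rab_def Rac_def Rbc_def dvd_def mult.assoc by blast
  obtain f g1 g2 h where 1:
    "x 1 = Rab * Rac * h - (Rab + Rac) * (va * f + vb * vc * g1) - va * (Rac * vc^2 + Rab * vb^2) * [:g2:]"
    "x 2 = Rac * (vb * f + vc * (va * g1 + vb * vc * [:g2:]))"
    "x 3 = Rab * (vc * f + vb * (va * g1 + vb * vc * [:g2:]))"
    using assms deg1_param[of "x 3" "x 2" "x 1"] unfolding gkm_cond_def by metis
  obtain F G k1 k2 where 2:
    "x 4 = Rbc * (va * k1 + vb * vc * [:k2:])"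
    "x 5 = Rbc * (vb * k1 + va * vc * [:k2:]) + Rab * (vb * F + vc * G)"
    "x 6 = Rbc * (vc * k1 + va * vb * [:k2:]) - Rac * (vc * F + vb * G)"
    using assms deg2_param[of "x 4" "x 5" "x 6"] unfolding gkm_cond_def by metis
  define P where "P = (!) [f0, f3, f, g1, h, F, G, k1, [:g2:], [:k2:]]"
  have "x i = coord P i" if "i < 8" for i
  proof -
    from that have "i \<in> {0,1,2,3,4,5,6,7}" by auto
    then show ?thesis by (elim insertE) (simp_all add: coord_def P_def f 1 2 del: One_nat_def)
  qed
  moreover have "admissible P" by (simp add: admissible_def P_def)
  ultimately show thesis using that by blast
qed

lemma R_nonzero: "Rab \<noteq> 0" "Rac \<noteq> 0" "Rbc \<noteq> 0"
  using prime_roots by (auto simp: Rab_def Rac_def Rbc_def prime_elem_def)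

lemma pCons_bc_eq_0:
  assumes "va * g + vb * vc * [:k:] = 0"
  shows "g = 0" "k = 0"
  using assms unfolding pCons_bc[symmetric] by auto

text \<open>The system is triangular. \<open>admissible\<close> is what separates \<open>P 3\<close>
  from \<open>P 8\<close> and \<open>P 7\<close> from \<open>P 9\<close>: each pair enters only
  through an element of (a, bc), whose representation is otherwise ambiguous.\<close>

lemma coord_inj:
  assumes "admissible P" "\<And>i. i < 8 \<Longrightarrow> coord P i = 0" "s < 10"
  shows "P s = 0"
proof -
  from assms(1) obtain g2 k2 where k: "P 8 = [:g2:]" "P 9 = [:k2:]" by (auto simp: admissible_def)
  note c = assms(2)[of 0] assms(2)[of 1] assms(2)[of 2] assms(2)[of 3] assms(2)[of 4] assms(2)[of 5]
    assms(2)[of 6] assms(2)[of 7]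
  have "P 0 = 0" "P 1 = 0" using c R_nonzero by (auto simp: coord_def)
  have "vb * P 2 + vc * (va * P 3 + vb * vc * P 8) = 0" "vc * P 2 + vb * (va * P 3 + vb * vc * P 8) = 0"
    using c R_nonzero by (simp_all add: coord_def)
  from pair_param_unique[OF this] have 2: "P 2 = 0" "P 3 = 0" "P 8 = 0"
    using pCons_bc_eq_0[of "P 3" g2] k by auto
  have "va * P 7 + vb * vc * P 9 = 0" using c R_nonzero by (simp add: coord_def)
  then have 7: "P 7 = 0" "P 9 = 0" using pCons_bc_eq_0[of "P 7" k2] k by auto
  have "vb * P 5 + vc * P 6 = 0" "vc * P 5 + vb * P 6 = 0"
    using c R_nonzero 7 by (simp_all add: coord_def)
  from pair_param_unique[OF this] have 5: "P 5 = 0" "P 6 = 0" .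
  have 4: "P 4 = 0" using c R_nonzero 2 by (simp add: coord_def)
  from assms(3) have "s \<in> {0,1,2,3,4,5,6,7,8,9}" by auto
  then show ?thesis using \<open>P 0 = 0\<close> \<open>P 1 = 0\<close> 2 7 5 4 by auto
qed

section \<open>The symmetric algebra as a polynomial ring\<close>

locale cring_hom =
  fixes h :: "'a::comm_ring_1 \<Rightarrow> 'b::comm_ring_1"
  assumes one: "h 1 = 1" and add: "h (x + y) = h x + h y" and mult: "h (x * y) = h x * h y"
begin

lemma zero: "h 0 = 0" using add[of 0 0] by simp
lemma uminus: "h (- x) = - h x" using add[of x "- x"] by (simp add: zero eq_neg_iff_add_eq_0 add.commute)
lemma diff: "h (x - y) = h x - h y" using add[of x "- y"] by (simp add: uminus)
lemma power: "h (x ^ n) = h x ^ n" by (induction n) (simp_all add: one mult)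
lemma sum: "h (\<Sum>i\<in>I. f i) = (\<Sum>i\<in>I. h (f i))" by (induction I rule: infinite_finite_induct) (simp_all add: zero add)
lemma prod: "h (\<Prod>i\<in>I. f i) = (\<Prod>i\<in>I. h (f i))" by (induction I rule: infinite_finite_induct) (simp_all add: one mult)
lemma of_nat: "h (of_nat n) = of_nat n" by (induction n) (simp_all add: zero one add)
lemma numeral: "h (numeral k) = numeral k" using of_nat[of "Num.numeral k"] by simp

lemmas simps = zero one uminus numeral add diff mult power

end

text \<open>The universal property of a polynomial ring in one variable; nesting it three times
  gives the maps out of \<open>R3\<close>.\<close>

definition hom_eval :: "('a::comm_ring_1 \<Rightarrow> 'b::comm_ring_1) \<Rightarrow> 'b \<Rightarrow> 'a poly \<Rightarrow> 'b" where
  "hom_eval h s f = poly (map_poly h f) s"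

lemma cring_hom_const_poly: "cring_hom (\<lambda>c. [:c:])"
  by unfold_locales (simp_all add: one_pCons)

lemma cring_hom_comp: "cring_hom g \<Longrightarrow> cring_hom h \<Longrightarrow> cring_hom (\<lambda>x. g (h x))"
  by (simp add: cring_hom_def)

lemma hom_eval_0 [simp]: "hom_eval h s 0 = 0"
  by (simp add: hom_eval_def)

lemma hom_eval_pCons:
  assumes "cring_hom h"
  shows "hom_eval h s (pCons c f) = h c + s * hom_eval h s f"
  using cring_hom.zero[OF assms] by (simp add: hom_eval_def map_poly_pCons)

lemma cring_hom_eval:
  assumes "cring_hom h"
  shows "cring_hom (hom_eval h s)"
proof -
  interpret cring_hom h by fact
  note ev = hom_eval_pCons[OF assms]
  have add': "hom_eval h s (f + g) = hom_eval h s f + hom_eval h s g" for f g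
    by (induction f g rule: poly_induct2) (simp_all add: ev simps algebra_simps)
  have smult': "hom_eval h s (smult c g) = h c * hom_eval h s g" for c g
    by (induction g) (simp_all add: ev simps algebra_simps)
  have "hom_eval h s (f * g) = hom_eval h s f * hom_eval h s g" for f g
    by (induction f) (simp_all add: ev add' smult' simps algebra_simps)
  then show ?thesis
    by unfold_locales (simp_all add: add' one_pCons ev one)
qed

lemma coeff_hom_eval_scale:
  assumes "cring_hom h"
  shows "coeff (hom_eval (\<lambda>c. [:h c:]) [:0, t:] f) n = t ^ n * h (coeff f n)"
proof (induction f arbitrary: n)
  case 0
  then show ?case using cring_hom.zero[OF assms] by simp
next
  case (pCons c f)
  have "cring_hom (\<lambda>c. [:h c:])" using cring_hom_comp[OF cring_hom_const_poly assms] .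
  then show ?case
    by (cases n) (simp_all add: hom_eval_pCons pCons.IH coeff_pCons mult.assoc)
qed

definition const3 :: "complex \<Rightarrow> R3" where "const3 k = [:[:[:k:]:]:]"

lemma cring_hom_const3: "cring_hom const3"
  unfolding const3_def by (intro cring_hom_comp[OF cring_hom_const_poly] cring_hom_const_poly)

lemma cring_hom_Const: "cring_hom Const"
  by unfold_locales (simp_all add: Const_add Const_mult Const_one)

definition subst4 :: "(4 \<Rightarrow> R3) \<Rightarrow> poly4 \<Rightarrow> R3" where
  "subst4 x p = (\<Sum>m\<in>Poly_Mapping.keys p. const3 (Poly_Mapping.lookup p m) * (\<Prod>i\<in>UNIV. x i ^ Poly_Mapping.lookup m i))"

lemma subst4_superset:
  assumes "finite S" "Poly_Mapping.keys p \<subseteq> S"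
  shows "subst4 x p = (\<Sum>m\<in>S. const3 (Poly_Mapping.lookup p m) * (\<Prod>i\<in>UNIV. x i ^ Poly_Mapping.lookup m i))"
  unfolding subst4_def using assms
  by (intro sum.mono_neutral_left) (auto simp: in_keys_iff cring_hom.zero[OF cring_hom_const3])

lemma subst4_add: "subst4 x (p + q) = subst4 x p + subst4 x q"
proof -
  let ?S = "Poly_Mapping.keys p \<union> Poly_Mapping.keys q"
  have "finite ?S" "Poly_Mapping.keys p \<subseteq> ?S" "Poly_Mapping.keys q \<subseteq> ?S" "Poly_Mapping.keys (p + q) \<subseteq> ?S"
    using keys_add[of p q] by auto
  then show ?thesis
    using subst4_superset[of ?S]
    by (simp add: lookup_add cring_hom.add[OF cring_hom_const3] distrib_right sum.distrib)
qed

lemma subst4_single: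
  "subst4 x (Poly_Mapping.single m c) = const3 c * (\<Prod>i\<in>UNIV. x i ^ Poly_Mapping.lookup m i)"
  using subst4_superset[of "{m}" "Poly_Mapping.single m c"] by simp

lemma poly_mapping_single_induct [case_names zero single]:
  assumes "P 0" "\<And>m c p. P p \<Longrightarrow> P (Poly_Mapping.single m c + p)"
  shows "P (p :: 'a \<Rightarrow>\<^sub>0 'b::comm_monoid_add)"
proof (induction p rule: update_induct)
  case const
  show ?case using assms(1) .
next
  case (update f a b)
  have "Poly_Mapping.update a b f = Poly_Mapping.single a b + f"
    using update(1) by (intro poly_mapping_eqI) (auto simp: lookup_update lookup_add lookup_single in_keys_iff when_def)
  then show ?case using assms(2) update by simp
qed

lemma cring_hom_subst4: "cring_hom (subst4 x)"
proof
  interpret c: cring_hom const3 by (rule cring_hom_const3)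
  show "subst4 x 1 = 1"
    using subst4_single[of x 0 1] by (simp add: c.one)
  show "subst4 x (p + q) = subst4 x p + subst4 x q" for p q by (rule subst4_add)
  have 0: "subst4 x 0 = 0" by (simp add: subst4_def)
  have 1: "subst4 x (Poly_Mapping.single m c * Poly_Mapping.single n d)
    = subst4 x (Poly_Mapping.single m c) * subst4 x (Poly_Mapping.single n d)" for m c n d
    by (simp add: mult_single subst4_single c.mult lookup_add power_add prod.distrib)
  have 2: "subst4 x (Poly_Mapping.single m c * q) = subst4 x (Poly_Mapping.single m c) * subst4 x q" for m c q
    by (induction q rule: poly_mapping_single_induct) (simp_all add: 0 1 distrib_left subst4_add)
  show "subst4 x (p * q) = subst4 x p * subst4 x q" for p q
    by (induction p rule: poly_mapping_single_induct) (simp_all add: 0 2 distrib_right subst4_add)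
qed

lemma subst4_Const: "subst4 x (Const k) = const3 k"
  using subst4_single[of x 0 k] by (simp add: Const_def)

lemma subst4_Var: "subst4 x (Var i) = x i"
proof -
  have "(\<Prod>j\<in>UNIV. x j ^ Poly_Mapping.lookup (Poly_Mapping.single i 1) j) = (\<Prod>j\<in>UNIV. if j = i then x i else 1)"
    by (intro prod.cong) (auto simp: lookup_single when_def)
  then show ?thesis
    unfolding Var_def subst4_single by (simp add: cring_hom.one[OF cring_hom_const3])
qed

text \<open>\<open>yA\<close>, \<open>yB\<close>, \<open>yC\<close> are the halved rows of a 4 by 4
  Hadamard matrix other than the constant row, hence an orthonormal basis of
  \<open>tt\<close>.\<close>

definition yA :: "complex^4" where "yA = (\<chi> i. if i = 1 \<or> i = 2 then 1/2 else - (1/2))"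
definition yB :: "complex^4" where "yB = (\<chi> i. if i = 1 \<or> i = 3 then 1/2 else - (1/2))"
definition yC :: "complex^4" where "yC = (\<chi> i. if i = 1 \<or> i = 4 then 1/2 else - (1/2))"

lemma root_vec_y:
  "root_vec 1 2 = yB + yC" "root_vec 3 4 = yB - yC" "root_vec 1 4 = yA + yB"
  "root_vec 2 3 = yA - yB" "root_vec 1 3 = yA + yC" "root_vec 2 4 = yA - yC"
  by (simp_all add: root_vec_def std_basis_def vec_eq_iff axis_def yA_def yB_def yC_def forall_4)

lemma positive_roots_eq:
  "positive_roots = {yB + yC, yB - yC, yA + yB, yA - yB, yA + yC, yA - yC}"
proof -
  have "positive_roots = {root_vec 1 2, root_vec 3 4, root_vec 1 4, root_vec 2 3, root_vec 1 3, root_vec 2 4}"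
    (is "_ = ?R")
  proof
    show "positive_roots \<subseteq> ?R"
    proof
      fix \<alpha> assume "\<alpha> \<in> positive_roots"
      then obtain i j where ij: "\<alpha> = root_vec i j" "1 \<le> i" "i < j" "j \<le> 4" by (auto simp: positive_roots_def)
      then have "(i = 1 \<or> i = 2 \<or> i = 3) \<and> (j = 2 \<or> j = 3 \<or> j = 4)" by arith
      with ij show "\<alpha> \<in> ?R" by auto
    qed
    show "?R \<subseteq> positive_roots" by (force simp: positive_roots_def)
  qed
  then show ?thesis unfolding root_vec_y .
qed

lemma tt_iff: "v \<in> tt \<longleftrightarrow> v $ 1 + v $ 2 + v $ 3 + v $ 4 = 0"
  by (simp add: tt_def pairing_def sum_4 std_basis_def axis_def)

lemma y_in_tt: "yA \<in> tt" "yB \<in> tt" "yC \<in> tt"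
  by (simp_all add: tt_iff yA_def yB_def yC_def)

text \<open>The coefficients are the pairings with the orthonormal basis: as the entries of
  \<open>v\<close> sum to 0, half of \<open>v $ 1 + v $ 2 - v $ 3 - v $ 4\<close> is
  \<open>v $ 1 + v $ 2\<close>, and similarly for the others.\<close>

lemma tt_expand:
  assumes "v \<in> tt"
  shows "v = (v $ 1 + v $ 2) *s yA + (v $ 1 + v $ 3) *s yB + (v $ 1 + v $ 4) *s yC"
proof -
  have e: "v $ 4 = - v $ 1 - v $ 2 - v $ 3" using assms by (simp add: tt_iff eq_neg_iff_add_eq_0 algebra_simps)
  show ?thesis
    by (simp add: vec_eq_iff forall_4 yA_def yB_def yC_def e; simp add: field_simps)
qed

lemma linear_form_add: "linear_form (u + v) = linear_form u + linear_form v"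
  by (simp add: linear_form_def Const_add distrib_right sum.distrib)

lemma linear_form_scale: "linear_form (c *s v) = Const c * linear_form v"
  by (simp add: linear_form_def Const_mult sum_distrib_left mult.assoc)

lemma linear_form_diff: "linear_form (u - v) = linear_form u - linear_form v"
  by (simp add: linear_form_def cring_hom.diff[OF cring_hom_Const] left_diff_distrib sum_subtractf)

definition Theta :: "R3 \<Rightarrow> poly4" where
  "Theta = hom_eval (hom_eval (hom_eval Const (linear_form yC)) (linear_form yB)) (linear_form yA)"

lemma cring_hom_Theta: "cring_hom Theta"
  unfolding Theta_def by (intro cring_hom_eval cring_hom_Const)

interpretation Theta: cring_hom Theta by (rule cring_hom_Theta)

lemma Theta_var: "Theta va = linear_form yA" "Theta vb = linear_form yB" "Theta vc = linear_form yC"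
  and Theta_const3: "Theta (const3 k) = Const k"
  by (simp_all add: Theta_def va_def vb_def vc_def const3_def hom_eval_pCons cring_hom_eval cring_hom_Const
    cring_hom.one cring_hom.zero)

text \<open>The orthogonal projection of the i-th basis vector to \<open>tt\<close>, written in a,
  b, c. Since projection fixes \<open>tt\<close>, the induced substitution is a left inverse of
  \<open>Theta\<close>.\<close>

definition xcoord :: "4 \<Rightarrow> R3" where
  "xcoord i = const3 (yA $ i) * va + const3 (yB $ i) * vb + const3 (yC $ i) * vc"

definition Sigma4 :: "poly4 \<Rightarrow> R3" where "Sigma4 = subst4 xcoord"

interpretation Sigma4: cring_hom Sigma4 unfolding Sigma4_def by (rule cring_hom_subst4)

lemma Sigma4_Const: "Sigma4 (Const k) = const3 k"
  by (simp add: Sigma4_def subst4_Const)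

lemma Sigma4_y: "Sigma4 (linear_form yA) = va" "Sigma4 (linear_form yB) = vb" "Sigma4 (linear_form yC) = vc"
proof -
  interpret c: cring_hom const3 by (rule cring_hom_const3)
  have lf: "Sigma4 (linear_form v) = (\<Sum>i\<in>UNIV. const3 (v $ i) * xcoord i)" for v
    by (simp add: linear_form_def Sigma4.sum Sigma4.mult Sigma4_Const) (simp add: Sigma4_def subst4_Var)
  have *: "(\<Sum>i\<in>UNIV. const3 (v $ i) * xcoord i) =
    const3 (pairing v yA) * va + const3 (pairing v yB) * vb + const3 (pairing v yC) * vc" for v
    by (simp add: xcoord_def pairing_def c.sum c.mult algebra_simps sum.distrib sum_distrib_left)
  have "pairing yA yA = 1" "pairing yA yB = 0" "pairing yA yC = 0"
    "pairing yB yA = 0" "pairing yB yB = 1" "pairing yB yC = 0"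
    "pairing yC yA = 0" "pairing yC yB = 0" "pairing yC yC = 1"
    by (simp_all add: pairing_def sum_4 yA_def yB_def yC_def)
  then show "Sigma4 (linear_form yA) = va" "Sigma4 (linear_form yB) = vb" "Sigma4 (linear_form yC) = vc"
    unfolding lf * by (simp_all add: c.zero c.one)
qed

lemma R3_hom_ext:
  assumes "cring_hom g" "cring_hom h" "\<And>k. g (const3 k) = h (const3 k)"
    and "g va = h va" "g vb = h vb" "g vc = h vc"
  shows "g f = h f"
proof -
  note hs = cring_hom.add[OF assms(1)] cring_hom.add[OF assms(2)] cring_hom.mult[OF assms(1)]
    cring_hom.mult[OF assms(2)] cring_hom.zero[OF assms(1)] cring_hom.zero[OF assms(2)]
  have 1: "g [:[:p:]:] = h [:[:p:]:]" for p
  proof (induction p)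
    case (pCons c p)
    have "[:[:pCons c p:]:] = const3 c + vc * [:[:p:]:]" by (simp add: const3_def vc_def)
    then show ?case by (simp only: hs assms pCons)
  qed (simp add: hs)
  have 2: "g [:p:] = h [:p:]" for p
  proof (induction p)
    case (pCons c p)
    have "[:pCons c p:] = [:[:c:]:] + vb * [:p:]" by (simp add: vb_def)
    then show ?case by (simp only: hs assms pCons 1)
  qed (simp add: hs)
  show ?thesis
  proof (induction f)
    case (pCons c p)
    have "pCons c p = [:c:] + va * p" by (simp add: va_def)
    then show ?case by (simp only: hs assms pCons 2)
  qed (simp add: hs)
qed

lemma Sigma4_Theta: "Sigma4 (Theta f) = f"
proof (rule R3_hom_ext[where h = "\<lambda>f. f"])
  show "cring_hom (\<lambda>f. Sigma4 (Theta f))"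
    by (rule cring_hom_comp[OF Sigma4.cring_hom_axioms cring_hom_Theta])
  show "cring_hom (\<lambda>f :: R3. f)" by unfold_locales simp_all
qed (simp_all add: Theta_var Theta_const3 Sigma4_y Sigma4_Const)

lemma Theta_inj: "Theta f = Theta g \<longleftrightarrow> f = g"
  by (metis Sigma4_Theta)

lemma sym_alg_eq: "sym_alg = range Theta"
proof
  show "sym_alg \<subseteq> range Theta"
  proof
    fix p assume "p \<in> sym_alg"
    then show "p \<in> range Theta"
    proof induction
      case (sym_alg_Const c)
      show ?case using Theta_const3 by (metis rangeI)
    next
      case (sym_alg_linear_form v)
      have "linear_form v = Theta (const3 (v $ 1 + v $ 2) * va + const3 (v $ 1 + v $ 3) * vb + const3 (v $ 1 + v $ 4) * vc)"
        by (subst tt_expand[OF sym_alg_linear_form])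
          (simp add: linear_form_add linear_form_scale Theta.add Theta.mult Theta_const3 Theta_var)
      then show ?case by blast
    next
      case (sym_alg_add p q)
      then obtain f g where "p = Theta f" "q = Theta g" by auto
      then have "p + q = Theta (f + g)" by (simp add: Theta.add)
      then show ?case by blast
    next
      case (sym_alg_mult p q)
      then obtain f g where "p = Theta f" "q = Theta g" by auto
      then have "p * q = Theta (f * g)" by (simp add: Theta.mult)
      then show ?case by blast
    qed
  qed
  show "range Theta \<subseteq> sym_alg"
  proof -
    have 1: "hom_eval h s f \<in> sym_alg" if "cring_hom h" "\<And>c. h c \<in> sym_alg" "s \<in> sym_alg" for h s and f :: "'a::comm_ring_1 poly"
      using that by (induction f) (auto simp: hom_eval_pCons intro: sym_alg.intros sym_alg_Const[of 0, unfolded cring_hom.zero[OF cring_hom_Const]])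
    show ?thesis
      unfolding Theta_def
      by (auto intro!: 1 cring_hom_eval cring_hom_Const sym_alg.intros y_in_tt)
  qed
qed

section \<open>The exterior algebra\<close>

text \<open>The sign for which e_i wedge e_(K - {i}) is this sign times e_K, when i lies in
  K.\<close>

definition ext_sign :: "4 set \<Rightarrow> 4 \<Rightarrow> poly4" where
  "ext_sign K i = (- 1) ^ card {j \<in> K. j < i}"

lemma ext_vec_nth: "ext_vec v $ I = (\<Sum>i\<in>UNIV. if I = {i} then Const (v $ i) else 0)"
  by (auto simp: ext_vec_def sum_component axis_def intro!: sum.cong)

lemma wedge_ext_vec_nth:
  "wedge (ext_vec v) w $ K = (\<Sum>i\<in>K. ext_sign K i * Const (v $ i) * w $ (K - {i}))"
proof -
  have single: "ext_vec v $ {i} = Const (v $ i)" for i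
    by (simp add: ext_vec_nth)
  have card: "card {(k, j). k \<in> {i} \<and> j \<in> K - {i} \<and> j < k} = card {j \<in> K. j < i}" for i
  proof -
    have "{(k, j). k \<in> {i} \<and> j \<in> K - {i} \<and> j < k} = Pair i ` {j \<in> K. j < i}" by auto
    then show ?thesis by (simp add: card_image inj_on_def)
  qed
  let ?f = "\<lambda>I. (- 1) ^ card {(i, j). i \<in> I \<and> j \<in> K - I \<and> j < i} * ext_vec v $ I * w $ (K - I)"
  have "wedge (ext_vec v) w $ K = (\<Sum>I\<in>Pow K. ?f I)"
    by (simp add: wedge_def)
  also have "\<dots> = (\<Sum>I\<in>(\<lambda>i. {i}) ` K. ?f I)"
    by (intro sum.mono_neutral_right) (auto simp: ext_vec_nth intro!: sum.neutral)
  also have "\<dots> = (\<Sum>i\<in>K. ?f {i})"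
    by (subst sum.reindex) (auto simp: inj_on_def)
  finally show ?thesis by (simp only: card single ext_sign_def)
qed

text \<open>Removing the smaller index lowers the count for the larger one by 1, while removing the
  larger index does not affect the smaller one.\<close>

lemma ext_sign_anti:
  assumes "i \<in> K" "j \<in> K" "i \<noteq> j"
  shows "ext_sign K i * ext_sign (K - {i}) j = - (ext_sign K j * ext_sign (K - {j}) i)"
proof -
  have *: "ext_sign K i * ext_sign (K - {i}) j = - (ext_sign K j * ext_sign (K - {j}) i)"
    if "i \<in> K" "i < j" for i j
  proof -
    have "{k \<in> K. k < j} = insert i {k \<in> K - {i}. k < j}" "{k \<in> K - {j}. k < i} = {k \<in> K. k < i}"
      using that by auto
    then show ?thesis by (simp add: ext_sign_def)
  qed
  show ?thesis
    using *[of i j] *[of j i] assms by (cases i j rule: linorder_cases) auto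
qed

lemma wedge_anti:
  "wedge (ext_vec u) (wedge (ext_vec v) w) = - wedge (ext_vec v) (wedge (ext_vec u) w)"
proof -
  have "(\<Sum>i\<in>K. \<Sum>j\<in>K - {i}. ext_sign K i * ext_sign (K - {i}) j * (Const (u $ i) * Const (v $ j) * w $ (K - {i} - {j}))) =
     - (\<Sum>i\<in>K. \<Sum>j\<in>K - {i}. ext_sign K i * ext_sign (K - {i}) j * (Const (v $ i) * Const (u $ j) * w $ (K - {i} - {j})))"
    for K
  proof -
    have d: "(\<Sum>i\<in>K. \<Sum>j\<in>K - {i}. f i j) = (\<Sum>i\<in>K. \<Sum>j\<in>K. if i = j then 0 else f i j)" for f :: "4 \<Rightarrow> 4 \<Rightarrow> poly4"
      by (intro sum.cong refl sum.mono_neutral_cong_left) auto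
    have "(\<Sum>i\<in>K. \<Sum>j\<in>K - {i}. ext_sign K i * ext_sign (K - {i}) j * (Const (v $ i) * Const (u $ j) * w $ (K - {i} - {j})))
      = (\<Sum>j\<in>K. \<Sum>i\<in>K. if i = j then 0 else ext_sign K i * ext_sign (K - {i}) j * (Const (v $ i) * Const (u $ j) * w $ (K - {i} - {j})))"
      unfolding d by (rule sum.swap)
    also have "\<dots> = (\<Sum>j\<in>K. \<Sum>i\<in>K. - (if j = i then 0 else ext_sign K j * ext_sign (K - {j}) i * (Const (u $ j) * Const (v $ i) * w $ (K - {j} - {i}))))"
    proof (intro sum.cong refl, goal_cases)
      case (1 j i)
      have "K - {i} - {j} = K - {j} - {i}" by auto
      then show ?case using ext_sign_anti[OF 1(2) 1(1)] by (auto simp: algebra_simps)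
    qed
    finally show ?thesis unfolding d by (simp add: sum_negf)
  qed
  then show ?thesis
    by (simp add: vec_eq_iff wedge_ext_vec_nth sum_distrib_left mult_ac)
qed

lemma Const_0: "Const 0 = 0" by (simp add: Const_def)
lemma Const_minus: "Const (- c) = - Const c" by (simp add: Const_def single_uminus)

lemma wedge_add_right: "wedge (ext_vec v) (w + w') = wedge (ext_vec v) w + wedge (ext_vec v) w'"
  by (simp add: vec_eq_iff wedge_ext_vec_nth distrib_left sum.distrib)

lemma wedge_smult_right: "wedge (ext_vec v) (p *s w) = p *s wedge (ext_vec v) w"
  by (simp add: vec_eq_iff wedge_ext_vec_nth sum_distrib_left mult_ac)

lemma wedge_zero_right: "wedge (ext_vec v) 0 = 0"
  by (simp add: vec_eq_iff wedge_ext_vec_nth)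

lemma wedge_minus_right: "wedge (ext_vec v) (- w) = - wedge (ext_vec v) w"
  by (simp add: vec_eq_iff wedge_ext_vec_nth sum_negf)

lemma wedge_sum_right: "wedge (ext_vec v) (\<Sum>i\<in>I. f i) = (\<Sum>i\<in>I. wedge (ext_vec v) (f i))"
  by (induction I rule: infinite_finite_induct) (simp_all add: wedge_zero_right wedge_add_right)

lemma wedge_add_left: "wedge (ext_vec (u + v)) w = wedge (ext_vec u) w + wedge (ext_vec v) w"
  by (simp add: vec_eq_iff wedge_ext_vec_nth Const_add distrib_left distrib_right sum.distrib)

lemma wedge_scale_left: "wedge (ext_vec (c *s v)) w = Const c *s wedge (ext_vec v) w"
  by (simp add: vec_eq_iff wedge_ext_vec_nth Const_mult sum_distrib_left mult_ac)

lemma wedge_zero_left: "wedge (ext_vec 0) w = 0"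
  by (simp add: vec_eq_iff wedge_ext_vec_nth Const_0)

lemma wedge_minus_left: "wedge (ext_vec (- v)) w = - wedge (ext_vec v) w"
  by (simp add: vec_eq_iff wedge_ext_vec_nth Const_minus sum_negf)

lemma wedge_sum_left: "wedge (ext_vec (\<Sum>i\<in>I. f i)) w = (\<Sum>i\<in>I. wedge (ext_vec (f i)) w)"
  by (induction I rule: infinite_finite_induct) (simp_all add: wedge_zero_left wedge_add_left)

lemma wedge_self: "wedge (ext_vec v) (wedge (ext_vec v) w) = 0"
proof -
  have "p = 0" if "p = - p" for p :: poly4
  proof (rule poly_mapping_eqI)
    fix m show "Poly_Mapping.lookup p m = Poly_Mapping.lookup 0 m"
      using arg_cong[OF that, of "\<lambda>p. Poly_Mapping.lookup p m"] by simp
  qed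
  then show ?thesis using wedge_anti[of v v w] by (simp add: vec_eq_iff)
qed

lemma wedge_list_Nil: "wedge_list [] = axis {} 1"
  and wedge_list_Cons: "wedge_list (v # vs) = wedge (ext_vec v) (wedge_list vs)"
  by (simp_all add: wedge_list_def)

lemma wedge_list_nth_eq_0:
  assumes "card K \<noteq> length vs"
  shows "wedge_list vs $ K = 0"
  using assms
proof (induction vs arbitrary: K)
  case Nil
  then show ?case by (auto simp: wedge_list_Nil axis_def)
next
  case (Cons v vs)
  have "wedge_list vs $ (K - {i}) = 0" if "i \<in> K" for i
    using that Cons by (auto simp: card_Suc_Diff1[symmetric] simp del: card_Diff_insert card_Diff_singleton)
  then show ?case by (simp add: wedge_list_Cons wedge_ext_vec_nth)
qed

text \<open>\<open>ext_map\<close> is defined through sorted index sets, so a new factor must be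
  moved to its place. Only anticommutativity is used, which allows arbitrary vectors
  \<open>g i\<close>.\<close>

lemma wedge_insort:
  assumes "sorted xs" "distinct xs"
  shows "wedge (ext_vec (g i)) (wedge_list (map g xs)) =
    (if i \<in> set xs then 0 else ext_sign (set xs) i *s wedge_list (map g (insort i xs)))"
  using assms
proof (induction xs)
  case Nil
  then show ?case by (simp add: wedge_list_Cons ext_sign_def vec_eq_iff)
next
  case (Cons x xs)
  consider "i = x" | "i < x" | "x < i" by fastforce
  then show ?case
  proof cases
    case 1
    then show ?thesis by (simp add: wedge_list_Cons wedge_self)
  next
    case 2
    with Cons.prems have "{j \<in> insert x (set xs). j < i} = {}" by auto
    then have "ext_sign (set (x # xs)) i = 1" by (simp only: ext_sign_def list.set card.empty power_0)
    moreover have "i \<notin> set (x # xs)" using 2 Cons.prems by auto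
    ultimately show ?thesis using less_imp_le[OF 2] by (simp add: wedge_list_Cons)
  next
    case 3
    have "x \<notin> set xs" using Cons.prems by simp
    then have "{j \<in> insert x (set xs). j < i} = insert x {j \<in> set xs. j < i}" "x \<notin> {j \<in> set xs. j < i}"
      using 3 by auto
    then have s: "ext_sign (set (x # xs)) i = - ext_sign (set xs) i" by (simp add: ext_sign_def)
    have "wedge (ext_vec (g i)) (wedge_list (map g (x # xs))) =
      - wedge (ext_vec (g x)) (wedge (ext_vec (g i)) (wedge_list (map g xs)))"
      by (simp add: wedge_list_Cons wedge_anti[of "g i"])
    moreover have "- (p *s w) = (- p) *s w" for p and w :: ext4
      by (simp add: vec_eq_iff)
    ultimately show ?thesis
      using 3 not_le[THEN iffD2, OF 3] Cons s by (simp add: wedge_list_Cons wedge_zero_right wedge_smult_right)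
  qed
qed

lemma ext_map_sum: "ext_map f (\<Sum>i\<in>I. w i) = (\<Sum>i\<in>I. ext_map f (w i))"
proof (induction I rule: infinite_finite_induct)
  case (insert x F)
  then show ?case by (simp add: ext_map_add)
qed (simp_all add: ext_map_def)

lemma ext_map_axis:
  "ext_map f (axis I 1) = wedge_list (map (\<lambda>i. f (axis i 1)) (sorted_list_of_set I))"
proof -
  have "ext_map f (axis I 1) = (\<Sum>J\<in>UNIV. if J = I then wedge_list (map (\<lambda>i. f (axis i 1)) (sorted_list_of_set I)) else 0)"
    unfolding ext_map_def by (intro sum.cong) (auto simp: axis_def vec_eq_iff)
  then show ?thesis by simp
qed

lemma wedge_axis:
  "wedge (ext_vec (axis i 1)) (axis I 1) = (if i \<in> I then 0 else ext_sign I i *s axis (insert i I) 1)"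
proof -
  have "(\<Sum>k\<in>K. ext_sign K k * Const (axis i 1 $ k) * axis I 1 $ (K - {k})) =
    (if i \<in> K \<and> I = K - {i} then ext_sign K i else 0)" for K
  proof -
    have "(\<Sum>k\<in>K. ext_sign K k * Const (axis i 1 $ k) * axis I 1 $ (K - {k})) =
      (\<Sum>k\<in>K. if k = i then ext_sign K i * axis I 1 $ (K - {i}) else 0)"
      by (intro sum.cong) (auto simp: axis_def Const_0 Const_one)
    then show ?thesis by (simp add: axis_def)
  qed
  moreover have "{j. (j = i \<or> j \<in> I) \<and> j < i} = {j \<in> I. j < i}" by auto
  then have "ext_sign (insert i I) i = ext_sign I i" by (simp add: ext_sign_def)
  ultimately show ?thesis
    by (auto simp: vec_eq_iff wedge_ext_vec_nth axis_def)
qed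

text \<open>On basis elements \<open>wedge_axis\<close> and \<open>wedge_insort\<close> produce the
  same sign on both sides; the rest is bilinearity.\<close>

lemma ext_map_wedge:
  assumes "Vector_Spaces.linear (*s) (*s) f"
  shows "ext_map f (wedge (ext_vec v) w) = wedge (ext_vec (f v)) (ext_map f w)"
proof -
  interpret Vector_Spaces.linear "(*s)" "(*s)" f by fact
  have v: "v = (\<Sum>i\<in>UNIV. (v $ i) *s axis i 1)" for v :: "complex^4"
    by (rule basis_expansion[symmetric])
  have w: "w = (\<Sum>I\<in>UNIV. (w $ I) *s axis I 1)" for w :: ext4
    by (simp add: vec_eq_iff sum_component axis_def if_distrib[of "\<lambda>x. _ * x"] cong: if_cong)
  have 1: "ext_map f (wedge (ext_vec (axis i 1)) (axis I 1)) = wedge (ext_vec (f (axis i 1))) (ext_map f (axis I 1))" for i I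
    unfolding ext_map_axis wedge_axis
    by (subst wedge_insort[where g = "\<lambda>i. f (axis i 1)"])
      (simp_all add: ext_map_smult ext_map_axis sorted_list_of_set_insert_remove ext_map_def[of f 0])
  have 2: "ext_map f (wedge (ext_vec (axis i 1)) w) = wedge (ext_vec (f (axis i 1))) (ext_map f w)" for i
    by (subst (1 2) w) (simp add: wedge_sum_right wedge_smult_right ext_map_sum ext_map_smult 1)
  show ?thesis
    by (subst (1 2) v) (simp add: wedge_sum_left wedge_scale_left ext_map_sum ext_map_smult 2 sum scale)
qed

lemma ext_map_wedge_list:
  assumes "Vector_Spaces.linear (*s) (*s) f"
  shows "ext_map f (wedge_list vs) = wedge_list (map f vs)"
proof (induction vs)
  case Nil
  show ?case by (simp add: wedge_list_Nil ext_map_axis)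
next
  case (Cons v vs)
  then show ?case by (simp add: wedge_list_Cons ext_map_wedge[OF assms])
qed

lemma linear_reflection: "Vector_Spaces.linear (*s) (*s) (reflection \<alpha>)"
  by unfold_locales
    (simp_all add: reflection_def pairing_def vec_eq_iff sum.distrib sum_distrib_left
      algebra_simps add_divide_distrib)

lemma homogeneous_wedge:
  assumes "w \<in> homogeneous d"
  shows "wedge (ext_vec v) w \<in> homogeneous (d + 1)"
  unfolding homogeneous_def
proof (clarify)
  fix K m assume "Poly_Mapping.lookup (wedge (ext_vec v) w $ K) m \<noteq> 0"
  then obtain i where i: "i \<in> K" "Poly_Mapping.lookup (ext_sign K i * Const (v $ i) * w $ (K - {i})) m \<noteq> 0"
    unfolding wedge_ext_vec_nth lookup_sum by (meson sum.not_neutral_contains_not_neutral)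
  have "ext_sign K i * Const (v $ i) = Const ((-1) ^ card {j \<in> K. j < i} * v $ i)"
    unfolding ext_sign_def Const_mult
    by (cases "even (card {j \<in> K. j < i})") (simp_all add: Const_one Const_minus)
  moreover have "Poly_Mapping.lookup (Const c * p) m = c * Poly_Mapping.lookup p m" for c p
    by (simp add: Const_def mult_map_scale_conv_mult[symmetric] map.rep_eq when_def)
  ultimately have "Poly_Mapping.lookup (w $ (K - {i})) m \<noteq> 0" using i by auto
  then have "card (K - {i}) + 2 * (\<Sum>i\<in>UNIV. Poly_Mapping.lookup m i) = d"
    using assms by (auto simp: homogeneous_def)
  then show "card K + 2 * (\<Sum>i\<in>UNIV. Poly_Mapping.lookup m i) = d + 1"
    using card_Suc_Diff1[OF _ i(1)] by auto
qed

section \<open>Coordinates on the fibre\<close>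

text \<open>Coordinates with respect to a basis of the fibre over \<open>R3\<close>. The cyclic
  order in degree 2 makes each product complementary to the vector in the same position in degree 1,
  without signs.\<close>

definition mk :: "(nat \<Rightarrow> R3) \<Rightarrow> ext4" where
  "mk x = Theta (x 0) *s wedge_list [] + Theta (x 1) *s wedge_list [yA] + Theta (x 2) *s wedge_list [yB] +
     Theta (x 3) *s wedge_list [yC] + Theta (x 4) *s wedge_list [yB, yC] + Theta (x 5) *s wedge_list [yC, yA] +
     Theta (x 6) *s wedge_list [yA, yB] + Theta (x 7) *s wedge_list [yA, yB, yC]"

lemma all_less_8: "(\<forall>i<8. P i) \<longleftrightarrow> P 0 \<and> P 1 \<and> P 2 \<and> P 3 \<and> P 4 \<and> P 5 \<and> P 6 \<and> P (7::nat)"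
proof -
  have "i \<in> {0,1,2,3,4,5,6,7}" if "i < 8" for i :: nat using that by auto
  then show ?thesis by (auto simp: less_Suc_eq)
qed

lemma mk_add: "mk x + mk y = mk (\<lambda>i. x i + y i)"
  by (simp add: mk_def Theta.add vec_eq_iff distrib_right)

lemma mk_diff: "mk x - mk y = mk (\<lambda>i. x i - y i)"
  by (simp add: mk_def Theta.diff vec_eq_iff left_diff_distrib)

lemma mk_smult: "Theta q *s mk x = mk (\<lambda>i. q * x i)"
  by (simp add: mk_def Theta.mult vec_eq_iff distrib_left mult.assoc)

lemma mk_cong: "(\<And>i. i < 8 \<Longrightarrow> x i = y i) \<Longrightarrow> mk x = mk y"
  by (simp add: mk_def)

lemma mk_0: "mk (\<lambda>i. 0) = 0"
  by (simp add: mk_def Theta.zero vec_eq_iff)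

lemmas wedge_y_normal = wedge_self wedge_anti[of yB yA] wedge_anti[of yC yA] wedge_anti[of yC yB]
  wedge_add_right wedge_smult_right wedge_minus_right wedge_zero_right wedge_list_Cons wedge_minus_left

lemma wedge_y_mk:
  "wedge (ext_vec yA) (mk x) = mk ((!) [0, x 0, 0, 0, 0, - x 3, x 2, x 4])"
  "wedge (ext_vec yB) (mk x) = mk ((!) [0, 0, x 0, 0, x 3, 0, - x 1, x 5])"
  "wedge (ext_vec yC) (mk x) = mk ((!) [0, 0, 0, x 0, - x 2, x 1, 0, x 6])"
  by (simp_all add: mk_def wedge_y_normal Theta.uminus Theta.zero)
    (simp_all add: vec_eq_iff algebra_simps)

lemma Const_Theta: "Const k = Theta (const3 k)"
  by (simp add: Theta_const3)

lemma wedge_tt_mk: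
  assumes "v \<in> tt"
  shows "wedge (ext_vec v) (mk x) \<in> range mk"
  by (subst tt_expand[OF assms])
    (simp add: wedge_add_left wedge_scale_left wedge_y_mk Const_Theta mk_smult mk_add)

lemma wedge_list_mk: "set vs \<subseteq> tt \<Longrightarrow> wedge_list vs \<in> range mk"
proof (induction vs)
  case Nil
  have "wedge_list [] = mk ((!) [1, 0, 0, 0, 0, 0, 0, 0])"
    by (simp add: mk_def Theta.one Theta.zero vec_eq_iff)
  then show ?case by blast
next
  case (Cons v vs)
  then obtain x where "wedge_list vs = mk x" by auto
  then show ?case using wedge_tt_mk[of v x] Cons.prems by (simp add: wedge_list_Cons)
qed

lemma fibre_eq: "fibre = range mk"
proof
  interpret M: module ext_scale by (rule module_ext_scale)
  have scale: "ext_scale c (mk x) = mk (\<lambda>i. const3 c * x i)" for c x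
    by (simp add: ext_scale_def Const_Theta mk_smult)
  have sub: "M.subspace (range mk)"
    unfolding M.subspace_def using mk_0 by (auto simp: scale mk_add)
  have "ext_alg \<subseteq> range mk"
    unfolding ext_alg_def by (intro M.span_minimal sub) (use wedge_list_mk in blast)
  then have "{p *s w |p w. p \<in> sym_alg \<and> w \<in> ext_alg} \<subseteq> range mk"
    by (auto simp: sym_alg_eq) (use mk_smult in force)
  then show "fibre \<subseteq> range mk"
    unfolding fibre_def by (rule M.span_minimal[OF _ sub])
  have *: "Theta q *s wedge_list vs \<in> fibre" if "set vs \<subseteq> tt" for q vs
  proof -
    have "wedge_list vs \<in> ext_alg" unfolding ext_alg_def using that by (intro M.span_base) blast
    then show ?thesis unfolding fibre_def by (intro M.span_base) (auto simp: sym_alg_eq)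
  qed
  show "range mk \<subseteq> fibre"
    unfolding mk_def by (auto intro!: fibre_add * y_in_tt)
qed

text \<open>The constant 1/2 is the determinant of the first three columns of \<open>yA\<close>,
  \<open>yB\<close>, \<open>yC\<close>. The index set avoids 4, which equals 0 in this type and
  would precede the others.\<close>

lemma mk_top: "mk x $ {1, 2, 3} = Theta (x 7) * Const (1/2)"
proof -
  have c: "card {1, 2, 3 :: 4} = 3" by simp
  have lt: "(1::4) < 2" "(1::4) < 3" "(2::4) < 3" "\<not> (2::4) < 1" "\<not> (3::4) < 1" "\<not> (3::4) < 2"
    by (simp_all add: less_bit0_def bit0.Rep_numeral bit0.Rep_1)
  have s: "{j \<in> {1,2,3}. j < 1} = ({} :: 4 set)" "{j \<in> {1,2,3}. j < 2} = {1 :: 4}" "{j \<in> {1,2,3}. j < 3} = {1, 2 :: 4}"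
    "{j \<in> {2,3}. j < 2} = ({} :: 4 set)" "{j \<in> {2,3}. j < 3} = {2 :: 4}"
    "{j \<in> {1,3}. j < 1} = ({} :: 4 set)" "{j \<in> {1,3}. j < 3} = {1 :: 4}"
    "{j \<in> {1,2}. j < 1} = ({} :: 4 set)" "{j \<in> {1,2}. j < 2} = {1 :: 4}"
    "{j \<in> {k}. j < k} = ({} :: 4 set)" for k
    using lt by auto
  have d: "{1,2,3} - {1} = {2,3 :: 4}" "{1,2,3} - {2} = {1,3 :: 4}" "{1,2,3} - {3} = {1,2 :: 4}"
    "{2,3} - {2} = {3 :: 4}" "{2,3} - {3} = {2 :: 4}" "{1,3} - {1} = {3 :: 4}" "{1,3} - {3} = {1 :: 4}"
    "{1,2} - {1} = {2 :: 4}" "{1,2} - {2} = {1 :: 4}"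
    by auto
  have e: "ext_sign {1, 2, 3} 1 = 1" "ext_sign {1, 2, 3} 2 = - 1" "ext_sign {1, 2, 3} 3 = 1"
    "ext_sign {2, 3} 2 = 1" "ext_sign {2, 3} 3 = - 1" "ext_sign {1, 3} 1 = 1" "ext_sign {1, 3} 3 = - 1"
    "ext_sign {1, 2} 1 = 1" "ext_sign {1, 2} 2 = - 1" "ext_sign {k} k = 1" for k
    by (simp_all only: ext_sign_def s) simp_all
  have 1: "wedge_list [u] $ {i} = Const (u $ i)" for u i
    by (simp add: wedge_list_Cons wedge_list_Nil wedge_ext_vec_nth e axis_def)
  have 2: "wedge_list [u, v] $ {2, 3} = Const (u $ 2) * Const (v $ 3) - Const (u $ 3) * Const (v $ 2)"
    "wedge_list [u, v] $ {1, 3} = Const (u $ 1) * Const (v $ 3) - Const (u $ 3) * Const (v $ 1)"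
    "wedge_list [u, v] $ {1, 2} = Const (u $ 1) * Const (v $ 2) - Const (u $ 2) * Const (v $ 1)" for u v
    by (simp_all only: wedge_list_Cons[of u] wedge_ext_vec_nth) (simp_all add: e d 1)
  have 3: "wedge_list [u, v, w] $ {1, 2, 3} = Const (u $ 1) * wedge_list [v, w] $ {2, 3} -
    Const (u $ 2) * wedge_list [v, w] $ {1, 3} + Const (u $ 3) * wedge_list [v, w] $ {1, 2}" for u v w
    by (simp only: wedge_list_Cons[of u] wedge_ext_vec_nth) (simp add: e d)
  have "wedge_list [yA, yB, yC] $ {1, 2, 3} = Const (1/2)"
    unfolding 2 3 by (simp add: Const_mult[symmetric] Const_add[symmetric] cring_hom.diff[OF cring_hom_Const, symmetric] yA_def yB_def yC_def)
  then show ?thesis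
    by (simp add: mk_def wedge_list_nth_eq_0 c)
qed

text \<open>Wedging with the complementary basis vectors moves each coordinate to the top degree.\<close>

definition to_top :: "nat \<Rightarrow> ext4 \<Rightarrow> ext4" where
  "to_top i w = (let a = wedge (ext_vec yA); b = wedge (ext_vec yB); c = wedge (ext_vec yC) in
     [a (b (c w)), b (c w), c (a w), a (b w), a w, b w, c w, w] ! i)"

definition exterior_degree :: "nat \<Rightarrow> nat" where
  "exterior_degree = (!) [0, 1, 1, 1, 2, 2, 2, 3]"

lemma to_top_mk: "i < 8 \<Longrightarrow> to_top i (mk x) $ {1, 2, 3} = Theta (x i) * Const (1/2)"
proof -
  have "\<forall>i<8. to_top i (mk x) $ {1, 2, 3} = Theta (x i) * Const (1/2)"
    unfolding all_less_8 by (simp add: to_top_def Let_def wedge_y_mk mk_top)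
  then show "i < 8 \<Longrightarrow> to_top i (mk x) $ {1, 2, 3} = Theta (x i) * Const (1/2)" by blast
qed

lemma coordinate_eq:
  assumes "i < 8"
  shows "x i = 2 * Sigma4 (to_top i (mk x) $ {1, 2, 3})"
proof -
  have "2 * const3 (1/2) = 1" by (simp add: const3_def numeral_poly one_pCons)
  moreover have "2 * (x i * const3 (1/2)) = x i * (2 * const3 (1/2))" by (simp only: ac_simps)
  ultimately show ?thesis
    unfolding to_top_mk[OF assms] Sigma4.mult Sigma4_Theta Sigma4_Const by simp
qed

lemma mk_eq_iff: "mk x = mk y \<longleftrightarrow> (\<forall>i<8. x i = y i)"
  using coordinate_eq mk_cong by metis

section \<open>Reflections in coordinates and the edge condition\<close>

lemma reflection_y:
  "reflection (yB + yC) yA = yA" "reflection (yB + yC) yB = - yC" "reflection (yB + yC) yC = - yB"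
  "reflection (yB - yC) yA = yA" "reflection (yB - yC) yB = yC" "reflection (yB - yC) yC = yB"
  "reflection (yA + yB) yA = - yB" "reflection (yA + yB) yB = - yA" "reflection (yA + yB) yC = yC"
  "reflection (yA - yB) yA = yB" "reflection (yA - yB) yB = yA" "reflection (yA - yB) yC = yC"
  "reflection (yA + yC) yA = - yC" "reflection (yA + yC) yB = yB" "reflection (yA + yC) yC = - yA"
  "reflection (yA - yC) yA = yC" "reflection (yA - yC) yB = yB" "reflection (yA - yC) yC = yA"
  by (simp_all add: reflection_def pairing_def sum_4 vec_eq_iff forall_4 yA_def yB_def yC_def)

lemma ext_map_reflection_mk:
  "ext_map (reflection (yB + yC)) (mk x) = mk ((!) [x 0, x 1, - x 3, - x 2, - x 4, x 6, x 5, - x 7])"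
  "ext_map (reflection (yB - yC)) (mk x) = mk ((!) [x 0, x 1, x 3, x 2, - x 4, - x 6, - x 5, - x 7])"
  "ext_map (reflection (yA + yB)) (mk x) = mk ((!) [x 0, - x 2, - x 1, x 3, x 5, x 4, - x 6, - x 7])"
  "ext_map (reflection (yA - yB)) (mk x) = mk ((!) [x 0, x 2, x 1, x 3, - x 5, - x 4, - x 6, - x 7])"
  "ext_map (reflection (yA + yC)) (mk x) = mk ((!) [x 0, - x 3, x 2, - x 1, x 6, - x 5, x 4, - x 7])"
  "ext_map (reflection (yA - yC)) (mk x) = mk ((!) [x 0, x 3, x 2, x 1, - x 6, - x 5, - x 4, - x 7])"
  unfolding mk_def ext_map_add ext_map_smult ext_map_wedge_list[OF linear_reflection] list.map reflection_y
  by (simp_all add: wedge_y_normal Theta.uminus)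
    (simp_all add: vec_eq_iff algebra_simps)

text \<open>With S the reflection, applying S to the first equation and subtracting the second
  eliminates \<open>m\<close>: S x - eta x = 2 alpha S n. As 2 is invertible, only divisibility by
  the root remains.\<close>

lemma edge_iff:
  assumes S: "\<And>x. ext_map (reflection \<alpha>) (mk x) = mk (\<sigma> x)"
    and inv: "\<And>x. \<forall>i<8. \<sigma> (\<sigma> x) i = x i"
    and r: "linear_form \<alpha> = Theta r"
  shows "(\<exists>m\<in>fibre. \<exists>n\<in>fibre. mk x = m + linear_form \<alpha> *s n \<and>
      Const \<eta> *s mk x = ext_map (reflection \<alpha>) m - linear_form \<alpha> *s ext_map (reflection \<alpha>) n)
    \<longleftrightarrow> (\<forall>i<8. r dvd \<sigma> x i - const3 \<eta> * x i)" (is "?L \<longleftrightarrow> ?R")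
proof
  let ?S = "ext_map (reflection \<alpha>)"
  assume ?L
  then obtain m n where mn: "n \<in> fibre" "mk x = m + linear_form \<alpha> *s n"
    "Const \<eta> *s mk x = ?S m - linear_form \<alpha> *s ?S n" by blast
  obtain y where y: "n = mk y" using mn(1) by (auto simp: fibre_eq)
  have "?S (mk x) = ?S m + linear_form \<alpha> *s ?S n"
    by (simp add: mn(2) ext_map_add ext_map_smult)
  with mn(3) have "?S (mk x) - Const \<eta> *s mk x = Theta (2 * r) *s ?S n"
    by (simp add: r Theta.mult Theta.numeral vec_eq_iff algebra_simps)
  then have "\<forall>i<8. \<sigma> x i - const3 \<eta> * x i = 2 * r * \<sigma> y i"
    unfolding y S Const_Theta mk_smult mk_diff mk_eq_iff .
  then show ?R by simp
next
  let ?S = "ext_map (reflection \<alpha>)"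
  assume ?R
  then have "\<forall>i. \<exists>z. i < 8 \<longrightarrow> \<sigma> x i - const3 \<eta> * x i = r * z" by (auto elim!: dvdE)
  then obtain z where z: "\<forall>i<8. \<sigma> x i - const3 \<eta> * x i = r * z i" by metis
  \<comment> \<open>Solves S x - eta x = 2 alpha S n for \<open>n\<close>, as S is an
    involution.\<close>
  define n where "n = mk (\<sigma> (\<lambda>i. half * z i))"
  define m where "m = mk x - linear_form \<alpha> *s n"
  have Sn: "?S n = mk (\<lambda>i. half * z i)" unfolding n_def S mk_eq_iff using inv .
  have m': "m = mk (\<lambda>i. x i - r * \<sigma> (\<lambda>i. half * z i) i)"
    by (simp add: m_def n_def r mk_smult mk_diff)
  have "mk x = m + linear_form \<alpha> *s n" by (simp add: m_def)
  then have "?S (mk x) = ?S m + linear_form \<alpha> *s ?S n" by (simp add: ext_map_add ext_map_smult)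
  then have "?S m - linear_form \<alpha> *s ?S n = mk (\<sigma> x) - Theta (2 * r) *s ?S n"
    by (simp add: S[symmetric] r Theta.mult Theta.numeral vec_eq_iff algebra_simps)
  also have "\<dots> = mk (\<lambda>i. \<sigma> x i - 2 * r * (half * z i))"
    by (simp add: Sn mk_smult mk_diff)
  also have "\<dots> = mk (\<lambda>i. const3 \<eta> * x i)"
  proof (rule mk_cong)
    fix i :: nat assume "i < 8"
    have "2 * r * (half * z i) = (2 * half) * (r * z i)" by (simp only: ac_simps)
    then have "2 * r * (half * z i) = \<sigma> x i - const3 \<eta> * x i"
      using z \<open>i < 8\<close> by (simp only: two_half mult_1)
    then show "\<sigma> x i - 2 * r * (half * z i) = const3 \<eta> * x i"
      by (simp only:) simp
  qed
  finally have "Const \<eta> *s mk x = ?S m - linear_form \<alpha> *s ?S n"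
    by (simp add: Const_Theta mk_smult)
  moreover have "m \<in> fibre" "n \<in> fibre" by (simp_all add: fibre_eq m' n_def)
  ultimately show ?L using \<open>mk x = m + linear_form \<alpha> *s n\<close> by blast
qed

lemma dvd_double: "r dvd 2 * x \<longleftrightarrow> r dvd x" for r x :: R3
proof
  assume "r dvd 2 * x"
  then have "r dvd half * (2 * x)" by (rule dvd_mult)
  moreover have "half * (2 * x) = (2 * half) * x" by (simp only: ac_simps)
  ultimately show "r dvd x" by (simp only: two_half mult_1)
qed simp

lemma dvd_neg_diff: "r dvd - x - y \<longleftrightarrow> r dvd x + y" "r dvd - x + y \<longleftrightarrow> r dvd x - y" for r x y :: R3
proof -
  have "- x - y = - (x + y)" "- x + y = - (x - y)" by simp_all
  then show "r dvd - x - y \<longleftrightarrow> r dvd x + y" "r dvd - x + y \<longleftrightarrow> r dvd x - y"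
    by (simp_all only: dvd_minus_iff)
qed

lemma dvd_diff_swap: "r dvd x - y \<longleftrightarrow> r dvd y - x" for r x y :: R3
  by (metis dvd_minus_iff minus_diff_eq)

lemma gkm_cond_iff:
  assumes "\<eta> (yB + yC) = 1" "\<eta> (yB - yC) = 1" "\<eta> (yA + yB) = - 1" "\<eta> (yA - yB) = - 1"
    "\<eta> (yA + yC) = - 1" "\<eta> (yA - yC) = - 1"
  shows "(\<forall>\<alpha>\<in>positive_roots. \<exists>m\<in>fibre. \<exists>n\<in>fibre. mk x = m + linear_form \<alpha> *s n \<and>
      Const (\<eta> \<alpha>) *s mk x = ext_map (reflection \<alpha>) m - linear_form \<alpha> *s ext_map (reflection \<alpha>) n)
    \<longleftrightarrow> gkm_cond x"
proof -
  have lf: "linear_form (yB + yC) = Theta (vb + vc)" "linear_form (yB - yC) = Theta (vb - vc)"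
    "linear_form (yA + yB) = Theta (va + vb)" "linear_form (yA - yB) = Theta (va - vb)"
    "linear_form (yA + yC) = Theta (va + vc)" "linear_form (yA - yC) = Theta (va - vc)"
    by (simp_all add: linear_form_add linear_form_diff Theta.add Theta.diff Theta_var)
  have c: "const3 1 = 1" "const3 (- 1) = - 1" by (simp_all add: const3_def one_pCons)
  let ?E = "\<lambda>\<alpha> \<eta>. \<exists>m\<in>fibre. \<exists>n\<in>fibre. mk x = m + linear_form \<alpha> *s n \<and>
      Const \<eta> *s mk x = ext_map (reflection \<alpha>) m - linear_form \<alpha> *s ext_map (reflection \<alpha>) n"
  note comm = add.commute[of "x 3" "x 2"] add.commute[of "x 6" "x 5"] add.commute[of "x 2" "x (Suc 0)"] add.commute[of "x 3" "x (Suc 0)"] add.commute[of "x 5" "x 4"] add.commute[of "x 6" "x 4"]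
    dvd_diff_swap[of _ "x 6" "x 5"] dvd_diff_swap[of _ "x 3" "x 2"]
    dvd_diff_swap[of _ "x 2" "x (Suc 0)"] dvd_diff_swap[of _ "x 3" "x (Suc 0)"] dvd_diff_swap[of _ "x 5" "x 4"] dvd_diff_swap[of _ "x 6" "x 4"]
  have "?E (yB + yC) 1 \<longleftrightarrow>
    (vb + vc dvd x 2 + x 3 \<and> vb + vc dvd x 4 \<and> vb + vc dvd x 5 - x 6 \<and> vb + vc dvd x 7)"
    by (rule trans[OF edge_iff[OF ext_map_reflection_mk(1) _ lf(1)]])
      (auto simp: all_less_8 c dvd_double dvd_neg_diff comm)
  moreover have "?E (yB - yC) 1 \<longleftrightarrow>
    (vb - vc dvd x 2 - x 3 \<and> vb - vc dvd x 4 \<and> vb - vc dvd x 5 + x 6 \<and> vb - vc dvd x 7)"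
    by (rule trans[OF edge_iff[OF ext_map_reflection_mk(2) _ lf(2)]])
      (auto simp: all_less_8 c dvd_double dvd_neg_diff comm)
  moreover have "?E (yA + yB) (- 1) \<longleftrightarrow>
    (va + vb dvd x 0 \<and> va + vb dvd x 1 - x 2 \<and> va + vb dvd x 3 \<and> va + vb dvd x 4 + x 5)"
    by (rule trans[OF edge_iff[OF ext_map_reflection_mk(3) _ lf(3)]])
      (auto simp: all_less_8 c dvd_double dvd_neg_diff comm)
  moreover have "?E (yA - yB) (- 1) \<longleftrightarrow>
    (va - vb dvd x 0 \<and> va - vb dvd x 1 + x 2 \<and> va - vb dvd x 3 \<and> va - vb dvd x 4 - x 5)"
    by (rule trans[OF edge_iff[OF ext_map_reflection_mk(4) _ lf(4)]])
      (auto simp: all_less_8 c dvd_double dvd_neg_diff comm)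
  moreover have "?E (yA + yC) (- 1) \<longleftrightarrow>
    (va + vc dvd x 0 \<and> va + vc dvd x 1 - x 3 \<and> va + vc dvd x 2 \<and> va + vc dvd x 4 + x 6)"
    by (rule trans[OF edge_iff[OF ext_map_reflection_mk(5) _ lf(5)]])
      (auto simp: all_less_8 c dvd_double dvd_neg_diff comm)
  moreover have "?E (yA - yC) (- 1) \<longleftrightarrow>
    (va - vc dvd x 0 \<and> va - vc dvd x 1 + x 3 \<and> va - vc dvd x 2 \<and> va - vc dvd x 4 - x 6)"
    by (rule trans[OF edge_iff[OF ext_map_reflection_mk(6) _ lf(6)]])
      (auto simp: all_less_8 c dvd_double dvd_neg_diff comm)
  ultimately show ?thesis
    unfolding positive_roots_eq gkm_cond_def by (simp only: ball_simps assms simp_thms)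
qed

section \<open>Homogeneous solutions\<close>

definition scale_poly :: "('a::comm_ring_1 \<Rightarrow> 'a) \<Rightarrow> 'a \<Rightarrow> 'a poly \<Rightarrow> 'a poly" where
  "scale_poly h t = hom_eval (\<lambda>c. [:h c:]) [:0, t:]"

lemma cring_hom_scale_poly: "cring_hom h \<Longrightarrow> cring_hom (scale_poly h t)"
  unfolding scale_poly_def by (rule cring_hom_eval[OF cring_hom_comp[OF cring_hom_const_poly]])

lemma coeff_scale_poly: "cring_hom h \<Longrightarrow> coeff (scale_poly h t f) n = t ^ n * h (coeff f n)"
  unfolding scale_poly_def by (rule coeff_hom_eval_scale)

lemma scale_poly_const: "cring_hom h \<Longrightarrow> scale_poly h t [:c:] = [:h c:]"
  and scale_poly_linear: "cring_hom h \<Longrightarrow> scale_poly h t [:c, d:] = [:h c, t * h d:]"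
  by (rule poly_eqI, simp add: coeff_scale_poly coeff_pCons cring_hom.zero split: nat.splits)+

text \<open>
  Homogeneity is expressed as an eigenvector equation: \<open>rho\<close> and \<open>tau\<close> multiply each variable by 4
  and \<open>rescale\<close> multiplies exterior degree 1 by 2, so that total degree \<open>d\<close> has eigenvalue \<open>2\<^sup>d\<close>.
  Since these maps are multiplicative, the uniqueness of the coefficients \<open>P\<close> shows that they are
  homogeneous as soon as the section is.
\<close>

definition rho :: "R3 \<Rightarrow> R3" where
  "rho = scale_poly (scale_poly (scale_poly (\<lambda>k. k) 4) 4) 4"

lemma cring_hom_id: "cring_hom (\<lambda>x. x)"
  by unfold_locales simp_all

lemma cring_hom_rho: "cring_hom rho"
  unfolding rho_def by (intro cring_hom_scale_poly cring_hom_id)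

interpretation rho: cring_hom rho by (rule cring_hom_rho)

lemma coeff_numeral_power_mult: "coeff (numeral w ^ n * p) i = numeral w ^ n * coeff p i"
proof -
  have "(numeral w ^ n * p :: 'a poly) = smult (numeral w ^ n) p"
    by (simp add: numeral_poly poly_const_pow)
  then show ?thesis by simp
qed

lemma coeff_rho:
  "coeff (coeff (coeff (rho f) i) j) k = 4 ^ (i + j + k) * coeff (coeff (coeff f i) j) k"
  by (simp add: rho_def coeff_scale_poly cring_hom_scale_poly cring_hom_id coeff_numeral_power_mult power_add)

lemma rho_var: "rho va = 4 * va" "rho vb = 4 * vb" "rho vc = 4 * vc" "rho (const3 k) = const3 k"
proof -
  note e = scale_poly_const scale_poly_linear
  note e' = e[OF cring_hom_id] e[OF cring_hom_scale_poly[OF cring_hom_id]]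
    e[OF cring_hom_scale_poly[OF cring_hom_scale_poly[OF cring_hom_id]]]
  have one: "scale_poly (\<lambda>k. k) 4 1 = (1 :: complex poly)" "scale_poly (scale_poly (\<lambda>k. k) 4) 4 1 = (1 :: complex poly poly)"
    by (simp_all add: cring_hom.one cring_hom_scale_poly cring_hom_id)
  have zero: "scale_poly (\<lambda>k. k) 4 0 = (0 :: complex poly)" "scale_poly (scale_poly (\<lambda>k. k) 4) 4 0 = (0 :: complex poly poly)"
    by (simp_all add: cring_hom.zero cring_hom_scale_poly cring_hom_id)
  show "rho va = 4 * va" "rho vb = 4 * vb" "rho vc = 4 * vc" "rho (const3 k) = const3 k"
    unfolding rho_def va_def vb_def vc_def const3_def e' one zero
    by (simp_all add: numeral_poly)
qed

lemma rho_const_poly: "rho [:p:] \<in> range (\<lambda>k. [:k:])"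
  unfolding rho_def
  by (subst scale_poly_const) (simp_all add: cring_hom_scale_poly cring_hom_id)

definition tau :: "poly4 \<Rightarrow> poly4" where
  "tau = Poly_Mapping.mapp (\<lambda>m c. 4 ^ (\<Sum>i\<in>UNIV. Poly_Mapping.lookup m i) * c)"

lemma lookup_tau: "Poly_Mapping.lookup (tau p) m = 4 ^ (\<Sum>i\<in>UNIV. Poly_Mapping.lookup m i) * Poly_Mapping.lookup p m"
  by (simp add: tau_def lookup_mapp when_def in_keys_iff)

lemma tau_single: "tau (Poly_Mapping.single m c) = Poly_Mapping.single m (4 ^ (\<Sum>i\<in>UNIV. Poly_Mapping.lookup m i) * c)"
  by (rule poly_mapping_eqI) (auto simp: lookup_tau lookup_single when_def)

lemma cring_hom_tau: "cring_hom tau"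
proof
  show "tau 1 = 1" using tau_single[of 0 1] by simp
  show add: "tau (p + q) = tau p + tau q" for p q
    by (rule poly_mapping_eqI) (simp add: lookup_tau lookup_add distrib_left)
  have 0: "tau 0 = 0" by (rule poly_mapping_eqI) (simp add: lookup_tau)
  have 1: "tau (Poly_Mapping.single m c * Poly_Mapping.single n d) = tau (Poly_Mapping.single m c) * tau (Poly_Mapping.single n d)" for m c n d
    by (simp add: mult_single tau_single lookup_add sum.distrib power_add mult_ac)
  have 2: "tau (Poly_Mapping.single m c * q) = tau (Poly_Mapping.single m c) * tau q" for m c q
    by (induction q rule: poly_mapping_single_induct) (simp_all add: 0 1 add distrib_left)
  show "tau (p * q) = tau p * tau q" for p q
    by (induction p rule: poly_mapping_single_induct) (simp_all add: 0 2 add distrib_right)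
qed

interpretation tau: cring_hom tau by (rule cring_hom_tau)

lemma tau_Const: "tau (Const c) = Const c"
  using tau_single[of 0 c] by (simp add: Const_def)

lemma tau_linear_form: "tau (linear_form v) = 4 * linear_form v"
proof -
  have "tau (Var i) = Poly_Mapping.single (Poly_Mapping.single i 1) 4" for i
  proof -
    have "(\<Sum>j\<in>UNIV. Poly_Mapping.lookup (Poly_Mapping.single i (1::nat)) j) = (\<Sum>j\<in>UNIV. if j = i then 1 else 0)"
      by (intro sum.cong) (auto simp: lookup_single when_def)
    then show ?thesis unfolding Var_def tau_single by simp
  qed
  also have "\<And>i. Poly_Mapping.single (Poly_Mapping.single i 1) 4 = 4 * Var i"
    unfolding Var_def single_numeral[symmetric] mult_single by simp
  finally show ?thesis
    by (simp add: linear_form_def tau.sum tau.mult tau_Const sum_distrib_left mult_ac)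
qed

lemma tau_Theta: "tau (Theta f) = Theta (rho f)"
proof -
  have 1: "cring_hom (\<lambda>f. tau (Theta f))" by (rule cring_hom_comp[OF cring_hom_tau cring_hom_Theta])
  have 2: "cring_hom (\<lambda>f. Theta (rho f))" by (rule cring_hom_comp[OF cring_hom_Theta cring_hom_rho])
  show ?thesis
    by (rule R3_hom_ext[OF 1 2])
      (simp_all add: Theta_const3 tau_Const rho_var Theta_var Theta.mult Theta.numeral tau_linear_form)
qed

text \<open>Distinct total degrees have distinct eigenvalues, so the eigenvector equation detects
  the degree of every single monomial.\<close>

lemma two_four_power: "2 ^ e * (4 ^ n * c) = 2 ^ d * c \<longleftrightarrow> c = 0 \<or> e + 2 * n = d" for c :: complex
proof -
  have "2 ^ e * (4 ^ n * c) = 2 ^ (e + 2 * n) * c" by (simp add: power_add power_mult)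
  moreover have "(2 :: complex) ^ (e + 2 * n) = 2 ^ d \<longleftrightarrow> e + 2 * n = d"
  proof -
    have "(2 :: complex) ^ a = of_nat (2 ^ a)" for a by simp
    then have "(2 :: complex) ^ (e + 2 * n) = 2 ^ d \<longleftrightarrow> (2 :: nat) ^ (e + 2 * n) = 2 ^ d"
      by (simp only: of_nat_eq_iff)
    then show ?thesis by simp
  qed
  ultimately show ?thesis by (auto simp: mult_cancel_right)
qed

definition rescale :: "ext4 \<Rightarrow> ext4" where
  "rescale w = (\<chi> I. 2 ^ card I * tau (w $ I))"

lemma lookup_two_power_mult: "Poly_Mapping.lookup (2 ^ n * p) m = 2 ^ n * Poly_Mapping.lookup p m" for p :: poly4
proof -
  have "(2 :: poly4) = Const 2" using cring_hom.numeral[OF cring_hom_Const] by metis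
  then have "(2 ^ n :: poly4) = Const (2 ^ n)" using cring_hom.power[OF cring_hom_Const] by metis
  then show ?thesis
    by (simp add: Const_def mult_map_scale_conv_mult[symmetric] map.rep_eq when_def)
qed

lemma homogeneous_iff_rescale: "w \<in> homogeneous d \<longleftrightarrow> rescale w = 2 ^ d *s w"
proof -
  have "rescale w = 2 ^ d *s w \<longleftrightarrow> (\<forall>I m. 2 ^ card I * (4 ^ (\<Sum>i\<in>UNIV. Poly_Mapping.lookup m i) * Poly_Mapping.lookup (w $ I) m)
     = 2 ^ d * Poly_Mapping.lookup (w $ I) m)"
    by (simp add: rescale_def vec_eq_iff poly_mapping_eq_iff fun_eq_iff lookup_two_power_mult lookup_tau)
  then show ?thesis unfolding two_four_power homogeneous_def by auto
qed

lemma rescale_add: "rescale (v + w) = rescale v + rescale w"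
  by (simp add: rescale_def vec_eq_iff tau.add distrib_left)

lemma rescale_smult: "rescale (p *s w) = tau p *s rescale w"
  by (simp add: rescale_def vec_eq_iff tau.mult mult_ac)

lemma rescale_wedge_list: "rescale (wedge_list vs) = 2 ^ length vs *s wedge_list vs"
proof -
  have "wedge_list vs \<in> homogeneous (length vs)"
  proof (induction vs)
    case Nil
    show ?case by (auto simp: homogeneous_def wedge_list_Nil axis_def lookup_one when_def)
  next
    case (Cons v vs)
    then show ?case using homogeneous_wedge by (simp add: wedge_list_Cons)
  qed
  then show ?thesis by (simp add: homogeneous_iff_rescale)
qed

lemma mk_homogeneous_iff:
  "mk x \<in> homogeneous d \<longleftrightarrow> (\<forall>i<8. 2 ^ exterior_degree i * rho (x i) = 2 ^ d * x i)"
proof -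
  have "rescale (mk x) = mk (\<lambda>i. 2 ^ exterior_degree i * rho (x i))"
    by (simp add: mk_def rescale_add rescale_smult rescale_wedge_list tau_Theta Theta.simps exterior_degree_def)
      (simp add: vec_eq_iff mult_ac)
  moreover have "2 ^ d *s mk x = mk (\<lambda>i. 2 ^ d * x i)"
    using mk_smult[of "2 ^ d" x] by (simp add: Theta.power Theta.numeral)
  ultimately show ?thesis by (simp add: homogeneous_iff_rescale mk_eq_iff)
qed

text \<open>The total degrees of the ten generators.\<close>

definition weight :: "nat \<Rightarrow> nat" where
  "weight = (!) [8, 7, 7, 9, 9, 8, 8, 8, 11, 10]"

lemma rho_R: "rho Rab = 16 * Rab" "rho Rac = 16 * Rac" "rho Rbc = 16 * Rbc"
  by (simp_all add: Rab_def Rac_def Rbc_def rho.simps rho_var algebra_simps)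

lemma rho_coord:
  "i < 8 \<Longrightarrow> 2 ^ exterior_degree i * rho (coord P i) = coord (\<lambda>s. 2 ^ weight s * rho (P s)) i"
proof -
  have "\<forall>i<8. 2 ^ exterior_degree i * rho (coord P i) = coord (\<lambda>s. 2 ^ weight s * rho (P s)) i"
    unfolding all_less_8
    by (simp add: exterior_degree_def coord_def weight_def rho.simps rho_var rho_R power2_eq_square)
     (simp add: algebra_simps)
  then show "i < 8 \<Longrightarrow> 2 ^ exterior_degree i * rho (coord P i) = coord (\<lambda>s. 2 ^ weight s * rho (P s)) i" by blast
qed

lemma coord_smult: "i < 8 \<Longrightarrow> coord (\<lambda>s. t * P s) i = t * coord P i"
proof -
  have "\<forall>i<8. coord (\<lambda>s. t * P s) i = t * coord P i"
    unfolding all_less_8 by (simp add: coord_def algebra_simps)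
  then show "i < 8 \<Longrightarrow> coord (\<lambda>s. t * P s) i = t * coord P i" by blast
qed

lemma coord_add: "i < 8 \<Longrightarrow> coord (\<lambda>s. P s + Q s) i = coord P i + coord Q i"
proof -
  have "\<forall>i<8. coord (\<lambda>s. P s + Q s) i = coord P i + coord Q i"
    unfolding all_less_8 by (simp add: coord_def algebra_simps)
  then show "i < 8 \<Longrightarrow> coord (\<lambda>s. P s + Q s) i = coord P i + coord Q i" by blast
qed

lemma coord_diff: "i < 8 \<Longrightarrow> coord (\<lambda>s. P s - Q s) i = coord P i - coord Q i"
  using coord_add[of i P "\<lambda>s. - 1 * Q s"] coord_smult[of i "- 1" Q] by simp

lemma admissible_diff:
  assumes "admissible P" "admissible Q"
  shows "admissible (\<lambda>s. P s - Q s)"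
  using assms by (force simp: admissible_def image_iff)

text \<open>\<open>rho\<close> preserves freedom from a, so \<open>2 ^ weight s * rho (P s)\<close>
  and \<open>2 ^ d * P s\<close> are both admissible. \<open>coord_inj\<close>, applied to their
  difference, turns one equation between sections into ten between coefficients.\<close>

lemma coord_homogeneous_iff:
  assumes "admissible P"
  shows "mk (coord P) \<in> homogeneous d \<longleftrightarrow>
    (\<forall>s<10. \<forall>i j k. coeff (coeff (coeff (P s) i) j) k \<noteq> 0 \<longrightarrow> weight s + 2 * (i + j + k) = d)"
proof -
  have const: "2 ^ n * f \<in> range (\<lambda>k. [:k:])" if "f \<in> range (\<lambda>k. [:k:])" for n and f :: R3
    using that by (auto simp: numeral_poly poly_const_pow)
  have P: "P 8 \<in> range (\<lambda>k. [:k:])" "P 9 \<in> range (\<lambda>k. [:k:])"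
    using assms by (auto simp: admissible_def)
  then have "rho (P 8) \<in> range (\<lambda>k. [:k:])" "rho (P 9) \<in> range (\<lambda>k. [:k:])"
    using rho_const_poly by auto
  then have adm: "admissible (\<lambda>s. 2 ^ weight s * rho (P s))" "admissible (\<lambda>s. 2 ^ d * P s)"
    unfolding admissible_def using P by (simp_all only: const simp_thms)
  have "mk (coord P) \<in> homogeneous d \<longleftrightarrow>
    (\<forall>i<8. coord (\<lambda>s. 2 ^ weight s * rho (P s) - 2 ^ d * P s) i = 0)"
    by (simp add: mk_homogeneous_iff rho_coord coord_diff coord_smult)
  also have "\<dots> \<longleftrightarrow> (\<forall>s<10. 2 ^ weight s * rho (P s) = 2 ^ d * P s)"
  proof
    assume "\<forall>i<8. coord (\<lambda>s. 2 ^ weight s * rho (P s) - 2 ^ d * P s) i = 0"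
    then have "2 ^ weight s * rho (P s) - 2 ^ d * P s = 0" if "s < 10" for s
      using coord_inj[OF admissible_diff[OF adm]] that by simp
    then show "\<forall>s<10. 2 ^ weight s * rho (P s) = 2 ^ d * P s" by simp
  next
    assume "\<forall>s<10. 2 ^ weight s * rho (P s) = 2 ^ d * P s"
    then show "\<forall>i<8. coord (\<lambda>s. 2 ^ weight s * rho (P s) - 2 ^ d * P s) i = 0"
      unfolding all_less_8 by (simp add: coord_def)
  qed
  also have "\<dots> \<longleftrightarrow> (\<forall>s<10. \<forall>i j k. 2 ^ weight s * (4 ^ (i + j + k) * coeff (coeff (coeff (P s) i) j) k) =
      2 ^ d * coeff (coeff (coeff (P s) i) j) k)"
    by (simp add: poly_eq_iff coeff_numeral_power_mult coeff_rho)
  finally show ?thesis unfolding two_four_power by auto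
qed

section \<open>The Hilbert series\<close>

lemma (in vector_space) dim_family:
  assumes fin: "finite J" and ind: "\<And>c. (\<Sum>q\<in>J. scale (c q) (e q)) = 0 \<Longrightarrow> \<forall>q\<in>J. c q = 0"
  shows "dim {\<Sum>q\<in>J. scale (c q) (e q) | c. True} = card J"
proof -
  have inj: "inj_on e J"
  proof (rule inj_onI, rule ccontr)
    fix p q assume pq: "p \<in> J" "q \<in> J" "e p = e q" "p \<noteq> q"
    \<comment> \<open>Equal vectors at distinct indices would satisfy this nontrivial relation; the
      indices therefore count the vectors.\<close>
    let ?c = "\<lambda>r. if r = p then 1 else if r = q then - 1 else 0"
    have "(\<Sum>r\<in>J. scale (?c r) (e r)) = (\<Sum>r\<in>J. (if r = p then e p else 0) - (if r = q then e q else 0))"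
      using pq by (intro sum.cong) auto
    also have "\<dots> = 0" using pq fin by (simp add: sum_subtractf)
    finally show False using ind[of ?c] pq by auto
  qed
  have span: "span (e ` J) = {\<Sum>q\<in>J. scale (c q) (e q) | c. True}"
  proof
    show "span (e ` J) \<subseteq> {\<Sum>q\<in>J. scale (c q) (e q) | c. True}"
    proof
      fix x assume "x \<in> span (e ` J)"
      then obtain u where "x = (\<Sum>v\<in>e ` J. scale (u v) v)" using fin by (auto simp: span_finite)
      then have "x = (\<Sum>q\<in>J. scale (u (e q)) (e q))" by (simp add: sum.reindex[OF inj])
      then show "x \<in> {\<Sum>q\<in>J. scale (c q) (e q) | c. True}"
        by (auto intro!: exI[of _ "\<lambda>q. u (e q)"])
    qed
    have "(\<Sum>q\<in>J. scale (c q) (e q)) \<in> span (e ` J)" for c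
      by (intro span_sum span_scale span_base) auto
    then show "{\<Sum>q\<in>J. scale (c q) (e q) | c. True} \<subseteq> span (e ` J)" by blast
  qed
  have "independent (e ` J)"
  proof
    assume "dependent (e ` J)"
    then obtain u v where u: "v \<in> e ` J" "u v \<noteq> 0" "(\<Sum>v\<in>e ` J. scale (u v) v) = 0"
      using dependent_finite fin by auto
    then have "(\<Sum>q\<in>J. scale (u (e q)) (e q)) = 0" by (simp add: sum.reindex[OF inj])
    with ind[of "\<lambda>q. u (e q)"] u show False by auto
  qed
  then show ?thesis
    using dim_span_eq_card_independent span card_image[OF inj] by metis
qed

text \<open>Adjoining a variable of degree 2 divides the series by 1 - t^2: a monomial in
  \<open>B n\<close> either lacks the new variable or arises from \<open>B (n - 2)\<close> by
  raising its exponent.\<close>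

lemma fps_geometric_step:
  fixes A :: "nat \<Rightarrow> 'a set"
  assumes fin: "\<And>n. finite (A n)"
  defines "B \<equiv> \<lambda>n. {(i, q). 2 * i \<le> n \<and> q \<in> A (n - 2 * i)}"
  shows "(1 - fps_X ^ 2) * Abs_fps (\<lambda>n. rat_of_nat (card (B n))) = Abs_fps (\<lambda>n. rat_of_nat (card (A n)))"
proof (rule fps_ext)
  fix n
  have finB: "finite (B n)" for n
  proof (rule finite_subset)
    show "B n \<subseteq> {..n} \<times> (\<Union>m\<in>{..n}. A m)"
    proof
      fix x assume "x \<in> B n"
      then obtain i q where "x = (i, q)" "2 * i \<le> n" "q \<in> A (n - 2 * i)" by (auto simp: B_def)
      then show "x \<in> {..n} \<times> (\<Union>m\<in>{..n}. A m)" by (auto intro!: bexI[of _ "n - 2 * i"])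
    qed
    show "finite ({..n} \<times> (\<Union>m\<in>{..n}. A m))" using fin by auto
  qed
  have "B n = Pair 0 ` A n \<union> (\<lambda>(i, q). (Suc i, q)) ` (if n < 2 then {} else B (n - 2))"
  proof (intro equalityI subsetI)
    fix x assume "x \<in> B n"
    then obtain i q where x: "x = (i, q)" "2 * i \<le> n" "q \<in> A (n - 2 * i)" by (auto simp: B_def)
    show "x \<in> Pair 0 ` A n \<union> (\<lambda>(i, q). (Suc i, q)) ` (if n < 2 then {} else B (n - 2))"
    proof (cases i)
      case (Suc k)
      then have "(k, q) \<in> (if n < 2 then {} else B (n - 2))" using x by (auto simp: B_def)
      then show ?thesis using x Suc by force
    qed (use x in auto)
  qed (auto simp: B_def split: if_splits)
  moreover have "card ((\<lambda>(i, q). (Suc i, q)) ` M) = card M" for M :: "(nat \<times> 'a) set"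
    by (rule card_image) (auto simp: inj_on_def)
  then have "card (Pair 0 ` A n \<union> (\<lambda>(i, q). (Suc i, q)) ` (if n < 2 then {} else B (n - 2))) =
    card (A n) + card (if n < 2 then {} else B (n - 2))"
    using fin finB by (subst card_Un_disjoint) (auto simp: card_image inj_on_def)
  ultimately have "card (B n) = card (A n) + (if n < 2 then 0 else card (B (n - 2)))" by simp
  then show "fps_nth ((1 - fps_X ^ 2) * Abs_fps (\<lambda>n. rat_of_nat (card (B n)))) n =
      fps_nth (Abs_fps (\<lambda>n. rat_of_nat (card (A n)))) n"
    by (simp add: left_diff_distrib fps_X_power_mult_nth)
qed

section \<open>Counting monomials in three and in two variables\<close>

definition triples :: "nat \<Rightarrow> (nat \<times> nat \<times> nat) set" where
  "triples n = {(i, j, k). 2 * (i + j + k) = n}"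
definition pairs :: "nat \<Rightarrow> (nat \<times> nat) set" where
  "pairs n = {(j, k). 2 * (j + k) = n}"

lemma finite_pairs: "finite (pairs n)"
  by (rule finite_subset[of _ "{..n} \<times> {..n}"]) (auto simp: pairs_def)

lemma fps_triples: "(1 - fps_X ^ 2) * Abs_fps (\<lambda>n. rat_of_nat (card (triples n))) = Abs_fps (\<lambda>n. rat_of_nat (card (pairs n)))"
  and fps_pairs: "(1 - fps_X ^ 2) ^ 2 * Abs_fps (\<lambda>n. rat_of_nat (card (pairs n))) = 1"
proof -
  have t: "triples = (\<lambda>n. {(i, q). 2 * i \<le> n \<and> q \<in> pairs (n - 2 * i)})"
    by (auto simp: triples_def pairs_def fun_eq_iff)
  show "(1 - fps_X ^ 2) * Abs_fps (\<lambda>n. rat_of_nat (card (triples n))) = Abs_fps (\<lambda>n. rat_of_nat (card (pairs n)))"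
    unfolding t by (rule fps_geometric_step[OF finite_pairs])
  define S where "S n = {k :: nat. 2 * k = n}" for n
  \<comment> \<open>The start of the recursion: no variables, and a single monomial in degree
    0.\<close>
  define U where "U n = (if n = 0 then {()} else {})" for n :: nat
  have finS: "finite (S n)" for n by (rule finite_subset[of _ "{..n}"]) (auto simp: S_def)
  have p: "pairs = (\<lambda>n. {(i, q). 2 * i \<le> n \<and> q \<in> S (n - 2 * i)})"
    by (auto simp: S_def pairs_def fun_eq_iff)
  have 1: "(1 - fps_X ^ 2) * Abs_fps (\<lambda>n. rat_of_nat (card (pairs n))) = Abs_fps (\<lambda>n. rat_of_nat (card (S n)))"
    unfolding p by (rule fps_geometric_step[OF finS])
  have "card (S n) = card {(i, q). 2 * i \<le> n \<and> q \<in> U (n - 2 * i)}" for n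
  proof (rule bij_betw_same_card)
    show "bij_betw (\<lambda>k. (k, ())) (S n) {(i, q). 2 * i \<le> n \<and> q \<in> U (n - 2 * i)}"
      by (auto simp: bij_betw_def inj_on_def S_def U_def split: if_splits)
  qed
  then have 2: "(1 - fps_X ^ 2) * Abs_fps (\<lambda>n. rat_of_nat (card (S n))) = Abs_fps (\<lambda>n. rat_of_nat (card (U n)))"
    using fps_geometric_step[of U] by (simp add: U_def)
  have "Abs_fps (\<lambda>n. rat_of_nat (card (U n))) = 1"
    by (rule fps_ext) (simp add: U_def)
  with 1 2 show "(1 - fps_X ^ 2) ^ 2 * Abs_fps (\<lambda>n. rat_of_nat (card (pairs n))) = 1"
    by (simp add: power2_eq_square mult.assoc)
qed

definition basis_index :: "nat \<Rightarrow> (nat \<times> nat \<times> nat \<times> nat) set" where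
  "basis_index d = {(s, i, j, k). s < 10 \<and> weight s + 2 * (i + j + k) = d \<and> (8 \<le> s \<longrightarrow> i = 0)}"

lemma finite_basis_index: "finite (basis_index d)"
  by (rule finite_subset[of _ "{..<10} \<times> {..d} \<times> {..d} \<times> {..d}"]) (auto simp: basis_index_def)

lemma card_basis_index:
  "card (basis_index d) = (\<Sum>s<8. if d < weight s then 0 else card (triples (d - weight s))) +
    (\<Sum>s\<in>{8, 9}. if d < weight s then 0 else card (pairs (d - weight s)))"
proof -
  define A where "A s = {(i, j, k). weight s + 2 * (i + j + k) = d \<and> (8 \<le> s \<longrightarrow> i = 0)}" for s
  have "basis_index d = Sigma {..<10} A" by (auto simp: basis_index_def A_def)
  moreover have "finite (A s)" for s
    by (rule finite_subset[of _ "{..d} \<times> {..d} \<times> {..d}"]) (auto simp: A_def)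
  ultimately have "card (basis_index d) = (\<Sum>s<10. card (A s))" by simp
  also have "{..<10} = {..<8} \<union> {8, 9 :: nat}" by auto
  also have "(\<Sum>s\<in>{..<8} \<union> {8, 9}. card (A s)) = (\<Sum>s<8. card (A s)) + (\<Sum>s\<in>{8, 9}. card (A s))"
    by (rule sum.union_disjoint) auto
  also have "(\<Sum>s<8. card (A s)) = (\<Sum>s<8. if d < weight s then 0 else card (triples (d - weight s)))"
  proof (rule sum.cong)
    fix s :: nat assume "s \<in> {..<8}"
    then have "A s = (if d < weight s then {} else triples (d - weight s))" by (auto simp: A_def triples_def)
    then show "card (A s) = (if d < weight s then 0 else card (triples (d - weight s)))" by simp
  qed simp
  also have "(\<Sum>s\<in>{8, 9}. card (A s)) = (\<Sum>s\<in>{8, 9}. if d < weight s then 0 else card (pairs (d - weight s)))"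
  proof (rule sum.cong)
    fix s :: nat assume "s \<in> {8, 9}"
    then have "A s = Pair 0 ` (if d < weight s then {} else pairs (d - weight s))" by (auto simp: A_def pairs_def)
    then show "card (A s) = (if d < weight s then 0 else card (pairs (d - weight s)))" by (simp add: card_image inj_on_def)
  qed simp
  finally show ?thesis .
qed

lemma fps_basis_index:
  "Abs_fps (\<lambda>d. rat_of_nat (card (basis_index d))) =
    (2 * fps_X ^ 7 + 4 * fps_X ^ 8 + 2 * fps_X ^ 9 + fps_X ^ 10 + fps_X ^ 11
        - fps_X ^ 12 - fps_X ^ 13) / (1 - fps_X ^ 2) ^ 3"
proof -
  define T where "T = Abs_fps (\<lambda>n. rat_of_nat (card (triples n)))"
  define Q where "Q = Abs_fps (\<lambda>n. rat_of_nat (card (pairs n)))"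
  define D where "D = (1 - fps_X ^ 2 :: rat fps)"
  have QT: "Q = D * T" using fps_triples by (simp add: T_def Q_def D_def)
  have "D ^ 2 * Q = 1" unfolding D_def Q_def by (rule fps_pairs)
  then have D3: "D ^ 3 * T = 1" unfolding QT by (simp add: power3_eq_cube power2_eq_square mult.assoc)
  have "Abs_fps (\<lambda>d. rat_of_nat (card (basis_index d))) =
    (\<Sum>s<8. fps_X ^ weight s * T) + (\<Sum>s\<in>{8, 9}. fps_X ^ weight s * Q)"
    by (rule fps_ext) (simp add: card_basis_index fps_sum_nth fps_X_power_mult_nth T_def Q_def of_nat_sum if_distrib[of rat_of_nat] cong: if_cong)
  \<comment> \<open>The generators 8 and 9 contribute (t^11 + t^10) Q, and Q = (1 - t^2) T; this
    yields the terms from t^10 on.\<close>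
  also have "\<dots> = (2 * fps_X ^ 7 + 4 * fps_X ^ 8 + 2 * fps_X ^ 9 + fps_X ^ 10 + fps_X ^ 11 - fps_X ^ 12 - fps_X ^ 13) * T"
    by (simp add: QT weight_def eval_nat_numeral D_def algebra_simps)
  also have "\<dots> = (2 * fps_X ^ 7 + 4 * fps_X ^ 8 + 2 * fps_X ^ 9 + fps_X ^ 10 + fps_X ^ 11 - fps_X ^ 12 - fps_X ^ 13) / D ^ 3"
  proof -
    have "D ^ 3 \<noteq> 0" using D3 by auto
    moreover have "F = F * T * D ^ 3" for F using D3 by (simp add: mult_ac)
    ultimately show "F * T = F / D ^ 3" for F by (metis nonzero_mult_div_cancel_right)
  qed
  finally show ?thesis by (simp add: D_def)
qed

definition unit_param :: "nat \<times> nat \<times> nat \<times> nat \<Rightarrow> nat \<Rightarrow> R3" where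
  "unit_param q t = (case q of (s, i, j, k) \<Rightarrow> if t = s then monom (monom (monom 1 k) j) i else 0)"

lemma coeff_unit_param:
  "coeff (coeff (coeff (const3 c * unit_param q t) i) j) k = (if q = (t, i, j, k) then c else 0)"
  by (cases q) (auto simp: unit_param_def const3_def coeff_monom)

lemma coeff_unit_param_sum:
  assumes "finite J"
  shows "coeff (coeff (coeff (\<Sum>q\<in>J. const3 (c q) * unit_param q t) i) j) k = (if (t, i, j, k) \<in> J then c (t, i, j, k) else 0)"
proof -
  have "coeff (coeff (coeff (\<Sum>q\<in>J. const3 (c q) * unit_param q t) i) j) k =
    (\<Sum>q\<in>J. if q = (t, i, j, k) then c (t, i, j, k) else 0)"
    unfolding coeff_sum coeff_unit_param by (intro sum.cong) auto
  then show ?thesis using assms by simp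
qed

lemma R3_eq_iff: "f = g \<longleftrightarrow> (\<forall>i j k. coeff (coeff (coeff f i) j) k = coeff (coeff (coeff g i) j) k)" for f g :: R3
  by (simp add: poly_eq_iff)

lemma const_poly_iff: "f \<in> range (\<lambda>k. [:k:]) \<longleftrightarrow> (\<forall>i j k. coeff (coeff (coeff f i) j) k \<noteq> 0 \<longrightarrow> i = 0)" for f :: R3
proof
  assume "\<forall>i j k. coeff (coeff (coeff f i) j) k \<noteq> 0 \<longrightarrow> i = 0"
  then have "f = [:coeff f 0:]"
    unfolding R3_eq_iff by (auto simp: coeff_pCons split: nat.splits)
  then show "f \<in> range (\<lambda>k. [:k:])" by blast
qed (auto simp: coeff_pCons split: nat.splits)

section \<open>Non-freeness\<close>

text \<open>This is where regularity of the sequence \<open>b, c, a\<close> enters.\<close>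

lemma koszul:
  assumes "va * f = vb * g + vc * h"
  shows "\<exists>g' h'. f = vb * g' + vc * h'"
proof -
  \<comment> \<open>On the right side every monomial contains b or c, so no pure power of a can
    occur in \<open>va * f\<close>.\<close>
  have "coeff (coeff (coeff f i) 0) 0 = 0" for i
    using arg_cong[OF assms, of "\<lambda>p. coeff (coeff (coeff p (Suc i)) 0) 0"]
    by (simp add: va_def vb_def vc_def)
  then show ?thesis
  proof (induction f)
    case 0
    then show ?case by (intro exI[of _ 0]) simp
  next
    case (pCons c f)
    have "coeff (coeff c 0) 0 = 0" using pCons.prems[of 0] by simp
    moreover obtain c0 c1 where c: "c = pCons c0 c1" by (cases c)
    moreover obtain c00 c01 where c0: "c0 = pCons c00 c01" by (cases c0)
    ultimately have "[:c:] = vb * [:c1:] + vc * [:[:c01:]:]" by (simp add: vb_def vc_def)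
    moreover have "\<exists>g' h'. f = vb * g' + vc * h'"
      using pCons.prems[of "Suc _"] by (intro pCons.IH) simp
    then obtain g' h' where "f = vb * g' + vc * h'" by blast
    ultimately have "pCons c f = vb * ([:c1:] + va * g') + vc * ([:[:c01:]:] + va * h')"
      by (simp add: algebra_simps va_def) (simp add: vb_def vc_def)
    then show ?case by blast
  qed
qed

text \<open>At a = 0 both sides are multiples of bc; cancelling it would express 1 through b and c,
  which fails at the origin.\<close>

lemma bc_not_in_ideal: "vb * vc \<noteq> vb * (va * p + vb * vc * q) + vc * (va * p' + vb * vc * q')"
proof
  let ?b = "[:0, 1 :: complex poly:]" and ?c = "[:[:0, 1:]:] :: complex poly poly"
  assume "vb * vc = vb * (va * p + vb * vc * q) + vc * (va * p' + vb * vc * q')"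
  from arg_cong[OF this, of "\<lambda>f. poly f 0"]
  have "?b * ?c = ?b * (?b * ?c * poly q 0) + ?c * (?b * ?c * poly q' 0)"
    by (simp only: poly_add poly_mult poly_vars_0 mult_zero_left add_0_left)
  also have "\<dots> = ?b * ?c * (?b * poly q 0 + ?c * poly q' 0)" by (simp only: distrib_left mult_ac)
  finally have "1 = ?b * poly q 0 + ?c * poly q' 0"
    by (metis mult_cancel_left mult_1_right mult_eq_0_iff pCons_eq_0_iff zero_neq_one)
  from arg_cong[OF this, of "\<lambda>f. poly (poly f 0) 0"] show False by simp
qed

lemma coord_cong: "(\<And>s. s < 10 \<Longrightarrow> P s = Q s) \<Longrightarrow> coord P = coord Q"
  by (simp add: coord_def)

text \<open>Write G_s for the generator with number s. Then a G_9 and bc G_7 agree in coordinate 4,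
  and solving for their difference in terms of G_5 and G_6 gives a G_9 = bc G_7 + 2bc G_5 - (b^2 +
  c^2) G_6. \<open>U_param\<close> collects the terms divided by b, and \<open>W_param\<close> is
  the remaining -c^2 G_6 divided by c.\<close>

definition K_param :: "nat \<Rightarrow> R3" where "K_param = (\<lambda>s. if s = 9 then 1 else 0)"
definition U_param :: "nat \<Rightarrow> R3" where
  "U_param = (\<lambda>s. if s = 7 then vc else if s = 5 then 2 * vc else if s = 6 then - vb else 0)"
definition W_param :: "nat \<Rightarrow> R3" where "W_param = (\<lambda>s. if s = 6 then - vc else 0)"

lemma syzygy: "i < 8 \<Longrightarrow> va * coord K_param i = vb * coord U_param i + vc * coord W_param i"
proof -
  have "\<forall>i<8. va * coord K_param i = vb * coord U_param i + vc * coord W_param i"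
    unfolding all_less_8
    by (simp add: coord_def K_param_def U_param_def W_param_def Rab_def Rac_def Rbc_def) (intro conjI; algebra)
  then show "i < 8 \<Longrightarrow> va * coord K_param i = vb * coord U_param i + vc * coord W_param i" by blast
qed

section \<open>Sections described by their coefficients\<close>

locale twisted_sections =
  fixes V :: "'v set" and v0 :: 'v and sign :: "'v \<Rightarrow> complex"
  assumes v0: "v0 \<in> V" "sign v0 = 1"
begin

definition sect :: "(nat \<Rightarrow> R3) \<Rightarrow> 'v \<Rightarrow> ext4" where
  "sect P = (\<lambda>v. if v \<in> V then Const (sign v) *s mk (coord P) else 0)"

lemma sect_cong: "(\<And>s. s < 10 \<Longrightarrow> P s = Q s) \<Longrightarrow> sect P = sect Q"
  unfolding sect_def by (simp only: coord_cong[of P Q])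

lemma sect_eq_iff: "sect P = sect Q \<longleftrightarrow> (\<forall>i<8. coord P i = coord Q i)"
proof
  assume "sect P = sect Q"
  then have "sect P v0 = sect Q v0" by simp
  then have "mk (coord P) = mk (coord Q)" using v0 by (simp add: sect_def Const_one)
  then show "\<forall>i<8. coord P i = coord Q i" by (simp add: mk_eq_iff)
next
  assume "\<forall>i<8. coord P i = coord Q i"
  then have "mk (coord P) = mk (coord Q)" by (simp add: mk_eq_iff)
  then show "sect P = sect Q" by (simp add: sect_def cong: if_cong)
qed

lemma sect_add: "sect P + sect Q = sect (\<lambda>s. P s + Q s)"
proof -
  have "mk (coord (\<lambda>s. P s + Q s)) = mk (coord P) + mk (coord Q)"
    unfolding mk_add by (rule mk_cong) (simp add: coord_add)
  then show ?thesis by (auto simp: sect_def fun_eq_iff vec_eq_iff distrib_left)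
qed

lemma sect_smult: "family_scale (Theta t) (sect P) = sect (\<lambda>s. t * P s)"
proof -
  have "mk (coord (\<lambda>s. t * P s)) = Theta t *s mk (coord P)"
    unfolding mk_smult by (rule mk_cong) (simp add: coord_smult)
  then show ?thesis by (auto simp: sect_def family_scale_def fun_eq_iff vec_eq_iff mult_ac)
qed

lemma sect_0: "sect (\<lambda>s. 0) = 0"
proof -
  have "mk (coord (\<lambda>s. 0)) = mk (\<lambda>i. 0)"
    by (rule mk_cong) (use coord_smult[of _ 0 "\<lambda>s. 0"] in simp)
  then show ?thesis by (auto simp: sect_def mk_0 fun_eq_iff)
qed

lemma zero_in_range_sect: "0 \<in> range sect"
  unfolding sect_0[symmetric] by (rule rangeI)

lemma sect_sum: "(\<Sum>q\<in>J. sect (P q)) = sect (\<lambda>s. \<Sum>q\<in>J. P q s)"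
  by (induction J rule: infinite_finite_induct) (simp_all add: sect_0 sect_add)

lemma sect_inj:
  assumes "admissible P" "sect P = 0" "s < 10"
  shows "P s = 0"
proof (rule coord_inj[OF assms(1) _ assms(3)])
  fix i :: nat assume "i < 8"
  with assms(2) have "coord P i = coord (\<lambda>s. 0) i" using sect_eq_iff sect_0 by metis
  then show "coord P i = 0" using coord_smult[of i 0 "\<lambda>s. 0"] \<open>i < 8\<close> by simp
qed

text \<open>Coefficients that are not admissible are normalized without rewriting by the relations:
  their coordinates satisfy \<open>gkm_cond\<close>, and each solution has admissible
  coefficients.\<close>

lemma range_sect: "range sect = sect ` {P. admissible P}"
proof
  show "range sect \<subseteq> sect ` {P. admissible P}"
  proof clarify
    fix P
    obtain Q where "admissible Q" "\<And>i. i < 8 \<Longrightarrow> coord P i = coord Q i"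
      using gkm_cond_imp_coord[OF gkm_cond_coord] by metis
    then show "sect P \<in> sect ` {P. admissible P}" using sect_eq_iff by blast
  qed
qed auto

lemma sect_homogeneous_iff:
  "(\<forall>v. sect P v \<in> homogeneous d) \<longleftrightarrow> mk (coord P) \<in> homogeneous d"
proof
  assume "\<forall>v. sect P v \<in> homogeneous d"
  then have "sect P v0 \<in> homogeneous d" by blast
  then show "mk (coord P) \<in> homogeneous d" using v0 by (simp add: sect_def Const_one)
next
  assume "mk (coord P) \<in> homogeneous d"
  then have "rescale (mk (coord P)) = 2 ^ d *s mk (coord P)" by (simp add: homogeneous_iff_rescale)
  then have "Const c *s mk (coord P) \<in> homogeneous d" for c
    by (simp add: homogeneous_iff_rescale rescale_smult tau_Const vec_eq_iff mult_ac)
  moreover have "0 \<in> homogeneous d" by (simp add: homogeneous_def)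
  ultimately show "\<forall>v. sect P v \<in> homogeneous d" by (simp add: sect_def)
qed

lemma homogeneous_part_sect:
  "homogeneous_part (range sect) d =
    {\<Sum>q\<in>basis_index d. family_cscale (c q) (sect (unit_param q)) | c. True}"
proof -
  define lin where "lin c s = (\<Sum>q\<in>basis_index d. const3 (c q) * unit_param q s)" for c s
  have sum: "(\<Sum>q\<in>basis_index d. family_cscale (c q) (sect (unit_param q))) = sect (lin c)" for c
    by (simp add: family_cscale_def Const_Theta sect_smult sect_sum lin_def[abs_def])
  have coeff: "coeff (coeff (coeff (lin c s) i) j) k = (if (s, i, j, k) \<in> basis_index d then c (s, i, j, k) else 0)" for c s i j k
    unfolding lin_def by (rule coeff_unit_param_sum[OF finite_basis_index])
  have adm: "admissible (lin c)" for c
    unfolding admissible_def const_poly_iff coeff by (auto simp: basis_index_def)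
  show ?thesis unfolding sum
  proof (intro equalityI subsetI)
    fix a assume "a \<in> homogeneous_part (range sect) d"
    then obtain P where P: "a = sect P" "admissible P" "\<forall>v. sect P v \<in> homogeneous d"
      unfolding range_sect homogeneous_part_def by auto
    then have h: "weight s + 2 * (i + j + k) = d" if "s < 10" "coeff (coeff (coeff (P s) i) j) k \<noteq> 0" for s i j k
      using that coord_homogeneous_iff[of P d] sect_homogeneous_iff by blast
    have i0: "i = 0" if "s < 10" "8 \<le> s" "coeff (coeff (coeff (P s) i) j) k \<noteq> 0" for s i j k
    proof -
      from that(1,2) have "s = 8 \<or> s = 9" by auto
      then show ?thesis using P(2) that(3) unfolding admissible_def const_poly_iff by blast
    qed
    define c where "c = (\<lambda>(s, i, j, k). coeff (coeff (coeff (P s) i) j) k)"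
    have "P s = lin c s" if "s < 10" for s
    proof -
      have "(s, i, j, k) \<in> basis_index d" if "coeff (coeff (coeff (P s) i) j) k \<noteq> 0" for i j k
        using h[OF \<open>s < 10\<close> that] i0[OF \<open>s < 10\<close> _ that] \<open>s < 10\<close> by (auto simp: basis_index_def)
      then show ?thesis unfolding R3_eq_iff coeff by (auto simp: c_def)
    qed
    then have "a = sect (lin c)" unfolding P(1) by (rule sect_cong)
    then show "a \<in> {sect (lin c) |c. True}" by blast
  next
    fix a assume "a \<in> {sect (lin c) |c. True}"
    then obtain c where c: "a = sect (lin c)" by blast
    have "mk (coord (lin c)) \<in> homogeneous d"
      unfolding coord_homogeneous_iff[OF adm] coeff by (auto simp: basis_index_def)
    then show "a \<in> homogeneous_part (range sect) d"
      unfolding c homogeneous_part_def using sect_homogeneous_iff by blast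
  qed
qed

lemma dim_homogeneous_part_sect:
  "vector_space.dim family_cscale (homogeneous_part (range sect) d) = card (basis_index d)"
  unfolding homogeneous_part_sect
proof (rule vector_space.dim_family[OF vector_space_family_cscale finite_basis_index], intro ballI)
  fix c q assume sum0: "(\<Sum>q\<in>basis_index d. family_cscale (c q) (sect (unit_param q))) = 0" and q: "q \<in> basis_index d"
  define lin where "lin s = (\<Sum>q\<in>basis_index d. const3 (c q) * unit_param q s)" for s
  have sum: "(\<Sum>q\<in>basis_index d. family_cscale (c q) (sect (unit_param q))) = sect lin"
    by (simp add: family_cscale_def Const_Theta sect_smult sect_sum lin_def[abs_def])
  have coeff: "coeff (coeff (coeff (lin s) i) j) k = (if (s, i, j, k) \<in> basis_index d then c (s, i, j, k) else 0)" for s i j k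
    unfolding lin_def by (rule coeff_unit_param_sum[OF finite_basis_index])
  have adm: "admissible lin"
    unfolding admissible_def const_poly_iff coeff by (auto simp: basis_index_def)
  obtain s i j k where q': "q = (s, i, j, k)" by (cases q)
  with q have "s < 10" by (simp add: basis_index_def)
  then have "lin s = 0" using sect_inj[OF adm] sum0 sum by simp
  then show "c q = 0" using coeff[of s i j k] q q' by simp
qed

lemma hilbert_series_sect:
  "hilbert_series (range sect) =
    (2 * fps_X ^ 7 + 4 * fps_X ^ 8 + 2 * fps_X ^ 9 + fps_X ^ 10 + fps_X ^ 11
        - fps_X ^ 12 - fps_X ^ 13) / (1 - fps_X ^ 2) ^ 3"
  unfolding hilbert_series_def dim_homogeneous_part_sect by (rule fps_basis_index)

lemma sect_lincomb:
  assumes "B \<subseteq> range sect"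
  shows "(\<Sum>b\<in>B. family_scale (Theta (t b)) b) \<in> range sect"
  using assms
proof (induction B rule: infinite_finite_induct)
  case (insert b B)
  then obtain P Q where "b = sect P" "(\<Sum>b\<in>B. family_scale (Theta (t b)) b) = sect Q" by auto
  then show ?case using insert by (simp add: sect_smult sect_add)
qed (simp_all add: zero_in_range_sect)

lemma not_free_sect: "\<not> free_over sym_alg family_scale (range sect)"
proof
  interpret F: module "family_scale :: poly4 \<Rightarrow> ('v \<Rightarrow> ext4) \<Rightarrow> _" by (rule module_family_scale)
  define rep where "rep B x c \<longleftrightarrow> finite {b. c b \<noteq> 0} \<and> {b. c b \<noteq> 0} \<subseteq> B \<and> range c \<subseteq> sym_alg \<and>
     x = (\<Sum>b | c b \<noteq> 0. family_scale (c b) b)" for B and x :: "'v \<Rightarrow> ext4" and c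
  assume "free_over sym_alg family_scale (range sect)"
  then have "\<exists>B. B \<subseteq> range sect \<and> (\<forall>x\<in>range sect. \<exists>!c. rep B x c)"
    unfolding free_over_def rep_def .
  then obtain B where B: "B \<subseteq> range sect" "\<And>x. x \<in> range sect \<Longrightarrow> \<exists>!c. rep B x c"
    by (elim exE conjE) (simp only:)
  have rep_sum: "x = (\<Sum>b\<in>S. family_scale (c b) b)" if "rep B x c" "finite S" "{b. c b \<noteq> 0} \<subseteq> S" for x c S
    using that unfolding rep_def by (auto intro!: sum.mono_neutral_left)
  obtain cK where cK: "rep B (sect K_param) cK" using B(2) by blast
  obtain cU where cU: "rep B (sect U_param) cU" using B(2) by blast
  obtain cW where cW: "rep B (sect W_param) cW" using B(2) by blast
  \<comment> \<open>A common finite support: the basis itself may be infinite.\<close>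
  define S where "S = {b. cK b \<noteq> 0} \<union> {b. cU b \<noteq> 0} \<union> {b. cW b \<noteq> 0}"
  have S: "finite S" "S \<subseteq> B" using cK cU cW by (auto simp: S_def rep_def)
  have "{b. cK b \<noteq> 0} \<subseteq> S" "{b. cU b \<noteq> 0} \<subseteq> S" "{b. cW b \<noteq> 0} \<subseteq> S"
    by (auto simp: S_def)
  then have K: "sect K_param = (\<Sum>b\<in>S. family_scale (cK b) b)" and U: "sect U_param = (\<Sum>b\<in>S. family_scale (cU b) b)"
    and W: "sect W_param = (\<Sum>b\<in>S. family_scale (cW b) b)"
    using rep_sum[OF cK S(1)] rep_sum[OF cU S(1)] rep_sum[OF cW S(1)] by blast+
  have rel: "family_scale (Theta va) (sect K_param) = family_scale (Theta vb) (sect U_param) + family_scale (Theta vc) (sect W_param)"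
    unfolding sect_smult sect_add sect_eq_iff by (simp add: coord_smult coord_add syzygy)
  \<comment> \<open>By the syzygy these coefficients represent 0, so uniqueness makes them vanish.
    \<open>koszul\<close> then places each \<open>cK b\<close> in the ideal (b, c), and hence
    \<open>sect K_param\<close> in bN + cN.\<close>
  define c where "c b = Theta va * cK b - Theta vb * cU b - Theta vc * cW b" for b
  have theta: "\<exists>f. cK b = Theta f" "\<exists>f. cU b = Theta f" "\<exists>f. cW b = Theta f" for b
    using cK cU cW unfolding rep_def sym_alg_eq by blast+
  have "(\<Sum>b\<in>S. family_scale (c b) b) =
      family_scale (Theta va) (sect K_param) - family_scale (Theta vb) (sect U_param) - family_scale (Theta vc) (sect W_param)"
    unfolding K U W c_def by (simp add: F.scale_sum_right F.scale_left_diff_distrib sum_subtractf F.scale_scale)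
  then have "(\<Sum>b\<in>S. family_scale (c b) b) = 0" unfolding rel by simp
  moreover have cS: "{b. c b \<noteq> 0} \<subseteq> S" by (auto simp: c_def S_def)
  ultimately have "0 = (\<Sum>b | c b \<noteq> 0. family_scale (c b) b)"
    using S(1) by (subst sum.mono_neutral_left[of S]) auto
  moreover have "range c \<subseteq> sym_alg"
  proof
    fix x assume "x \<in> range c"
    then obtain b where "x = c b" by blast
    moreover obtain f g h where "cK b = Theta f" "cU b = Theta g" "cW b = Theta h" using theta by blast
    ultimately have "x = Theta (va * f - vb * g - vc * h)" by (simp add: c_def Theta.simps)
    then show "x \<in> sym_alg" by (simp add: sym_alg_eq)
  qed
  ultimately have "rep B 0 c"
    unfolding rep_def using cS S finite_subset by blast
  moreover have "rep B 0 (\<lambda>b. 0)" by (auto simp: rep_def sym_alg_eq intro: Theta.zero[symmetric])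
  ultimately have "c = (\<lambda>b. 0)" using B(2)[OF zero_in_range_sect] by blast
  then have c0: "c b = 0" for b by simp
  have "\<exists>g h. cK b = Theta (vb * g + vc * h)" for b
  proof -
    obtain f g h where fgh: "cK b = Theta f" "cU b = Theta g" "cW b = Theta h" using theta by blast
    have "Theta (va * f) = Theta (vb * g + vc * h)" using c0[of b] by (simp add: c_def fgh Theta.simps algebra_simps)
    then show ?thesis using koszul fgh(1) unfolding Theta_inj by blast
  qed
  then obtain g h where gh: "\<And>b. cK b = Theta (vb * g b + vc * h b)" by metis
  have sub: "S \<subseteq> range sect" using S(2) B(1) by blast
  obtain P where P: "(\<Sum>b\<in>S. family_scale (Theta (g b)) b) = sect P"
    using sect_lincomb[OF sub, of g] by (rule rangeE)
  obtain Q where Q: "(\<Sum>b\<in>S. family_scale (Theta (h b)) b) = sect Q"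
    using sect_lincomb[OF sub, of h] by (rule rangeE)
  have "sect K_param = family_scale (Theta vb) (sect P) + family_scale (Theta vc) (sect Q)"
    unfolding K gh P[symmetric] Q[symmetric]
    by (simp add: F.scale_sum_right F.scale_left_distrib sum.distrib F.scale_scale Theta.simps)
  \<comment> \<open>Coordinate 4 involves only the coefficients 7 and 9, so it alone refutes
    membership in bN + cN.\<close>
  then have "coord K_param 4 = vb * coord P 4 + vc * coord Q 4"
    unfolding sect_smult sect_add sect_eq_iff by (simp add: coord_smult coord_add)
  then have "Rbc * (vb * vc) = Rbc * (vb * (va * P 7 + vb * vc * P 9) + vc * (va * Q 7 + vb * vc * Q 9))"
    by (simp add: coord_def K_param_def algebra_simps)
  then show False using bc_not_in_ideal R_nonzero by (metis mult_cancel_left)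
qed

end

section \<open>The group of elements of order two\<close>

definition diag4 :: "(4 \<Rightarrow> complex) \<Rightarrow> complex^4^4" where
  "diag4 e = (\<chi> k l. if k = l then e k else 0)"

lemma diag4_mult: "diag4 e ** B = (\<chi> i j. e i * B $ i $ j)"
proof -
  have "(\<Sum>k\<in>UNIV. (if i = k then e i else 0) * B $ k $ j) = (\<Sum>k\<in>UNIV. if k = i then e i * B $ i $ j else 0)" for i j
    by (intro sum.cong) auto
  then show ?thesis by (simp add: matrix_matrix_mult_def diag4_def vec_eq_iff)
qed

lemma diag4_mult_diag4: "diag4 e ** diag4 f = diag4 (\<lambda>k. e k * f k)"
  unfolding diag4_mult by (simp add: diag4_def vec_eq_iff)

lemma mat_1_diag4: "mat 1 = diag4 (\<lambda>k. 1)"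
  by (simp add: diag4_def mat_def)

lemma det_diag4: "det (diag4 e) = e 1 * e 2 * e 3 * e 4"
proof -
  have "det (diag4 e) = (\<Prod>i\<in>UNIV. e i)"
    by (subst det_diagonal) (simp_all add: diag4_def)
  then show ?thesis unfolding UNIV_4 by (simp add: mult.assoc)
qed

lemma carrier_T2_iff:
  "g \<in> carrier T2 \<longleftrightarrow> (\<exists>e. g = diag4 e \<and> (\<forall>k. e k = 1 \<or> e k = - 1) \<and> e 1 * e 2 * e 3 * e 4 = 1)"
proof
  assume "g \<in> carrier T2"
  then have g: "g \<in> torus" "g ** g = mat 1" by (auto simp: T2_def)
  have d: "g = diag4 (\<lambda>k. g $ k $ k)" using g(1) by (auto simp: torus_def diag4_def vec_eq_iff)
  have "diag4 (\<lambda>k. g $ k $ k * g $ k $ k) = diag4 (\<lambda>k. 1)"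
    using g(2) d by (metis diag4_mult_diag4 mat_1_diag4)
  then have "g $ k $ k * g $ k $ k = 1" for k
    by (simp add: diag4_def vec_eq_iff) metis
  then have "g $ k $ k = 1 \<or> g $ k $ k = - 1" for k by (simp add: square_eq_1_iff)
  moreover have "det g = 1" using g(1) by (simp add: torus_def SU4_def)
  then have "g $ 1 $ 1 * g $ 2 $ 2 * g $ 3 $ 3 * g $ 4 $ 4 = 1" using det_diag4[of "\<lambda>k. g $ k $ k", folded d] by simp
  ultimately show "\<exists>e. g = diag4 e \<and> (\<forall>k. e k = 1 \<or> e k = - 1) \<and> e 1 * e 2 * e 3 * e 4 = 1"
    using d by blast
next
  assume "\<exists>e. g = diag4 e \<and> (\<forall>k. e k = 1 \<or> e k = - 1) \<and> e 1 * e 2 * e 3 * e 4 = 1"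
  then obtain e where e: "g = diag4 e" "\<And>k. e k = 1 \<or> e k = - 1" "e 1 * e 2 * e 3 * e 4 = 1" by blast
  have sq: "e k * e k = 1" and cnj: "cnj (e k) = e k" for k using e(2)[of k] by auto
  have "(\<chi> i j. cnj (g $ j $ i)) = g"
    using cnj by (auto simp: e(1) diag4_def vec_eq_iff)
  moreover have "g ** g = mat 1" by (simp add: e(1) diag4_mult_diag4 sq mat_1_diag4)
  moreover have "det g = 1" by (simp add: e(1,3) det_diag4)
  ultimately show "g \<in> carrier T2"
    by (auto simp: T2_def torus_def SU4_def) (simp add: e(1) diag4_def)
qed

lemma exp_pi_i_diag4: "exp_pi_i \<xi> = diag4 (\<lambda>k. exp (of_real pi * \<i> * \<xi> $ k))"
  by (simp add: exp_pi_i_def diag4_def)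

lemma exp_pi_i_add: "exp_pi_i (\<xi> + \<zeta>) = exp_pi_i \<xi> ** exp_pi_i \<zeta>"
  by (simp add: exp_pi_i_diag4 diag4_mult_diag4 distrib_left exp_add)

lemma exp_pi_i_simple_roots:
  "exp_pi_i (root_vec 1 2) = diag4 (\<lambda>k. if k = 1 \<or> k = 2 then - 1 else 1)"
  "exp_pi_i (root_vec 2 3) = diag4 (\<lambda>k. if k = 2 \<or> k = 3 then - 1 else 1)"
  "exp_pi_i (root_vec 3 4) = diag4 (\<lambda>k. if k = 3 \<or> k = 4 then - 1 else 1)"
  by (simp_all add: exp_pi_i_diag4 diag4_def vec_eq_iff forall_4 root_vec_def std_basis_def axis_def exp_minus)

lemma exp_pi_i_simple_roots_carrier:
  "exp_pi_i (root_vec 1 2) \<in> carrier T2" "exp_pi_i (root_vec 2 3) \<in> carrier T2"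
  "exp_pi_i (root_vec 3 4) \<in> carrier T2"
  unfolding exp_pi_i_simple_roots carrier_T2_iff
  by (rule exI, rule conjI, rule refl, simp)+

lemma root_vec_simple:
  "root_vec 1 3 = root_vec 1 2 + root_vec 2 3" "root_vec 2 4 = root_vec 2 3 + root_vec 3 4"
  "root_vec 1 4 = root_vec 1 2 + (root_vec 2 3 + root_vec 3 4)"
  by (simp_all add: root_vec_def)

lemma T2_mult: "x \<otimes>\<^bsub>T2\<^esub> y = x ** y" and T2_one: "\<one>\<^bsub>T2\<^esub> = mat 1"
  by (simp_all add: T2_def)

lemma T2_closed: "x \<in> carrier T2 \<Longrightarrow> y \<in> carrier T2 \<Longrightarrow> x ** y \<in> carrier T2"
  using group.is_monoid[OF group_T2] monoid.m_closed T2_mult by metis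

lemma exp_pi_i_positive_roots_carrier:
  assumes "\<alpha> \<in> positive_roots"
  shows "exp_pi_i \<alpha> \<in> carrier T2"
proof -
  have "\<alpha> \<in> {root_vec 1 2, root_vec 3 4, root_vec 1 4, root_vec 2 3, root_vec 1 3, root_vec 2 4}"
    using assms unfolding positive_roots_eq root_vec_y .
  then show ?thesis
    unfolding root_vec_simple using exp_pi_i_simple_roots_carrier T2_closed
    by (auto simp: exp_pi_i_add)
qed

section \<open>Values of the character on the roots\<close>

locale T2_character =
  fixes chi :: "complex^4^4 \<Rightarrow> complex"
  assumes hom: "chi \<in> hom T2 sign_group"
begin

lemma chi_mult: "x \<in> carrier T2 \<Longrightarrow> y \<in> carrier T2 \<Longrightarrow> chi (x ** y) = chi x * chi y"
  using hom by (simp add: hom_def sign_group_def T2_mult)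

lemma chi_values: "x \<in> carrier T2 \<Longrightarrow> chi x = 1 \<or> chi x = - 1"
  using hom by (auto simp: hom_def sign_group_def)

lemma chi_sq: "x \<in> carrier T2 \<Longrightarrow> chi x * chi x = 1"
  using chi_values by fastforce

lemma one_carrier: "mat 1 \<in> carrier T2"
  using group.is_monoid[OF group_T2] monoid.one_closed T2_one by metis

lemma chi_one: "chi (mat 1) = 1"
  using chi_mult[OF one_carrier one_carrier] chi_sq[OF one_carrier] by simp

lemma chi_inv:
  assumes "x \<in> carrier T2"
  shows "chi (inv\<^bsub>T2\<^esub> x) = chi x"
proof -
  have i: "inv\<^bsub>T2\<^esub> x \<in> carrier T2" using assms group.inv_closed[OF group_T2] by blast
  have "x ** inv\<^bsub>T2\<^esub> x = mat 1" using group.r_inv[OF group_T2 assms] by (simp add: T2_mult T2_one)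
  then have "chi x * chi (inv\<^bsub>T2\<^esub> x) = 1" using chi_mult[OF assms i] chi_one by simp
  then show ?thesis using chi_values[OF assms] chi_values[OF i] by auto
qed

text \<open>The images of the three simple coroots generate the group, so a nontrivial character
  that is 1 on two of them is -1 on the third, which occurs exactly once in each of the other three
  roots.\<close>

lemma chi_roots:
  assumes "\<exists>g\<in>carrier T2. chi g \<noteq> 1"
    and 12: "chi (exp_pi_i (root_vec 1 2)) = 1" and 34: "chi (exp_pi_i (root_vec 3 4)) = 1"
  shows "chi (exp_pi_i (root_vec 2 3)) = - 1" "chi (exp_pi_i (root_vec 1 3)) = - 1"
    "chi (exp_pi_i (root_vec 2 4)) = - 1" "chi (exp_pi_i (root_vec 1 4)) = - 1"
proof -
  note c = exp_pi_i_simple_roots_carrier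
  show 23: "chi (exp_pi_i (root_vec 2 3)) = - 1"
  proof (rule ccontr)
    assume "\<not> ?thesis"
    then have 23: "chi (exp_pi_i (root_vec 2 3)) = 1" using chi_values[OF c(2)] by blast
    define pw where "pw z H = (if z = 1 then mat 1 else H)" for z :: complex and H :: "complex^4^4"
    have pw: "pw z H \<in> carrier T2 \<and> chi (pw z H) = 1" if "H \<in> carrier T2" "chi H = 1" for z H
      using that one_carrier chi_one by (simp add: pw_def)
    have "chi g = 1" if "g \<in> carrier T2" for g
    proof -
      from that obtain e where e: "g = diag4 e" "\<And>k. e k = 1 \<or> e k = - 1" "e 1 * e 2 * e 3 * e 4 = 1"
        unfolding carrier_T2_iff by blast
      \<comment> \<open>The exponents are read off from the diagonal entries 1, 2 and 4; entry 3
        then agrees because the determinant is 1.\<close>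
      have "g = pw (e 1) (exp_pi_i (root_vec 1 2)) ** (pw (e 1 * e 2) (exp_pi_i (root_vec 2 3)) **
        pw (e 4) (exp_pi_i (root_vec 3 4)))"
        using e(2)[of 1] e(2)[of 2] e(2)[of 3] e(2)[of 4] e(3)
        unfolding e(1) pw_def exp_pi_i_simple_roots mat_1_diag4
        by (auto simp: diag4_mult_diag4) (auto simp: diag4_def vec_eq_iff forall_4)
      then show ?thesis
        using pw[OF c(1) 12] pw[OF c(2) 23] pw[OF c(3) 34] T2_closed chi_mult by simp
    qed
    with assms(1) show False by blast
  qed
  show "chi (exp_pi_i (root_vec 1 3)) = - 1" "chi (exp_pi_i (root_vec 2 4)) = - 1"
    "chi (exp_pi_i (root_vec 1 4)) = - 1"
    unfolding root_vec_simple using c 12 23 34 by (simp_all add: exp_pi_i_add chi_mult T2_closed)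
qed

end

text \<open>
  A \<open>chi\<close>-isotypical section is determined by its value at one vertex \<open>v0\<close>, and the edge conditions
  at all vertices reduce to those at \<open>v0\<close>.
\<close>

lemma isotypical_eq_sections:
  fixes V :: "'v set"
  assumes free: "free_transitive T2 V \<phi>" and hom: "chi \<in> hom T2 sign_group"
    and ne: "\<exists>g\<in>carrier T2. chi g \<noteq> 1"
    and 12: "chi (exp_pi_i (root_vec 1 2)) = 1" and 34: "chi (exp_pi_i (root_vec 3 4)) = 1"
  obtains v0 sign where "twisted_sections V v0 sign"
    "isotypical V \<phi> chi (H0_F1 V \<phi>) = range (twisted_sections.sect V sign)"
proof -
  interpret chi: T2_character chi using hom by unfold_locales
  interpret act: transitive_action T2 V \<phi> using free by (simp add: free_transitive_def)
  note eta = chi.chi_roots[OF ne 12 34]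
  obtain v0 where v0: "v0 \<in> V" using free by (auto simp: free_transitive_def)
  have comp: "\<phi> (g ** h) v = \<phi> g (\<phi> h v)" if "v \<in> V" "g \<in> carrier T2" "h \<in> carrier T2" for g h v
    using act.composition_rule[OF that] by (simp add: T2_mult)
  have closed: "\<phi> g v \<in> V" if "v \<in> V" "g \<in> carrier T2" for g v
    using act.element_image that by blast
  have inv: "inv\<^bsub>T2\<^esub> g \<in> carrier T2" if "g \<in> carrier T2" for g
    using that group.inv_closed[OF group_T2] by blast
  have inv_act: "\<phi> (inv\<^bsub>T2\<^esub> g) (\<phi> g v) = v" if "v \<in> V" "g \<in> carrier T2" for g v
    using act.orbit_sym_aux[OF that(2,1) refl] .
  \<comment> \<open>By freeness exactly one group element takes \<open>v0\<close> to
    \<open>v\<close>, so the choice is harmless.\<close>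
  define sign where "sign v = chi (SOME g. g \<in> carrier T2 \<and> \<phi> g v0 = v)" for v
  have sign: "sign (\<phi> g v0) = chi g" if g: "g \<in> carrier T2" for g
  proof -
    define g' where "g' = (SOME h. h \<in> carrier T2 \<and> \<phi> h v0 = \<phi> g v0)"
    have g': "g' \<in> carrier T2" "\<phi> g' v0 = \<phi> g v0"
      using someI[of "\<lambda>h. h \<in> carrier T2 \<and> \<phi> h v0 = \<phi> g v0" g] g by (simp_all add: g'_def)
    have "\<phi> (inv\<^bsub>T2\<^esub> g ** g') v0 = v0"
      using comp[OF v0 inv[OF g] g'(1)] inv_act[OF v0 g] g'(2) by simp
    then have "inv\<^bsub>T2\<^esub> g ** g' \<in> stabilizer T2 \<phi> v0"
      using T2_closed inv g g' by (simp add: stabilizer_def)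
    then have one: "inv\<^bsub>T2\<^esub> g ** g' = mat 1" using free v0 by (auto simp: free_transitive_def T2_one)
    have "chi g * chi g' = 1"
      using chi.chi_mult[OF inv[OF g] g'(1)] one chi.chi_one chi.chi_inv[OF g] by simp
    then have "chi g' = chi g" using chi.chi_values[OF g] chi.chi_values[OF g'(1)] by auto
    then show ?thesis by (simp add: sign_def g'_def)
  qed
  have one: "\<phi> (mat 1) v0 = v0"
    using act.id_eq_one v0 by (metis T2_one restrict_apply')
  interpret S: twisted_sections V v0 sign
    using v0 sign[OF chi.one_carrier] chi.chi_one one by unfold_locales simp_all
  have reach: "\<exists>g\<in>carrier T2. v = \<phi> g v0" if "v \<in> V" for v
    using act.unique_orbit[OF v0 that] by blast
  have sign_act: "sign (\<phi> h v) = chi h * sign v" if v: "v \<in> V" and h: "h \<in> carrier T2" for h v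
  proof -
    obtain g where g: "g \<in> carrier T2" "v = \<phi> g v0" using reach[OF v] by blast
    then have "\<phi> h v = \<phi> (h ** g) v0" using comp v0 h by simp
    then show ?thesis using sign g h T2_closed chi.chi_mult by simp
  qed
  define E where "E x \<longleftrightarrow> (\<forall>\<alpha>\<in>positive_roots. \<exists>m\<in>fibre. \<exists>n\<in>fibre. mk x = m + linear_form \<alpha> *s n \<and>
      Const (chi (exp_pi_i \<alpha>)) *s mk x = ext_map (reflection \<alpha>) m - linear_form \<alpha> *s ext_map (reflection \<alpha>) n)" for x
  have E_iff: "E x \<longleftrightarrow> gkm_cond x" for x
    unfolding E_def by (rule gkm_cond_iff) (simp_all only: root_vec_y[symmetric] eta 12 34)
  have "isotypical V \<phi> chi (H0_F1 V \<phi>) = range S.sect"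
  proof (intro equalityI subsetI)
    fix a assume "a \<in> isotypical V \<phi> chi (H0_F1 V \<phi>)"
    then have a: "a \<in> H0_F1 V \<phi>" "\<And>g. g \<in> carrier T2 \<Longrightarrow> translate V \<phi> g a = family_cscale (chi g) a"
      by (auto simp: isotypical_def)
    \<comment> \<open>Translation by g puts the value at \<open>v0\<close> on v = g
      \<open>v0\<close>, so \<open>a v0\<close> is chi g times \<open>a v\<close>; as chi g is its
      own inverse, the factor can change sides.\<close>
    have av: "a v = Const (sign v) *s a v0" if v: "v \<in> V" for v
    proof -
      obtain g where g: "g \<in> carrier T2" "v = \<phi> g v0" using reach[OF v] by blast
      have "translate V \<phi> g a v = Const (chi g) *s a v"
        unfolding a(2)[OF g(1)] by (simp add: family_cscale_def family_scale_def)
      then have "a v0 = Const (chi g) *s a v" using v g inv_act[OF v0 g(1)] by (simp add: translate_def)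
      then have "Const (chi g) *s a v0 = Const (chi g * chi g) *s a v" by (simp add: vec_eq_iff Const_mult mult.assoc)
      then show ?thesis using chi.chi_sq[OF g(1)] sign[OF g(1)] g(2) by (simp add: Const_one)
    qed
    have "a v0 \<in> fibre" using a(1) v0 by (auto simp: H0_F1_def)
    then obtain x where x: "a v0 = mk x" by (auto simp: fibre_eq)
    have "E x" unfolding E_def
    proof
      fix \<alpha> assume \<alpha>: "\<alpha> \<in> positive_roots"
      have h: "exp_pi_i \<alpha> \<in> carrier T2" using exp_pi_i_positive_roots_carrier[OF \<alpha>] .
      have h0: "a (\<phi> (exp_pi_i \<alpha>) v0) = Const (chi (exp_pi_i \<alpha>)) *s mk x"
        using av[OF closed[OF v0 h]] sign[OF h] x by simp
      have "\<exists>m\<in>fibre. \<exists>n\<in>fibre. a v0 = m + linear_form \<alpha> *s n \<and>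
        a (\<phi> (exp_pi_i \<alpha>) v0) = ext_map (reflection \<alpha>) m - linear_form \<alpha> *s ext_map (reflection \<alpha>) n"
        using a(1) \<alpha> v0 unfolding H0_F1_def by blast
      then show "\<exists>m\<in>fibre. \<exists>n\<in>fibre. mk x = m + linear_form \<alpha> *s n \<and>
        Const (chi (exp_pi_i \<alpha>)) *s mk x = ext_map (reflection \<alpha>) m - linear_form \<alpha> *s ext_map (reflection \<alpha>) n"
        unfolding h0 x .
    qed
    then obtain P where "\<And>i. i < 8 \<Longrightarrow> x i = coord P i" using E_iff gkm_cond_imp_coord by metis
    then have "a v0 = mk (coord P)" unfolding x by (rule mk_cong)
    moreover have "a v = 0" if "v \<notin> V" for v using a(1) that by (simp add: H0_F1_def)
    ultimately have "a = S.sect P" using av by (auto simp: S.sect_def fun_eq_iff)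
    then show "a \<in> range S.sect" by blast
  next
    fix a assume "a \<in> range S.sect"
    then obtain P where a: "a = S.sect P" by blast
    have "E (coord P)" using E_iff gkm_cond_coord by blast
    have "a \<in> H0_F1 V \<phi>"
      unfolding H0_F1_def
    proof (intro CollectI conjI allI ballI impI)
      show "a v = 0" if "v \<notin> V" for v using that by (simp add: a S.sect_def)
      show "a v \<in> fibre" if "v \<in> V" for v
        using that fibre_smult[OF sym_alg_Const, of "mk (coord P)"] by (simp add: a S.sect_def fibre_eq)
      fix \<alpha> v assume \<alpha>: "\<alpha> \<in> positive_roots" and v: "v \<in> V"
      have h: "exp_pi_i \<alpha> \<in> carrier T2" using exp_pi_i_positive_roots_carrier[OF \<alpha>] .
      obtain m n where mn: "m \<in> fibre" "n \<in> fibre" "mk (coord P) = m + linear_form \<alpha> *s n"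
        "Const (chi (exp_pi_i \<alpha>)) *s mk (coord P) = ext_map (reflection \<alpha>) m - linear_form \<alpha> *s ext_map (reflection \<alpha>) n"
        using \<open>E (coord P)\<close> \<alpha> unfolding E_def by blast
      \<comment> \<open>The decomposition at \<open>v0\<close>, multiplied by the sign of
        \<open>v\<close>, serves at \<open>v\<close>, since the edge condition is linear.\<close>
      have 1: "a v = Const (sign v) *s m + linear_form \<alpha> *s (Const (sign v) *s n)"
        using v by (simp add: a S.sect_def mn(3) vec_eq_iff distrib_left mult_ac)
      have "a (\<phi> (exp_pi_i \<alpha>) v) = Const (sign v) *s (Const (chi (exp_pi_i \<alpha>)) *s mk (coord P))"
        using closed[OF v h] sign_act[OF v h] by (simp add: a S.sect_def Const_mult vec_eq_iff mult_ac)
      then have 2: "a (\<phi> (exp_pi_i \<alpha>) v) = ext_map (reflection \<alpha>) (Const (sign v) *s m)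
          - linear_form \<alpha> *s ext_map (reflection \<alpha>) (Const (sign v) *s n)"
        unfolding mn(4) ext_map_smult by (simp add: vec_eq_iff right_diff_distrib mult_ac)
      show "\<exists>m\<in>fibre. \<exists>n\<in>fibre. a v = m + linear_form \<alpha> *s n \<and>
          a (\<phi> (exp_pi_i \<alpha>) v) = ext_map (reflection \<alpha>) m - linear_form \<alpha> *s ext_map (reflection \<alpha>) n"
        using 1 2 fibre_smult[OF sym_alg_Const mn(1)] fibre_smult[OF sym_alg_Const mn(2)] by blast
    qed
    moreover have "translate V \<phi> g a = family_cscale (chi g) a" if g: "g \<in> carrier T2" for g
    proof
      fix v
      have "Const (sign (\<phi> (inv\<^bsub>T2\<^esub> g) v)) = Const (chi g) * Const (sign v)" if "v \<in> V"
        using sign_act[OF that inv[OF g]] chi.chi_inv[OF g] by (simp add: Const_mult)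
      then show "translate V \<phi> g a v = family_cscale (chi g) a v"
        using closed[OF _ inv[OF g], of v]
        by (auto simp: translate_def family_cscale_def family_scale_def a S.sect_def vec_eq_iff mult.assoc)
    qed
    ultimately show "a \<in> isotypical V \<phi> chi (H0_F1 V \<phi>)" by (simp add: isotypical_def)
  qed
  then show thesis using that S.twisted_sections_axioms by blast
qed

theorem proposition4p17:
  fixes V :: "'v set"
    and \<phi> :: "complex^4^4 \<Rightarrow> 'v \<Rightarrow> 'v"
    and chi :: "complex^4^4 \<Rightarrow> complex"
  assumes "free_transitive T2 V \<phi>"
    and "chi \<in> hom T2 sign_group"
    and "\<exists>g\<in>carrier T2. chi g \<noteq> 1"
    and "chi (exp_pi_i (root_vec 1 2)) = 1"
    and "chi (exp_pi_i (root_vec 3 4)) = 1"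
  shows "\<not> free_over sym_alg family_scale (isotypical V \<phi> chi (H0_F1 V \<phi>))
    \<and> hilbert_series (isotypical V \<phi> chi (H0_F1 V \<phi>)) =
      (2 * fps_X ^ 7 + 4 * fps_X ^ 8 + 2 * fps_X ^ 9 + fps_X ^ 10 + fps_X ^ 11
        - fps_X ^ 12 - fps_X ^ 13) / (1 - fps_X ^ 2) ^ 3"
proof -
  obtain v0 sign where "twisted_sections V v0 sign"
    and iso: "isotypical V \<phi> chi (H0_F1 V \<phi>) = range (twisted_sections.sect V sign)"
    using isotypical_eq_sections[OF assms] .
  then interpret twisted_sections V v0 sign by simp
  show ?thesis unfolding iso using not_free_sect hilbert_series_sect by blast
qed

end
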